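(* Let $R$ be a Dedekind ring and let $H$ be a Hopf algebra over $R$ which is projective as an $R$-module. Then $H$ possesses a non-zero left integral if and only if $H$ is projective in ${}_{H^*}\mathcal M$. In particular, if $H$ possesses a non-zero left integral then $H$ is projective in $\mathcal M^H$.
   Context: A left integral on $H$ is an $R$-linear map $\varphi:H\to R$ with $\sum h_1\varphi(h_2)=\varphi(h)1$ for all $h\in H$. $H^*=\mathrm{Hom}_R(H,R)$ is an algebra under the convolution product, and ${}_{H^*}\mathcal M$ is the category of left $H^*$-modules. $\mathcal M^H$ is the category of right $H$-comodules; every right $H$-comodule $M$ is a left $H^*$-module via $f\cdot m=\sum m_0 f(m_1)$, and $H$ is regarded as a right comodule over itself by its coproduct, hence as a left $H^*$-module via $f\cdot h=\sum h_1f(h_2)$. *)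

theory Defs
  imports "HOL-Algebra.Algebra"
begin

section \<open>Dedekind rings\<close>

text \<open>The fraction \<open>a / b\<close> is the set of all pairs \<open>(c, d)\<close> with \<open>c / d = a / b\<close>.\<close>

definition fraction :: "('r, 'k) ring_scheme \<Rightarrow> 'r \<Rightarrow> 'r \<Rightarrow> ('r \<times> 'r) set" where
  "fraction R a b = {(c, d). c \<in> carrier R \<and> d \<in> carrier R - {\<zero>\<^bsub>R\<^esub>} \<and> a \<otimes>\<^bsub>R\<^esub> d = c \<otimes>\<^bsub>R\<^esub> b}"

definition fraction_field :: "('r, 'k) ring_scheme \<Rightarrow> ('r \<times> 'r) set ring" where
  "fraction_field R =
    \<lparr> carrier = {fraction R a b | a b. a \<in> carrier R \<and> b \<in> carrier R - {\<zero>\<^bsub>R\<^esub>}},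
      monoid.mult = (\<lambda>U V. \<Union>{fraction R (a \<otimes>\<^bsub>R\<^esub> c) (b \<otimes>\<^bsub>R\<^esub> d) | a b c d. (a, b) \<in> U \<and> (c, d) \<in> V}),
      monoid.one = fraction R \<one>\<^bsub>R\<^esub> \<one>\<^bsub>R\<^esub>,
      ring.zero = fraction R \<zero>\<^bsub>R\<^esub> \<one>\<^bsub>R\<^esub>,
      ring.add = (\<lambda>U V. \<Union>{fraction R (a \<otimes>\<^bsub>R\<^esub> d \<oplus>\<^bsub>R\<^esub> c \<otimes>\<^bsub>R\<^esub> b) (b \<otimes>\<^bsub>R\<^esub> d) | a b c d. (a, b) \<in> U \<and> (c, d) \<in> V}) \<rparr>"

text \<open>In HOL-Algebra a polynomial is the list of its coefficients, leading coefficient first;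
  so \<open>\<one> # cs\<close> is a monic polynomial of degree \<open>length cs\<close>.\<close>

definition integral_over :: "('a, 'k) ring_scheme \<Rightarrow> 'a set \<Rightarrow> 'a \<Rightarrow> bool" where
  "integral_over K A x \<longleftrightarrow> (\<exists>cs. set cs \<subseteq> A \<and> ring.eval K (\<one>\<^bsub>K\<^esub> # cs) x = \<zero>\<^bsub>K\<^esub>)"

definition integrally_closed :: "('r, 'k) ring_scheme \<Rightarrow> bool" where
  "integrally_closed R \<longleftrightarrow>
    (let A = (\<lambda>a. fraction R a \<one>\<^bsub>R\<^esub>) ` carrier R
     in \<forall>x\<in>carrier (fraction_field R). integral_over (fraction_field R) A x \<longrightarrow> x \<in> A)"

text \<open>Fields are Dedekind rings under this convention.\<close>

locale dedekind_ring = noetherian_domain R for R (structure) +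
  assumes integrally_closed: "integrally_closed R"
    and nonzero_prime_maximal: "\<lbrakk>primeideal P R; P \<noteq> {\<zero>}\<rbrakk> \<Longrightarrow> maximalideal P R"


section \<open>Modules over a not necessarily commutative ring\<close>

text \<open>The library's \<^locale>\<open>module\<close> requires a commutative base ring. Of a module record only
  \<open>carrier\<close>, \<open>zero\<close>, \<open>add\<close> and \<open>smult\<close> matter here.\<close>

locale left_module = A?: ring A + M?: abelian_group M
  for A :: "('a, 'k) ring_scheme" (structure) and M :: "('a, 'm) module" (structure) +
  assumes smult_closed [simp, intro]:
      "\<lbrakk>a \<in> carrier A; x \<in> carrier M\<rbrakk> \<Longrightarrow> a \<odot>\<^bsub>M\<^esub> x \<in> carrier M"
    and smult_l_distr:
      "\<lbrakk>a \<in> carrier A; b \<in> carrier A; x \<in> carrier M\<rbrakk> \<Longrightarrow>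
        (a \<oplus>\<^bsub>A\<^esub> b) \<odot>\<^bsub>M\<^esub> x = a \<odot>\<^bsub>M\<^esub> x \<oplus>\<^bsub>M\<^esub> b \<odot>\<^bsub>M\<^esub> x"
    and smult_r_distr:
      "\<lbrakk>a \<in> carrier A; x \<in> carrier M; y \<in> carrier M\<rbrakk> \<Longrightarrow>
        a \<odot>\<^bsub>M\<^esub> (x \<oplus>\<^bsub>M\<^esub> y) = a \<odot>\<^bsub>M\<^esub> x \<oplus>\<^bsub>M\<^esub> a \<odot>\<^bsub>M\<^esub> y"
    and smult_assoc1:
      "\<lbrakk>a \<in> carrier A; b \<in> carrier A; x \<in> carrier M\<rbrakk> \<Longrightarrow>
        (a \<otimes>\<^bsub>A\<^esub> b) \<odot>\<^bsub>M\<^esub> x = a \<odot>\<^bsub>M\<^esub> (b \<odot>\<^bsub>M\<^esub> x)"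
    and smult_one [simp]: "x \<in> carrier M \<Longrightarrow> \<one>\<^bsub>A\<^esub> \<odot>\<^bsub>M\<^esub> x = x"

definition lin_map ::
    "('a, 'k) ring_scheme \<Rightarrow> ('a, 'm) module \<Rightarrow> ('a, 'n) module \<Rightarrow> ('m \<Rightarrow> 'n) set" where
  "lin_map A M N = {f \<in> carrier M \<rightarrow> carrier N.
     (\<forall>x\<in>carrier M. \<forall>y\<in>carrier M. f (x \<oplus>\<^bsub>M\<^esub> y) = f x \<oplus>\<^bsub>N\<^esub> f y) \<and>
     (\<forall>a\<in>carrier A. \<forall>x\<in>carrier M. f (a \<odot>\<^bsub>M\<^esub> x) = a \<odot>\<^bsub>N\<^esub> f x)}"

definition regular_module :: "('a, 'k) ring_scheme \<Rightarrow> ('a, 'a) module" where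
  "regular_module A = \<lparr> carrier = carrier A, monoid.mult = monoid.mult A, monoid.one = \<one>\<^bsub>A\<^esub>,
     ring.zero = \<zero>\<^bsub>A\<^esub>, ring.add = ring.add A, smult = monoid.mult A \<rparr>"

definition free_module :: "('a, 'k) ring_scheme \<Rightarrow> 's set \<Rightarrow> ('a, 's \<Rightarrow> 'a) module" where
  "free_module A S =
    \<lparr> carrier = {x. range x \<subseteq> carrier A \<and> finite {p. x p \<noteq> \<zero>\<^bsub>A\<^esub>} \<and> {p. x p \<noteq> \<zero>\<^bsub>A\<^esub>} \<subseteq> S},
      monoid.mult = undefined, monoid.one = undefined,
      ring.zero = (\<lambda>p. \<zero>\<^bsub>A\<^esub>), ring.add = (\<lambda>x y p. x p \<oplus>\<^bsub>A\<^esub> y p), smult = (\<lambda>a x p. a \<otimes>\<^bsub>A\<^esub> x p) \<rparr>"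

definition basis_vector :: "('a, 'k) ring_scheme \<Rightarrow> 's \<Rightarrow> 's \<Rightarrow> 'a" where
  "basis_vector A p = (\<lambda>q. if q = p then \<one>\<^bsub>A\<^esub> else \<zero>\<^bsub>A\<^esub>)"

text \<open>The linear map that sends the basis vector \<open>p\<close> to \<open>b p\<close>.\<close>

definition lin_ext ::
    "('a, 'k) ring_scheme \<Rightarrow> ('a, 'n) module \<Rightarrow> ('s \<Rightarrow> 'n) \<Rightarrow> ('s \<Rightarrow> 'a) \<Rightarrow> 'n" where
  "lin_ext A N b x = (\<Oplus>\<^bsub>N\<^esub>p\<in>{p. x p \<noteq> \<zero>\<^bsub>A\<^esub>}. x p \<odot>\<^bsub>N\<^esub> b p)"

definition lifting_property ::
    "('a, 'k) ring_scheme \<Rightarrow> ('a, 'p) module \<Rightarrow> ('a, 'm) module \<Rightarrow> ('a, 'n) module \<Rightarrow> bool" where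
  "lifting_property A P M N \<longleftrightarrow>
    (\<forall>g\<in>lin_map A M N. \<forall>f\<in>lin_map A P N. g ` carrier M = carrier N \<longrightarrow>
      (\<exists>h\<in>lin_map A P M. \<forall>x\<in>carrier P. g (h x) = f x))"

text \<open>The lifting property of a projective module ranges over all modules, but a formula of HOL
  can only quantify over modules whose elements lie in a fixed type. The types chosen here have
  room for the free module on the elements of \<open>P\<close> and for \<open>P\<close> itself, and this
  suffices for lifting along surjections between modules over arbitrary types: see
  \<open>projective_module_lift\<close> below.\<close>

definition projective_module :: "('a, 'k) ring_scheme \<Rightarrow> ('a, 'p) module \<Rightarrow> bool" where
  "projective_module A P \<longleftrightarrow> left_module A P \<and>
    (\<forall>(M :: ('a, 'p \<Rightarrow> 'a) module) (N :: ('a, 'p) module).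
      left_module A M \<longrightarrow> left_module A N \<longrightarrow> lifting_property A P M N)"

lemma (in left_module) smult_l_null: "x \<in> carrier M \<Longrightarrow> \<zero>\<^bsub>A\<^esub> \<odot>\<^bsub>M\<^esub> x = \<zero>\<^bsub>M\<^esub>"
  by (metis A.l_zero A.zero_closed M.add.l_cancel_one' smult_closed smult_l_distr)

lemma (in left_module) smult_r_null: "a \<in> carrier A \<Longrightarrow> a \<odot>\<^bsub>M\<^esub> \<zero>\<^bsub>M\<^esub> = \<zero>\<^bsub>M\<^esub>"
  by (metis M.add.l_cancel_one' M.l_zero M.zero_closed smult_closed smult_r_distr)

lemma (in left_module) finsum_smult:
  assumes "finite T" "a \<in> carrier A" "f \<in> T \<rightarrow> carrier M"
  shows "a \<odot>\<^bsub>M\<^esub> (\<Oplus>\<^bsub>M\<^esub>i\<in>T. f i) = (\<Oplus>\<^bsub>M\<^esub>i\<in>T. a \<odot>\<^bsub>M\<^esub> f i)"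
  using assms by (induct set: finite) (auto simp: smult_r_null smult_r_distr Pi_def)

lemma module_imp_left_module: "module R M \<Longrightarrow> left_module R M"
  by (auto simp: module_def module_axioms_def left_module_def left_module_axioms_def cring_def)

lemma free_module_left_module:
  assumes "ring A" shows "left_module A (free_module A S)"
proof -
  interpret A: ring A by fact
  show ?thesis
  proof (intro left_module.intro left_module_axioms.intro abelian_groupI assms)
    fix x assume x: "x \<in> carrier (free_module A S)"
    have "(\<lambda>p. \<ominus>\<^bsub>A\<^esub> x p) \<in> carrier (free_module A S)"
    proof -
      have "{p. \<ominus>\<^bsub>A\<^esub> x p \<noteq> \<zero>\<^bsub>A\<^esub>} \<subseteq> {p. x p \<noteq> \<zero>\<^bsub>A\<^esub>}" by auto
      then show ?thesis using x by (auto simp: free_module_def dest: finite_subset)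
    qed
    moreover have "(\<lambda>p. \<ominus>\<^bsub>A\<^esub> x p) \<oplus>\<^bsub>free_module A S\<^esub> x = \<zero>\<^bsub>free_module A S\<^esub>"
      using x by (auto simp: free_module_def A.l_neg image_subset_iff)
    ultimately show "\<exists>y\<in>carrier (free_module A S). y \<oplus>\<^bsub>free_module A S\<^esub> x = \<zero>\<^bsub>free_module A S\<^esub>"
      by blast
  next
    fix x y assume x: "x \<in> carrier (free_module A S)" and y: "y \<in> carrier (free_module A S)"
    have s: "{p. x p \<oplus>\<^bsub>A\<^esub> y p \<noteq> \<zero>\<^bsub>A\<^esub>} \<subseteq> {p. x p \<noteq> \<zero>\<^bsub>A\<^esub>} \<union> {p. y p \<noteq> \<zero>\<^bsub>A\<^esub>}"
      by auto
    have "finite {p. x p \<oplus>\<^bsub>A\<^esub> y p \<noteq> \<zero>\<^bsub>A\<^esub>}"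
      by (rule finite_subset[OF s]) (use x y in \<open>auto simp: free_module_def\<close>)
    with s x y show "x \<oplus>\<^bsub>free_module A S\<^esub> y \<in> carrier (free_module A S)"
      by (auto simp: free_module_def image_subset_iff) 
  next
    fix a x assume a: "a \<in> carrier A" and x: "x \<in> carrier (free_module A S)"
    have s: "{p. a \<otimes>\<^bsub>A\<^esub> x p \<noteq> \<zero>\<^bsub>A\<^esub>} \<subseteq> {p. x p \<noteq> \<zero>\<^bsub>A\<^esub>}"
      using a by auto
    have "finite {p. a \<otimes>\<^bsub>A\<^esub> x p \<noteq> \<zero>\<^bsub>A\<^esub>}"
      by (rule finite_subset[OF s]) (use x in \<open>auto simp: free_module_def\<close>)
    with s x a show "a \<odot>\<^bsub>free_module A S\<^esub> x \<in> carrier (free_module A S)"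
      by (auto simp: free_module_def image_subset_iff)
  qed (auto simp: free_module_def image_subset_iff A.a_assoc A.l_distr A.r_distr A.m_assoc A.a_ac)
qed

context left_module begin

lemma lin_ext_superset:
  assumes b: "b \<in> S \<rightarrow> carrier M" and x: "x \<in> carrier (free_module A S)"
    and T: "finite T" "{p. x p \<noteq> \<zero>\<^bsub>A\<^esub>} \<subseteq> T" "T \<subseteq> S"
  shows "lin_ext A M b x = (\<Oplus>\<^bsub>M\<^esub>p\<in>T. x p \<odot>\<^bsub>M\<^esub> b p)"
  unfolding lin_ext_def
proof (rule M.add.finprod_mono_neutral_cong_left)
  show "finite T" "{p. x p \<noteq> \<zero>\<^bsub>A\<^esub>} \<subseteq> T" by fact+
  show "\<And>i. i \<in> T - {p. x p \<noteq> \<zero>\<^bsub>A\<^esub>} \<Longrightarrow> x i \<odot>\<^bsub>M\<^esub> b i = \<zero>\<^bsub>M\<^esub>"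
    using b T by (auto intro!: smult_l_null)
  show "(\<lambda>p. x p \<odot>\<^bsub>M\<^esub> b p) \<in> T \<rightarrow> carrier M"
    using b T x by (auto simp: free_module_def image_subset_iff Pi_iff)
qed auto

lemma lin_ext_lin_map:
  assumes b: "b \<in> S \<rightarrow> carrier M"
  shows "lin_ext A M b \<in> lin_map A (free_module A S) M"
proof -
  let ?F = "free_module A S"
  interpret F: left_module A ?F by (rule free_module_left_module) unfold_locales
  have fin: "finite {p. x p \<noteq> \<zero>\<^bsub>A\<^esub>}" "{p. x p \<noteq> \<zero>\<^bsub>A\<^esub>} \<subseteq> S" "\<And>p. x p \<in> carrier A"
    if "x \<in> carrier ?F" for x
    using that by (auto simp: free_module_def)
  have bc: "x p \<odot>\<^bsub>M\<^esub> b p \<in> carrier M" if "x \<in> carrier ?F" "p \<in> S" for x p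
    using that b fin by auto
  show ?thesis unfolding lin_map_def
  proof (intro CollectI conjI ballI funcsetI)
    fix x assume x: "x \<in> carrier ?F"
    show "lin_ext A M b x \<in> carrier M"
      unfolding lin_ext_def using bc[OF x] fin(2)[OF x] by (intro M.add.finprod_closed) auto
  next
    fix x y assume x: "x \<in> carrier ?F" and y: "y \<in> carrier ?F"
    let ?T = "{p. x p \<noteq> \<zero>\<^bsub>A\<^esub>} \<union> {p. y p \<noteq> \<zero>\<^bsub>A\<^esub>}"
    have T: "finite ?T" "?T \<subseteq> S" using fin[OF x] fin[OF y] by auto
    have xy: "x \<oplus>\<^bsub>?F\<^esub> y \<in> carrier ?F" using x y by simp
    have s: "{p. (x \<oplus>\<^bsub>?F\<^esub> y) p \<noteq> \<zero>\<^bsub>A\<^esub>} \<subseteq> ?T" by (auto simp: free_module_def)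
    have "lin_ext A M b (x \<oplus>\<^bsub>?F\<^esub> y) = (\<Oplus>\<^bsub>M\<^esub>p\<in>?T. (x \<oplus>\<^bsub>?F\<^esub> y) p \<odot>\<^bsub>M\<^esub> b p)"
      by (rule lin_ext_superset[OF b xy T(1) s T(2)])
    also have "\<dots> = (\<Oplus>\<^bsub>M\<^esub>p\<in>?T. x p \<odot>\<^bsub>M\<^esub> b p \<oplus>\<^bsub>M\<^esub> y p \<odot>\<^bsub>M\<^esub> b p)"
      using bc[OF x] bc[OF y] T(2) b fin(3)[OF x] fin(3)[OF y]
      by (intro M.add.finprod_cong') (auto simp: free_module_def smult_l_distr Pi_iff subset_iff)
    also have "\<dots> = (\<Oplus>\<^bsub>M\<^esub>p\<in>?T. x p \<odot>\<^bsub>M\<^esub> b p) \<oplus>\<^bsub>M\<^esub> (\<Oplus>\<^bsub>M\<^esub>p\<in>?T. y p \<odot>\<^bsub>M\<^esub> b p)"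
      using bc[OF x] bc[OF y] T(2) by (intro M.add.finprod_multf) auto
    also have "\<dots> = lin_ext A M b x \<oplus>\<^bsub>M\<^esub> lin_ext A M b y"
      using lin_ext_superset[OF b x T(1) _ T(2)] lin_ext_superset[OF b y T(1) _ T(2)] by simp
    finally show "lin_ext A M b (x \<oplus>\<^bsub>?F\<^esub> y) = lin_ext A M b x \<oplus>\<^bsub>M\<^esub> lin_ext A M b y" .
  next
    fix a x assume a: "a \<in> carrier A" and x: "x \<in> carrier ?F"
    let ?T = "{p. x p \<noteq> \<zero>\<^bsub>A\<^esub>}"
    have ax: "a \<odot>\<^bsub>?F\<^esub> x \<in> carrier ?F" using a x by simp
    have s: "{p. (a \<odot>\<^bsub>?F\<^esub> x) p \<noteq> \<zero>\<^bsub>A\<^esub>} \<subseteq> ?T" using a by (auto simp: free_module_def)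
    have "lin_ext A M b (a \<odot>\<^bsub>?F\<^esub> x) = (\<Oplus>\<^bsub>M\<^esub>p\<in>?T. (a \<odot>\<^bsub>?F\<^esub> x) p \<odot>\<^bsub>M\<^esub> b p)"
      by (rule lin_ext_superset[OF b ax fin(1)[OF x] s fin(2)[OF x]])
    also have "\<dots> = (\<Oplus>\<^bsub>M\<^esub>p\<in>?T. a \<odot>\<^bsub>M\<^esub> (x p \<odot>\<^bsub>M\<^esub> b p))"
      using bc[OF x] fin[OF x] b a
      by (intro M.add.finprod_cong') (auto simp: free_module_def smult_assoc1 Pi_iff subset_iff)
    also have "\<dots> = a \<odot>\<^bsub>M\<^esub> lin_ext A M b x"
      unfolding lin_ext_def using bc[OF x] fin[OF x] a by (intro finsum_smult[symmetric]) auto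
    finally show "lin_ext A M b (a \<odot>\<^bsub>?F\<^esub> x) = a \<odot>\<^bsub>M\<^esub> lin_ext A M b x" .
  qed
qed

lemma basis_vector_closed:
  assumes "p \<in> S" shows "basis_vector A p \<in> carrier (free_module A S)"
  using assms by (auto simp: free_module_def basis_vector_def)

lemma lin_ext_basis:
  assumes b: "b \<in> S \<rightarrow> carrier M" and p: "p \<in> S"
  shows "lin_ext A M b (basis_vector A p) = b p"
proof -
  have "lin_ext A M b (basis_vector A p) = (\<Oplus>\<^bsub>M\<^esub>q\<in>{p}. basis_vector A p q \<odot>\<^bsub>M\<^esub> b q)"
    using p by (intro lin_ext_superset[OF b basis_vector_closed]) (auto simp: basis_vector_def)
  also have "\<dots> = basis_vector A p p \<odot>\<^bsub>M\<^esub> b p \<oplus>\<^bsub>M\<^esub> (\<Oplus>\<^bsub>M\<^esub>q\<in>{}. basis_vector A p q \<odot>\<^bsub>M\<^esub> b q)"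
    using b p by (intro M.finsum_insert) (auto simp: basis_vector_def)
  finally have "lin_ext A M b (basis_vector A p) =
    basis_vector A p p \<odot>\<^bsub>M\<^esub> b p \<oplus>\<^bsub>M\<^esub> (\<Oplus>\<^bsub>M\<^esub>q\<in>{}. basis_vector A p q \<odot>\<^bsub>M\<^esub> b q)" .
  moreover have "b p \<in> carrier M" using b p by auto
  ultimately show ?thesis by (simp add: basis_vector_def)
qed

end

lemma lin_map_zero:
  assumes "left_module A M" "left_module A N" "f \<in> lin_map A M N"
  shows "f \<zero>\<^bsub>M\<^esub> = \<zero>\<^bsub>N\<^esub>"
proof -
  interpret M: left_module A M by fact
  interpret N: left_module A N by fact
  have "f (\<zero>\<^bsub>M\<^esub> \<oplus>\<^bsub>M\<^esub> \<zero>\<^bsub>M\<^esub>) = f \<zero>\<^bsub>M\<^esub> \<oplus>\<^bsub>N\<^esub> f \<zero>\<^bsub>M\<^esub>" "f \<zero>\<^bsub>M\<^esub> \<in> carrier N"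
    using assms(3) M.M.zero_closed unfolding lin_map_def by blast+
  then show ?thesis by simp
qed

lemma lin_map_finsum:
  assumes "left_module A M" "left_module A N" "f \<in> lin_map A M N"
    and "finite T" "u \<in> T \<rightarrow> carrier M"
  shows "f (\<Oplus>\<^bsub>M\<^esub>i\<in>T. u i) = (\<Oplus>\<^bsub>N\<^esub>i\<in>T. f (u i))"
proof -
  interpret M: left_module A M by fact
  interpret N: left_module A N by fact
  show ?thesis
    using assms(4,5)
  proof (induct set: finite)
    case empty then show ?case using lin_map_zero[OF assms(1-3)] by simp
  next
    case (insert i T)
    have c: "u \<in> T \<rightarrow> carrier M" "u i \<in> carrier M" "(\<Oplus>\<^bsub>M\<^esub>i\<in>T. u i) \<in> carrier M"
      using insert by auto
    have d: "(\<lambda>i. f (u i)) \<in> T \<rightarrow> carrier N" "f (u i) \<in> carrier N"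
      using c assms(3) by (auto simp: lin_map_def)
    have "f (u i \<oplus>\<^bsub>M\<^esub> (\<Oplus>\<^bsub>M\<^esub>i\<in>T. u i)) = f (u i) \<oplus>\<^bsub>N\<^esub> f (\<Oplus>\<^bsub>M\<^esub>i\<in>T. u i)"
      using c assms(3) unfolding lin_map_def by blast
    then show ?case using insert c d by simp
  qed
qed

lemma projective_module_lift:
  fixes A :: "('a, 'k) ring_scheme" and P :: "('a, 'p) module"
    and M :: "('a, 'm) module" and N :: "('a, 'n) module"
  assumes P: "projective_module A P" and M: "left_module A M" and N: "left_module A N"
  shows "lifting_property A P M N"
  unfolding lifting_property_def
proof (intro ballI impI)
  fix g f assume g: "g \<in> lin_map A M N" and f: "f \<in> lin_map A P N" and surj: "g ` carrier M = carrier N"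
  have lP: "left_module A P" using P by (simp add: projective_module_def)
  interpret P: left_module A P by fact
  interpret M: left_module A M by fact
  interpret N: left_module A N by fact
  let ?F = "free_module A (carrier P)"
  have lF: "left_module A ?F" by (rule free_module_left_module) unfold_locales
  define q where "q = lin_ext A P (\<lambda>p. p)"
  have idb: "(\<lambda>p. p) \<in> carrier P \<rightarrow> carrier P" by simp
  have q: "q \<in> lin_map A ?F P" unfolding q_def by (rule P.lin_ext_lin_map[OF idb])
  have "q ` carrier ?F = carrier P"
  proof (intro equalityI subsetI)
    fix y assume "y \<in> q ` carrier ?F" then show "y \<in> carrier P" using q by (auto simp: lin_map_def)
  next
    fix y assume y: "y \<in> carrier P"
    then have "y = q (basis_vector A y)" unfolding q_def using P.lin_ext_basis[OF idb y] by simp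
    then show "y \<in> q ` carrier ?F" using P.basis_vector_closed[OF y] by blast
  qed
  moreover have "id \<in> lin_map A P P" by (simp add: lin_map_def)
  moreover have "lifting_property A P ?F P"
    using P lF lP unfolding projective_module_def by blast
  ultimately have "\<exists>s\<in>lin_map A P ?F. \<forall>x\<in>carrier P. q (s x) = id x"
    using q unfolding lifting_property_def by blast
  then obtain s where s: "s \<in> lin_map A P ?F" "\<And>x. x \<in> carrier P \<Longrightarrow> q (s x) = x"
    by auto
  have "\<forall>p\<in>carrier P. \<exists>m. m \<in> carrier M \<and> g m = f p"
  proof
    fix p assume "p \<in> carrier P"
    then have "f p \<in> carrier N" using f by (auto simp: lin_map_def)
    then show "\<exists>m. m \<in> carrier M \<and> g m = f p" using surj by (metis imageE)
  qed
  then obtain b where "\<forall>p\<in>carrier P. b p \<in> carrier M \<and> g (b p) = f p" by (rule bchoice[THEN exE])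
  then have b: "b \<in> carrier P \<rightarrow> carrier M" "\<And>p. p \<in> carrier P \<Longrightarrow> g (b p) = f p" by auto
  define L where "L = lin_ext A M b"
  have L: "L \<in> lin_map A ?F M" unfolding L_def by (rule M.lin_ext_lin_map[OF b(1)])
  have gL: "g (L y) = f (q y)" if y: "y \<in> carrier ?F" for y
  proof -
    let ?T = "{p. y p \<noteq> \<zero>\<^bsub>A\<^esub>}"
    have T: "finite ?T" "?T \<subseteq> carrier P" "\<And>p. y p \<in> carrier A"
      using y by (auto simp: free_module_def)
    have "g (L y) = (\<Oplus>\<^bsub>N\<^esub>p\<in>?T. g (y p \<odot>\<^bsub>M\<^esub> b p))"
      unfolding L_def lin_ext_def using T b by (intro lin_map_finsum[OF M N g]) auto
    also have "\<dots> = (\<Oplus>\<^bsub>N\<^esub>p\<in>?T. f (y p \<odot>\<^bsub>P\<^esub> p))"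
    proof (intro N.add.finprod_cong' refl)
      show "(\<lambda>p. f (y p \<odot>\<^bsub>P\<^esub> p)) \<in> ?T \<rightarrow> carrier N" using f T by (auto simp: lin_map_def)
      fix p assume "p \<in> ?T"
      then have p: "p \<in> carrier P" "y p \<in> carrier A" "b p \<in> carrier M" using T b by auto
      then show "g (y p \<odot>\<^bsub>M\<^esub> b p) = f (y p \<odot>\<^bsub>P\<^esub> p)"
        using f g b(2) unfolding lin_map_def by auto
    qed
    also have "\<dots> = f (q y)"
      unfolding q_def lin_ext_def using T by (intro lin_map_finsum[OF lP N f, symmetric]) auto
    finally show ?thesis .
  qed
  have "L \<circ> s \<in> lin_map A P M"
    using L s(1) by (auto simp: lin_map_def Pi_iff)
  moreover have "\<forall>x\<in>carrier P. g ((L \<circ> s) x) = f x"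
  proof
    fix x assume x: "x \<in> carrier P"
    then have "s x \<in> carrier ?F" using s(1) by (auto simp: lin_map_def)
    then show "g ((L \<circ> s) x) = f x" using gL s(2)[OF x] by simp
  qed
  ultimately show "\<exists>h\<in>lin_map A P M. \<forall>x\<in>carrier P. g (h x) = f x" by blast
qed


section \<open>Tensor products\<close>

text \<open>\<open>M \<otimes> N\<close> is the free \<open>R\<close>-module on the pairs modulo the submodule generated by the
  bilinearity relations, each written as a difference \<open>x - y\<close>.\<close>

definition tensor_relators ::
    "('r, 'k) ring_scheme \<Rightarrow> ('r, 'm) module \<Rightarrow> ('r, 'n) module \<Rightarrow> ('m \<times> 'n \<Rightarrow> 'r) set" where
  "tensor_relators R M N =
    (let F = free_module R (carrier M \<times> carrier N); e = (\<lambda>m n. basis_vector R (m, n)) in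
      {e (m \<oplus>\<^bsub>M\<^esub> m') n \<ominus>\<^bsub>F\<^esub> (e m n \<oplus>\<^bsub>F\<^esub> e m' n) | m m' n.
          m \<in> carrier M \<and> m' \<in> carrier M \<and> n \<in> carrier N}
    \<union> {e m (n \<oplus>\<^bsub>N\<^esub> n') \<ominus>\<^bsub>F\<^esub> (e m n \<oplus>\<^bsub>F\<^esub> e m n') | m n n'.
          m \<in> carrier M \<and> n \<in> carrier N \<and> n' \<in> carrier N}
    \<union> {e (r \<odot>\<^bsub>M\<^esub> m) n \<ominus>\<^bsub>F\<^esub> r \<odot>\<^bsub>F\<^esub> e m n | r m n.
          r \<in> carrier R \<and> m \<in> carrier M \<and> n \<in> carrier N}
    \<union> {e m (r \<odot>\<^bsub>N\<^esub> n) \<ominus>\<^bsub>F\<^esub> r \<odot>\<^bsub>F\<^esub> e m n | r m n.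
          r \<in> carrier R \<and> m \<in> carrier M \<and> n \<in> carrier N})"

definition tensor_kernel ::
    "('r, 'k) ring_scheme \<Rightarrow> ('r, 'm) module \<Rightarrow> ('r, 'n) module \<Rightarrow> ('m \<times> 'n \<Rightarrow> 'r) set" where
  "tensor_kernel R M N =
    \<Inter>{K. submodule K R (free_module R (carrier M \<times> carrier N)) \<and> tensor_relators R M N \<subseteq> K}"

definition tensor ::
    "('r, 'k) ring_scheme \<Rightarrow> ('r, 'm) module \<Rightarrow> ('r, 'n) module \<Rightarrow> ('r, ('m \<times> 'n \<Rightarrow> 'r) set) module" where
  "tensor R M N =
    (let F = free_module R (carrier M \<times> carrier N); K = tensor_kernel R M N in
      \<lparr> carrier = a_rcosets\<^bsub>F\<^esub> K, monoid.mult = undefined, monoid.one = undefined,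
        ring.zero = K, ring.add = (\<lambda>U V. U <+>\<^bsub>F\<^esub> V), smult = (\<lambda>r U. \<Union>x\<in>U. K +>\<^bsub>F\<^esub> (r \<odot>\<^bsub>F\<^esub> x)) \<rparr>)"

definition pure_tensor ::
    "('r, 'k) ring_scheme \<Rightarrow> ('r, 'm) module \<Rightarrow> ('r, 'n) module \<Rightarrow> 'm \<Rightarrow> 'n \<Rightarrow> ('m \<times> 'n \<Rightarrow> 'r) set" where
  "pure_tensor R M N m n =
    tensor_kernel R M N +>\<^bsub>free_module R (carrier M \<times> carrier N)\<^esub> basis_vector R (m, n)"

text \<open>The linear map out of a tensor product into \<open>P\<close> that a bilinear map \<open>b\<close> induces: for
  \<open>U = \<Sum> m \<otimes> n\<close> the value is \<open>\<Sum> b m n\<close>. Bilinearity of \<open>b\<close> makes this independent of the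
  representative; see \<open>tensor_lift_pure\<close> and \<open>tensor_lift_lin_map\<close> below. With
  \<open>U = \<Delta> h\<close> this expresses Sweedler sums \<open>\<Sum> b h\<^sub>1 h\<^sub>2\<close>.\<close>

definition tensor_lift ::
    "('r, 'k) ring_scheme \<Rightarrow> ('r, 'p) module \<Rightarrow> ('m \<Rightarrow> 'n \<Rightarrow> 'p) \<Rightarrow> ('m \<times> 'n \<Rightarrow> 'r) set \<Rightarrow> 'p" where
  "tensor_lift R P b U =
    lin_ext R P (\<lambda>p. b (fst p) (snd p)) (SOME x. x \<in> U)"

definition bilinear_map ::
    "('r, 'k) ring_scheme \<Rightarrow> ('r, 'm) module \<Rightarrow> ('r, 'n) module \<Rightarrow> ('r, 'p) module \<Rightarrow> ('m \<Rightarrow> 'n \<Rightarrow> 'p) set" where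
  "bilinear_map R M N P = {b.
     (\<forall>n\<in>carrier N. (\<lambda>m. b m n) \<in> lin_map R M P) \<and> (\<forall>m\<in>carrier M. b m \<in> lin_map R N P)}"

lemma free_module_module:
  assumes "cring R" shows "module R (free_module R S)"
proof -
  interpret F: left_module R "free_module R S"
    using assms by (intro free_module_left_module) (simp add: cring_def)
  show ?thesis
    by (intro moduleI assms F.M.abelian_group_axioms)
       (auto simp: F.smult_l_distr F.smult_r_distr F.smult_assoc1)
qed

lemma tensor_kernel_submodule:
  assumes "cring R" "module R M" "module R N"
  shows "submodule (tensor_kernel R M N) R (free_module R (carrier M \<times> carrier N))"
    and "tensor_relators R M N \<subseteq> tensor_kernel R M N"
proof -
  let ?S = "carrier M \<times> carrier N" let ?F = "free_module R ?S"
  interpret F: module R ?F by (rule free_module_module) fact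
  interpret LF: left_module R ?F by (rule module_imp_left_module) unfold_locales
  interpret M: module R M by fact
  interpret N: module R N by fact
  have bv: "basis_vector R (m, n) \<in> carrier ?F" if "m \<in> carrier M" "n \<in> carrier N" for m n
    using that by (intro LF.basis_vector_closed) simp
  have c: "tensor_relators R M N \<subseteq> carrier ?F"
    unfolding tensor_relators_def Let_def by (auto intro!: bv F.M.minus_closed)
  let ?K = "{K. submodule K R ?F \<and> tensor_relators R M N \<subseteq> K}"
  have top: "carrier ?F \<in> ?K" using c F.carrier_is_submodule by simp
  show "tensor_relators R M N \<subseteq> tensor_kernel R M N" unfolding tensor_kernel_def by blast
  show "submodule (tensor_kernel R M N) R ?F"
  proof (rule F.submoduleI)
    show "tensor_kernel R M N \<subseteq> carrier ?F" unfolding tensor_kernel_def using top by blast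
    show "\<zero>\<^bsub>?F\<^esub> \<in> tensor_kernel R M N" unfolding tensor_kernel_def
      by (auto dest!: submodule.axioms(1) subgroup.one_closed)
    show "\<ominus>\<^bsub>?F\<^esub> a \<in> tensor_kernel R M N" if "a \<in> tensor_kernel R M N" for a
      using that F.submoduleE(3) unfolding tensor_kernel_def by blast
    show "a \<oplus>\<^bsub>?F\<^esub> b \<in> tensor_kernel R M N"
      if "a \<in> tensor_kernel R M N" "b \<in> tensor_kernel R M N" for a b
      using that F.submoduleE(5) unfolding tensor_kernel_def by blast
    show "a \<odot>\<^bsub>?F\<^esub> b \<in> tensor_kernel R M N" if "a \<in> carrier R" "b \<in> tensor_kernel R M N" for a b
      using that F.submoduleE(4) unfolding tensor_kernel_def by blast
  qed
qed

lemma lin_map_minus: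
  assumes "left_module A M" "left_module A N" "f \<in> lin_map A M N" "x \<in> carrier M"
  shows "f (\<ominus>\<^bsub>M\<^esub> x) = \<ominus>\<^bsub>N\<^esub> f x"
proof -
  interpret M: left_module A M by fact
  interpret N: left_module A N by fact
  have "f (\<ominus>\<^bsub>M\<^esub> x) \<oplus>\<^bsub>N\<^esub> f x = f (\<ominus>\<^bsub>M\<^esub> x \<oplus>\<^bsub>M\<^esub> x)" "f (\<ominus>\<^bsub>M\<^esub> x) \<in> carrier N" "f x \<in> carrier N"
    using assms(3,4) M.M.a_inv_closed[OF assms(4)] unfolding lin_map_def by auto
  then show ?thesis
    using lin_map_zero[OF assms(1-3)] assms(4) by (simp add: M.M.l_neg N.M.minus_equality)
qed

lemma tensor_lift_coset:
  assumes R: "cring R" and M: "module R M" and N: "module R N" and P: "module R P"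
    and b: "b \<in> bilinear_map R M N P"
    and x: "x \<in> carrier (free_module R (carrier M \<times> carrier N))"
  shows "tensor_lift R P b (tensor_kernel R M N +>\<^bsub>free_module R (carrier M \<times> carrier N)\<^esub> x)
    = lin_ext R P (\<lambda>p. b (fst p) (snd p)) x"
proof -
  let ?S = "carrier M \<times> carrier N" let ?F = "free_module R ?S" let ?K = "tensor_kernel R M N"
  let ?b = "\<lambda>p. b (fst p) (snd p)" let ?L = "lin_ext R P ?b"
  interpret F: module R ?F by (rule free_module_module) fact
  interpret LF: left_module R ?F by (rule module_imp_left_module) unfold_locales
  interpret M: module R M by fact
  interpret N: module R N by fact
  interpret P: left_module R P by (rule module_imp_left_module) fact
  have lF: "left_module R ?F" and lP: "left_module R P" by unfold_locales
  have bc: "?b \<in> ?S \<rightarrow> carrier P" using b by (auto simp: bilinear_map_def lin_map_def Pi_iff)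
  have L: "?L \<in> lin_map R ?F P" by (rule P.lin_ext_lin_map[OF bc])
  have Lc: "?L y \<in> carrier P" if "y \<in> carrier ?F" for y using L that by (auto simp: lin_map_def)
  have La: "?L (y \<oplus>\<^bsub>?F\<^esub> z) = ?L y \<oplus>\<^bsub>P\<^esub> ?L z" if "y \<in> carrier ?F" "z \<in> carrier ?F" for y z
    using L that by (auto simp: lin_map_def)
  have Ls: "?L (r \<odot>\<^bsub>?F\<^esub> y) = r \<odot>\<^bsub>P\<^esub> ?L y" if "r \<in> carrier R" "y \<in> carrier ?F" for r y
    using L that by (auto simp: lin_map_def)
  have Lm: "?L (y \<ominus>\<^bsub>?F\<^esub> z) = ?L y \<ominus>\<^bsub>P\<^esub> ?L z" if "y \<in> carrier ?F" "z \<in> carrier ?F" for y z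
    using that La lin_map_minus[OF lF lP L] by (simp add: a_minus_def)
  have bv: "basis_vector R (m, n) \<in> carrier ?F" "?L (basis_vector R (m, n)) = b m n"
    if "m \<in> carrier M" "n \<in> carrier N" for m n
    using that LF.basis_vector_closed[of "(m, n)"] P.lin_ext_basis[OF bc, of "(m, n)"] by auto
  let ?Z = "{y \<in> carrier ?F. ?L y = \<zero>\<^bsub>P\<^esub>}"
  have "submodule ?Z R ?F"
    using lin_map_minus[OF lF lP L]
    by (intro F.submoduleI)
       (auto simp: La Ls P.smult_r_null lin_map_zero[OF lF lP L])
  moreover have "tensor_relators R M N \<subseteq> ?Z"
    using b unfolding tensor_relators_def Let_def
    by (auto simp: Lm La Ls bv bilinear_map_def lin_map_def Pi_iff P.M.minus_eq P.M.r_neg)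
  ultimately have KZ: "?K \<subseteq> ?Z" unfolding tensor_kernel_def by blast
  let ?y = "SOME y. y \<in> ?K +>\<^bsub>?F\<^esub> x"
  have "\<zero>\<^bsub>?F\<^esub> \<in> ?K"
    using tensor_kernel_submodule(1)[OF R M N] by (auto dest!: submodule.axioms(1) subgroup.one_closed)
  then have "\<zero>\<^bsub>?F\<^esub> \<oplus>\<^bsub>?F\<^esub> x \<in> ?K +>\<^bsub>?F\<^esub> x" unfolding a_r_coset_def' by blast
  then have "?y \<in> ?K +>\<^bsub>?F\<^esub> x" by (rule someI[where P = "\<lambda>y. y \<in> ?K +>\<^bsub>?F\<^esub> x"])
  then obtain k where "k \<in> ?K" "?y = k \<oplus>\<^bsub>?F\<^esub> x" unfolding a_r_coset_def' by blast
  then have "?L ?y = ?L x" using KZ x La Lc by auto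
  then show ?thesis unfolding tensor_lift_def .
qed

lemma tensor_lift_pure:
  assumes "cring R" "module R M" "module R N" "module R P" "b \<in> bilinear_map R M N P"
    and m: "m \<in> carrier M" and n: "n \<in> carrier N"
  shows "tensor_lift R P b (pure_tensor R M N m n) = b m n"
proof -
  interpret P: left_module R P by (rule module_imp_left_module) fact
  have bc: "(\<lambda>p. b (fst p) (snd p)) \<in> carrier M \<times> carrier N \<rightarrow> carrier P"
    using assms(5) by (auto simp: bilinear_map_def lin_map_def Pi_iff)
  show ?thesis
    unfolding pure_tensor_def using m n
    by (simp add: tensor_lift_coset[OF assms(1-5)] P.basis_vector_closed P.lin_ext_basis[OF bc])
qed

lemma tensor_coset_ops:
  fixes R :: "('r, 'k) ring_scheme" and M :: "('r, 'm) module" and N :: "('r, 'n) module"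
  defines "F \<equiv> free_module R (carrier M \<times> carrier N)" and "K \<equiv> tensor_kernel R M N"
  assumes R: "cring R" and M: "module R M" and N: "module R N"
  shows "carrier (tensor R M N) = (\<lambda>x. K +>\<^bsub>F\<^esub> x) ` carrier F"
    and "\<lbrakk>x \<in> carrier F; y \<in> carrier F\<rbrakk> \<Longrightarrow>
      (K +>\<^bsub>F\<^esub> x) \<oplus>\<^bsub>tensor R M N\<^esub> (K +>\<^bsub>F\<^esub> y) = K +>\<^bsub>F\<^esub> (x \<oplus>\<^bsub>F\<^esub> y)"
    and "\<lbrakk>r \<in> carrier R; x \<in> carrier F\<rbrakk> \<Longrightarrow>
      r \<odot>\<^bsub>tensor R M N\<^esub> (K +>\<^bsub>F\<^esub> x) = K +>\<^bsub>F\<^esub> (r \<odot>\<^bsub>F\<^esub> x)"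
    and "\<zero>\<^bsub>tensor R M N\<^esub> = K +>\<^bsub>F\<^esub> \<zero>\<^bsub>F\<^esub>"
proof -
  interpret F: module R F unfolding F_def by (rule free_module_module) fact
  have K: "submodule K R F" unfolding F_def K_def by (rule tensor_kernel_submodule(1)) fact+
  interpret K: submodule K R F by fact
  interpret K: abelian_subgroup K F
    by (rule abelian_subgroupI3) (auto simp: additive_subgroup_def K.subgroup_axioms F.M.abelian_group_axioms)
  show "carrier (tensor R M N) = (\<lambda>x. K +>\<^bsub>F\<^esub> x) ` carrier F"
    unfolding tensor_def Let_def F_def[symmetric] K_def[symmetric] A_RCOSETS_def' by auto
  show "(K +>\<^bsub>F\<^esub> x) \<oplus>\<^bsub>tensor R M N\<^esub> (K +>\<^bsub>F\<^esub> y) = K +>\<^bsub>F\<^esub> (x \<oplus>\<^bsub>F\<^esub> y)"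
    if "x \<in> carrier F" "y \<in> carrier F"
    using K.a_rcos_sum[OF that] unfolding tensor_def Let_def F_def[symmetric] K_def[symmetric] by simp
  show "\<zero>\<^bsub>tensor R M N\<^esub> = K +>\<^bsub>F\<^esub> \<zero>\<^bsub>F\<^esub>"
    unfolding tensor_def Let_def F_def[symmetric] K_def[symmetric]
    using K.a_subset by (simp add: F.M.a_coset_add_zero)
  show "r \<odot>\<^bsub>tensor R M N\<^esub> (K +>\<^bsub>F\<^esub> x) = K +>\<^bsub>F\<^esub> (r \<odot>\<^bsub>F\<^esub> x)"
    if r: "r \<in> carrier R" and x: "x \<in> carrier F"
  proof -
    have "K +>\<^bsub>F\<^esub> (r \<odot>\<^bsub>F\<^esub> y) = K +>\<^bsub>F\<^esub> (r \<odot>\<^bsub>F\<^esub> x)" if y: "y \<in> K +>\<^bsub>F\<^esub> x" for y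
    proof -
      obtain k where k: "k \<in> K" "y = k \<oplus>\<^bsub>F\<^esub> x" using y unfolding a_r_coset_def' by blast
      have kc: "k \<in> carrier F" using k K.a_subset by blast
      have "r \<odot>\<^bsub>F\<^esub> y = r \<odot>\<^bsub>F\<^esub> k \<oplus>\<^bsub>F\<^esub> r \<odot>\<^bsub>F\<^esub> x" using k kc r x by (simp add: F.smult_r_distr)
      moreover have "r \<odot>\<^bsub>F\<^esub> k \<in> K" using r k by simp
      ultimately have "r \<odot>\<^bsub>F\<^esub> y \<in> K +>\<^bsub>F\<^esub> (r \<odot>\<^bsub>F\<^esub> x)" unfolding a_r_coset_def' by blast
      then show ?thesis by (rule K.a_repr_independence'[OF _ F.smult_closed[OF r x], symmetric])
    qed
    moreover have "x \<in> K +>\<^bsub>F\<^esub> x" by (rule K.a_rcos_self) fact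
    ultimately have "(\<Union>y\<in>K +>\<^bsub>F\<^esub> x. K +>\<^bsub>F\<^esub> (r \<odot>\<^bsub>F\<^esub> y)) = K +>\<^bsub>F\<^esub> (r \<odot>\<^bsub>F\<^esub> x)"
      by (intro UN_constant_eq ballI)
    then show ?thesis
      unfolding tensor_def Let_def F_def[symmetric] K_def[symmetric] by simp
  qed
qed

lemma tensor_module:
  assumes R: "cring R" and M: "module R M" and N: "module R N"
  shows "module R (tensor R M N)"
proof -
  let ?F = "free_module R (carrier M \<times> carrier N)"
  interpret F: module R ?F by (rule free_module_module) fact
  note ops = tensor_coset_ops[OF R M N]
  show ?thesis
  proof (intro moduleI abelian_groupI R)
    fix x assume "x \<in> carrier (tensor R M N)"
    then obtain u where u: "u \<in> carrier ?F" "x = tensor_kernel R M N +>\<^bsub>?F\<^esub> u" by (auto simp: ops)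
    then have "(tensor_kernel R M N +>\<^bsub>?F\<^esub> (\<ominus>\<^bsub>?F\<^esub> u)) \<oplus>\<^bsub>tensor R M N\<^esub> x = \<zero>\<^bsub>tensor R M N\<^esub>"
      by (simp add: ops F.M.l_neg)
    then show "\<exists>y\<in>carrier (tensor R M N). y \<oplus>\<^bsub>tensor R M N\<^esub> x = \<zero>\<^bsub>tensor R M N\<^esub>"
      using u by (auto simp: ops(1))
  qed (auto simp: ops F.smult_l_distr F.smult_r_distr F.smult_assoc1 F.M.a_ac)
qed

lemma tensor_lift_lin_map:
  assumes R: "cring R" and M: "module R M" and N: "module R N" and P: "module R P"
    and b: "b \<in> bilinear_map R M N P"
  shows "tensor_lift R P b \<in> lin_map R (tensor R M N) P"
proof -
  let ?F = "free_module R (carrier M \<times> carrier N)"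
  interpret F: module R ?F by (rule free_module_module) fact
  interpret P: left_module R P by (rule module_imp_left_module) fact
  have bc: "(\<lambda>p. b (fst p) (snd p)) \<in> carrier M \<times> carrier N \<rightarrow> carrier P"
    using b by (auto simp: bilinear_map_def lin_map_def Pi_iff)
  note L = P.lin_ext_lin_map[OF bc]
  show ?thesis
    using L unfolding lin_map_def
    by (auto simp: tensor_coset_ops[OF R M N] tensor_lift_coset[OF R M N P b])
qed

text \<open>\<open>f \<otimes> g : M \<otimes> N \<rightarrow> M' \<otimes> N'\<close>; the arguments are the target modules.\<close>

definition tensor_map ::
    "('r, 'k) ring_scheme \<Rightarrow> ('r, 'm2) module \<Rightarrow> ('r, 'n2) module \<Rightarrow> ('m \<Rightarrow> 'm2) \<Rightarrow> ('n \<Rightarrow> 'n2) \<Rightarrow>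
      ('m \<times> 'n \<Rightarrow> 'r) set \<Rightarrow> ('m2 \<times> 'n2 \<Rightarrow> 'r) set" where
  "tensor_map R M' N' f g =
    tensor_lift R (tensor R M' N') (\<lambda>m n. pure_tensor R M' N' (f m) (g n))"

text \<open>The isomorphism \<open>(M \<otimes> N) \<otimes> P \<rightarrow> M \<otimes> (N \<otimes> P)\<close>.\<close>

definition tensor_assoc ::
    "('r, 'k) ring_scheme \<Rightarrow> ('r, 'm) module \<Rightarrow> ('r, 'n) module \<Rightarrow> ('r, 'p) module \<Rightarrow>
      (('m \<times> 'n \<Rightarrow> 'r) set \<times> 'p \<Rightarrow> 'r) set \<Rightarrow> ('m \<times> ('n \<times> 'p \<Rightarrow> 'r) set \<Rightarrow> 'r) set" where
  "tensor_assoc R M N P =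
    (let T = tensor R M (tensor R N P) in
      tensor_lift R T (\<lambda>t p. tensor_lift R T
        (\<lambda>m n. pure_tensor R M (tensor R N P) m (pure_tensor R N P n p)) t))"

definition tensor_algebra ::
    "('r, 'k) ring_scheme \<Rightarrow> ('r, 'm) module \<Rightarrow> ('r, 'n) module \<Rightarrow> ('r, ('m \<times> 'n \<Rightarrow> 'r) set) module" where
  "tensor_algebra R A B =
    (tensor R A B)
      \<lparr> monoid.mult := (\<lambda>U V. tensor_lift R (tensor R A B) (\<lambda>a b. tensor_lift R (tensor R A B)
          (\<lambda>a' b'. pure_tensor R A B (a \<otimes>\<^bsub>A\<^esub> a') (b \<otimes>\<^bsub>B\<^esub> b')) V) U),
        monoid.one := pure_tensor R A B \<one>\<^bsub>A\<^esub> \<one>\<^bsub>B\<^esub> \<rparr>"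


section \<open>Hopf algebras and comodules\<close>

locale right_comodule =
  fixes R :: "('r, 'k) ring_scheme" and C :: "('r, 'c) module"
    and \<Delta> :: "'c \<Rightarrow> ('c \<times> 'c \<Rightarrow> 'r) set" and \<epsilon> :: "'c \<Rightarrow> 'r"
    and M :: "('r, 'm) module" and \<rho> :: "'m \<Rightarrow> ('m \<times> 'c \<Rightarrow> 'r) set"
  assumes module: "module R M"
    and coaction: "\<rho> \<in> lin_map R M (tensor R M C)"
    and coaction_assoc: "m \<in> carrier M \<Longrightarrow>
      tensor_assoc R M C C (tensor_map R (tensor R M C) C \<rho> id (\<rho> m))
        = tensor_map R M (tensor R C C) id \<Delta> (\<rho> m)"
    and coaction_counit: "m \<in> carrier M \<Longrightarrow> tensor_lift R M (\<lambda>x c. \<epsilon> c \<odot>\<^bsub>M\<^esub> x) (\<rho> m) = m"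

text \<open>A coalgebra is a right comodule over itself with the additional left counit law.\<close>

locale coalgebra = right_comodule R C \<Delta> \<epsilon> C \<Delta>
  for R :: "('r, 'k) ring_scheme" and C :: "('r, 'c) module" and \<Delta> and \<epsilon> +
  assumes counit: "\<epsilon> \<in> lin_map R C (regular_module R)"
    and left_counit: "c \<in> carrier C \<Longrightarrow> tensor_lift R C (\<lambda>x y. \<epsilon> x \<odot>\<^bsub>C\<^esub> y) (\<Delta> c) = c"

locale hopf_algebra = coalgebra R H \<Delta> \<epsilon> + ring H
  for R :: "('r, 'k) ring_scheme" and H :: "('r, 'h) module" and \<Delta> and \<epsilon> and S :: "'h \<Rightarrow> 'h" +
  assumes smult_mult_left: "\<lbrakk>r \<in> carrier R; x \<in> carrier H; y \<in> carrier H\<rbrakk> \<Longrightarrow>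
      (r \<odot>\<^bsub>H\<^esub> x) \<otimes>\<^bsub>H\<^esub> y = r \<odot>\<^bsub>H\<^esub> (x \<otimes>\<^bsub>H\<^esub> y)"
    and smult_mult_right: "\<lbrakk>r \<in> carrier R; x \<in> carrier H; y \<in> carrier H\<rbrakk> \<Longrightarrow>
      x \<otimes>\<^bsub>H\<^esub> (r \<odot>\<^bsub>H\<^esub> y) = r \<odot>\<^bsub>H\<^esub> (x \<otimes>\<^bsub>H\<^esub> y)"
    and comult_ring_hom: "\<Delta> \<in> ring_hom H (tensor_algebra R H H)"
    and counit_ring_hom: "\<epsilon> \<in> ring_hom H R"
    and antipode: "S \<in> lin_map R H H"
    and antipode_left: "h \<in> carrier H \<Longrightarrow>
      tensor_lift R H (\<lambda>x y. S x \<otimes>\<^bsub>H\<^esub> y) (\<Delta> h) = \<epsilon> h \<odot>\<^bsub>H\<^esub> \<one>\<^bsub>H\<^esub>"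
    and antipode_right: "h \<in> carrier H \<Longrightarrow>
      tensor_lift R H (\<lambda>x y. x \<otimes>\<^bsub>H\<^esub> S y) (\<Delta> h) = \<epsilon> h \<odot>\<^bsub>H\<^esub> \<one>\<^bsub>H\<^esub>"

text \<open>The convolution algebra \<open>C\<^sup>* = Hom\<^sub>R(C, R)\<close>; its elements are functions that are
  \<^const>\<open>undefined\<close> outside the carrier, so that equality of functions is equality in \<open>C\<^sup>*\<close>.\<close>

definition dual_algebra ::
    "('r, 'k) ring_scheme \<Rightarrow> ('r, 'c) module \<Rightarrow> ('c \<Rightarrow> ('c \<times> 'c \<Rightarrow> 'r) set) \<Rightarrow> ('c \<Rightarrow> 'r) \<Rightarrow>
      ('c \<Rightarrow> 'r) ring" where
  "dual_algebra R C \<Delta> \<epsilon> =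
    \<lparr> carrier = lin_map R C (regular_module R) \<inter> extensional (carrier C),
      monoid.mult = (\<lambda>f g. \<lambda>c\<in>carrier C. tensor_lift R (regular_module R) (\<lambda>x y. f x \<otimes>\<^bsub>R\<^esub> g y) (\<Delta> c)),
      monoid.one = (\<lambda>c\<in>carrier C. \<epsilon> c),
      ring.zero = (\<lambda>c\<in>carrier C. \<zero>\<^bsub>R\<^esub>),
      ring.add = (\<lambda>f g. \<lambda>c\<in>carrier C. f c \<oplus>\<^bsub>R\<^esub> g c) \<rparr>"

text \<open>A right comodule as a left \<open>C\<^sup>*\<close>-module: \<open>f \<cdot> m = \<Sum> f(m\<^sub>1) m\<^sub>0\<close>.\<close>

definition comodule_to_module ::
    "('r, 'k) ring_scheme \<Rightarrow> ('r, 'm) module \<Rightarrow> ('m \<Rightarrow> ('m \<times> 'c \<Rightarrow> 'r) set) \<Rightarrow>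
      ('c \<Rightarrow> 'r, 'm) module" where
  "comodule_to_module R M \<rho> =
    \<lparr> carrier = carrier M, monoid.mult = monoid.mult M, monoid.one = \<one>\<^bsub>M\<^esub>, ring.zero = \<zero>\<^bsub>M\<^esub>, ring.add = ring.add M,
      smult = (\<lambda>f m. tensor_lift R M (\<lambda>x c. f c \<odot>\<^bsub>M\<^esub> x) (\<rho> m)) \<rparr>"

definition left_integral ::
    "('r, 'k) ring_scheme \<Rightarrow> ('r, 'h) module \<Rightarrow> ('h \<Rightarrow> ('h \<times> 'h \<Rightarrow> 'r) set) \<Rightarrow> ('h \<Rightarrow> 'r) \<Rightarrow> bool" where
  "left_integral R H \<Delta> \<phi> \<longleftrightarrow> \<phi> \<in> lin_map R H (regular_module R) \<and>
    (\<forall>h\<in>carrier H. tensor_lift R H (\<lambda>x y. \<phi> y \<odot>\<^bsub>H\<^esub> x) (\<Delta> h) = \<phi> h \<odot>\<^bsub>H\<^esub> \<one>\<^bsub>H\<^esub>)"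

definition comodule_hom ::
    "('r, 'k) ring_scheme \<Rightarrow> ('r, 'c) module \<Rightarrow> ('r, 'm) module \<Rightarrow> ('m \<Rightarrow> ('m \<times> 'c \<Rightarrow> 'r) set) \<Rightarrow>
      ('r, 'n) module \<Rightarrow> ('n \<Rightarrow> ('n \<times> 'c \<Rightarrow> 'r) set) \<Rightarrow> ('m \<Rightarrow> 'n) set" where
  "comodule_hom R C M \<rho> N \<sigma> =
    {f \<in> lin_map R M N. \<forall>m\<in>carrier M. \<sigma> (f m) = tensor_map R N C f id (\<rho> m)}"

text \<open>The epimorphisms of the category of right comodules are the surjective comodule maps,
  since its forgetful functor to \<open>R\<close>-modules is a left adjoint (to \<open>- \<otimes> C\<close>). The types
  \<open>'m\<close> and \<open>'n\<close> of the elements of the comodules \<open>M\<close> and \<open>N\<close> are parameters, because HOL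
  cannot quantify over them inside the definition.\<close>

definition projective_comodule ::
    "'m itself \<Rightarrow> 'n itself \<Rightarrow> ('r, 'k) ring_scheme \<Rightarrow> ('r, 'c) module \<Rightarrow>
      ('c \<Rightarrow> ('c \<times> 'c \<Rightarrow> 'r) set) \<Rightarrow> ('c \<Rightarrow> 'r) \<Rightarrow>
      ('r, 'p) module \<Rightarrow> ('p \<Rightarrow> ('p \<times> 'c \<Rightarrow> 'r) set) \<Rightarrow> bool" where
  "projective_comodule _ _ R C \<Delta> \<epsilon> P \<pi> \<longleftrightarrow> right_comodule R C \<Delta> \<epsilon> P \<pi> \<and>
    (\<forall>(M :: ('r, 'm) module) \<rho> (N :: ('r, 'n) module) \<sigma>.
      right_comodule R C \<Delta> \<epsilon> M \<rho> \<longrightarrow> right_comodule R C \<Delta> \<epsilon> N \<sigma> \<longrightarrow>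
      (\<forall>g\<in>comodule_hom R C M \<rho> N \<sigma>. \<forall>f\<in>comodule_hom R C P \<pi> N \<sigma>. g ` carrier M = carrier N \<longrightarrow>
        (\<exists>h\<in>comodule_hom R C P \<pi> M \<rho>. \<forall>x\<in>carrier P. g (h x) = f x)))"

end

theory Submission
  imports Defs
begin

text \<open>
  Write \<open>H\<^sup>*\<close> for the convolution algebra and \<open>f \<cdot> h = \<Sum> f(h\<^sub>2) h\<^sub>1\<close> for its action on \<open>H\<close>.

  If \<open>H\<close> is projective over \<open>H\<^sup>*\<close>, it has a dual basis, whose coordinates are \<open>H\<^sup>*\<close>-linear maps
  \<open>s : H \<rightarrow> H\<^sup>*\<close>. For each of them \<open>\<phi> = s(1)\<close> satisfies \<open>f * \<phi> = s(f \<cdot> 1) = f(1) \<phi>\<close> for all \<open>f\<close>. This says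
  that \<open>\<phi>\<close> is a left integral, because functionals separate the elements of the projective \<open>R\<close>-module
  \<open>H\<close>. As \<open>1 \<noteq> 0\<close> in \<open>H\<close>, one of these integrals is non-zero (\<open>projective_imp_nonzero_integral\<close>).

  Conversely let \<open>\<phi>\<close> be a non-zero left integral. Then \<open>h \<mapsto> \<phi>(- S(h))\<close> is an \<open>H\<^sup>*\<close>-linear map from \<open>H\<close> to \<open>H\<^sup>*\<close>
  (\<open>sw_integral_antipode\<close>). Fix \<open>e \<in> H\<close> and let \<open>p\<^sup>*\<close> be the coordinates of a dual basis \<open>p\<close> of \<open>H\<close> over \<open>R\<close>.
  The maps \<open>t\<^sub>p(h) = \<Sum> p\<^sup>*(e h\<^sub>1) \<phi>(- S(h\<^sub>2))\<close> are still \<open>H\<^sup>*\<close>-linear, and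
  \<open>\<Sum>\<^sub>p t\<^sub>p(h)(p) = \<Sum> \<phi>(e h\<^sub>1 S(h\<^sub>2)) = \<phi>(e) \<epsilon>(h)\<close>; this implies \<open>\<Sum>\<^sub>p t\<^sub>p(h) \<cdot> p = \<phi>(e) h\<close>, so that multiplication by
  \<open>\<phi>(e)\<close> on \<open>H\<close> factors through a free \<open>H\<^sup>*\<close>-module (\<open>integral_factorization\<close>). If \<open>\<phi>(e) = 1\<close> for some
  \<open>e\<close>, this shows at once that \<open>H\<close> is projective over \<open>H\<^sup>*\<close>. In general the values of \<open>\<phi>\<close> form a
  non-zero ideal \<open>I\<close> of \<open>R\<close>. For each fraction \<open>q \<in> I\<^sup>-\<^sup>1\<close> the map \<open>q \<phi>\<close> has values in \<open>R\<close> and is again an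
  integral, so in a given lifting problem the scalars \<open>r\<close> for which the \<open>r\<close>-fold problem is solvable form an
  ideal that contains \<open>I\<^sup>-\<^sup>1 I\<close>. The ideal \<open>I\<close> of the Dedekind ring \<open>R\<close> is invertible (\<open>trace_ideal_unit\<close>),
  so \<open>1\<close> is among these scalars (\<open>nonzero_integral_imp_projective\<close>).

  For the statement on comodules, \<open>H\<close> is projective over \<open>R\<close>, hence functionals on \<open>H\<close> separate the
  elements of \<open>M \<otimes> H\<close> for every \<open>M\<close>. Therefore the \<open>H\<^sup>*\<close>-linear maps between comodules are
  precisely the comodule maps (\<open>comodule_hom_imp_dual_linear\<close>, \<open>dual_linear_imp_comodule_hom\<close>), and
  liftings over \<open>H\<^sup>*\<close> are liftings of comodules.
\<close>


section \<open>Ideals of Dedekind rings\<close>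

lemma Union_const: "\<lbrakk>U \<in> \<A>; \<And>V. V \<in> \<A> \<Longrightarrow> V = U\<rbrakk> \<Longrightarrow> \<Union>\<A> = U"
  by blast

context domain begin

lemma fraction_eq_iff:
  assumes "a \<in> carrier R" "b \<in> carrier R - {\<zero>}" "c \<in> carrier R" "d \<in> carrier R - {\<zero>}"
  shows "fraction R a b = fraction R c d \<longleftrightarrow> a \<otimes> d = c \<otimes> b"
proof
  assume "fraction R a b = fraction R c d"
  moreover have "(a, b) \<in> fraction R a b" using assms by (simp add: fraction_def)
  ultimately have "(a, b) \<in> fraction R c d" by simp
  then show "a \<otimes> d = c \<otimes> b" by (simp add: fraction_def)
next
  have sub: "fraction R a b \<subseteq> fraction R c d"
    if "a \<in> carrier R" "b \<in> carrier R - {\<zero>}" "c \<in> carrier R" "d \<in> carrier R - {\<zero>}"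
      and eq: "a \<otimes> d = c \<otimes> b" for a b c d
  proof (clarsimp simp: fraction_def)
    fix u v assume uv: "u \<in> carrier R" "v \<in> carrier R" "v \<noteq> \<zero>" "a \<otimes> v = u \<otimes> b"
    have "b \<otimes> (c \<otimes> v) = (c \<otimes> b) \<otimes> v" using that(1-4) uv(1-3) by (simp add: m_ac)
    also have "\<dots> = (a \<otimes> v) \<otimes> d" using that(1-4) uv(1-3) by (simp add: eq[symmetric] m_ac)
    also have "\<dots> = (u \<otimes> b) \<otimes> d" by (simp only: uv(4))
    also have "\<dots> = b \<otimes> (u \<otimes> d)" using that(1-4) uv(1-3) by (simp add: m_ac)
    finally show "c \<otimes> v = u \<otimes> d" using that uv m_lcancel by auto
  qed
  assume "a \<otimes> d = c \<otimes> b"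
  then show "fraction R a b = fraction R c d"
    using sub[of a b c d] sub[of c d a b] assms by auto
qed

lemma fraction_memD:
  assumes "a \<in> carrier R" "b \<in> carrier R - {\<zero>}" "(c, d) \<in> fraction R a b"
  shows "c \<in> carrier R" "d \<in> carrier R - {\<zero>}" "a \<otimes> d = c \<otimes> b"
  using assms by (auto simp: fraction_def)

text \<open>The operations of the fraction field are unions over all representatives. Independence of the
  representatives means that such a union ranges over a single set.\<close>

lemma fraction_mult:
  assumes "a \<in> carrier R" "b \<in> carrier R - {\<zero>}" "c \<in> carrier R" "d \<in> carrier R - {\<zero>}"
  shows "fraction R a b \<otimes>\<^bsub>fraction_field R\<^esub> fraction R c d = fraction R (a \<otimes> c) (b \<otimes> d)"
proof -
  have *: "fraction R (a' \<otimes> c') (b' \<otimes> d') = fraction R (a \<otimes> c) (b \<otimes> d)"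
    if "(a', b') \<in> fraction R a b" "(c', d') \<in> fraction R c d" for a' b' c' d'
  proof -
    note m = fraction_memD[OF assms(1,2) that(1)] fraction_memD[OF assms(3,4) that(2)]
    have "(a' \<otimes> c') \<otimes> (b \<otimes> d) = (a' \<otimes> b) \<otimes> (c' \<otimes> d)" using m(1,2,4,5) assms by (simp add: m_ac)
    also have "\<dots> = (a \<otimes> b') \<otimes> (c \<otimes> d')" by (simp only: m(3,6))
    also have "\<dots> = (a \<otimes> c) \<otimes> (b' \<otimes> d')" using m(1,2,4,5) assms by (simp add: m_ac)
    finally show ?thesis using m assms by (subst fraction_eq_iff) (auto simp: integral_iff)
  qed
  have mem: "(a, b) \<in> fraction R a b" "(c, d) \<in> fraction R c d" using assms by (auto simp: fraction_def)
  have "\<Union>{fraction R (a' \<otimes> c') (b' \<otimes> d') | a' b' c' d'.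
      (a', b') \<in> fraction R a b \<and> (c', d') \<in> fraction R c d} = fraction R (a \<otimes> c) (b \<otimes> d)" (is "\<Union>?Z = _")
  proof (rule Union_const)
    show "fraction R (a \<otimes> c) (b \<otimes> d) \<in> ?Z" by (intro CollectI exI conjI) (rule refl, fact+)
    show "V = fraction R (a \<otimes> c) (b \<otimes> d)" if "V \<in> ?Z" for V using that by (elim CollectE exE conjE) (simp only: *)
  qed
  then show ?thesis by (simp add: fraction_field_def)
qed

lemma fraction_add:
  assumes "a \<in> carrier R" "b \<in> carrier R - {\<zero>}" "c \<in> carrier R" "d \<in> carrier R - {\<zero>}"
  shows "fraction R a b \<oplus>\<^bsub>fraction_field R\<^esub> fraction R c d = fraction R (a \<otimes> d \<oplus> c \<otimes> b) (b \<otimes> d)"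
proof -
  have *: "fraction R (a' \<otimes> d' \<oplus> c' \<otimes> b') (b' \<otimes> d') = fraction R (a \<otimes> d \<oplus> c \<otimes> b) (b \<otimes> d)"
    if "(a', b') \<in> fraction R a b" "(c', d') \<in> fraction R c d" for a' b' c' d'
  proof -
    note m = fraction_memD[OF assms(1,2) that(1)] fraction_memD[OF assms(3,4) that(2)]
    have "(a' \<otimes> d' \<oplus> c' \<otimes> b') \<otimes> (b \<otimes> d) = (a' \<otimes> b) \<otimes> (d' \<otimes> d) \<oplus> (c' \<otimes> d) \<otimes> (b' \<otimes> b)"
      using m(1,2,4,5) assms by (simp add: l_distr r_distr m_ac)
    also have "\<dots> = (a \<otimes> b') \<otimes> (d' \<otimes> d) \<oplus> (c \<otimes> d') \<otimes> (b' \<otimes> b)" by (simp only: m(3,6))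
    also have "\<dots> = (a \<otimes> d \<oplus> c \<otimes> b) \<otimes> (b' \<otimes> d')"
      using m(1,2,4,5) assms by (simp add: l_distr r_distr m_ac)
    finally show ?thesis using m assms by (subst fraction_eq_iff) (auto simp: integral_iff)
  qed
  have mem: "(a, b) \<in> fraction R a b" "(c, d) \<in> fraction R c d" using assms by (auto simp: fraction_def)
  have "\<Union>{fraction R (a' \<otimes> d' \<oplus> c' \<otimes> b') (b' \<otimes> d') | a' b' c' d'.
      (a', b') \<in> fraction R a b \<and> (c', d') \<in> fraction R c d} = fraction R (a \<otimes> d \<oplus> c \<otimes> b) (b \<otimes> d)" (is "\<Union>?Z = _")
  proof (rule Union_const)
    show "fraction R (a \<otimes> d \<oplus> c \<otimes> b) (b \<otimes> d) \<in> ?Z" by (intro CollectI exI conjI) (rule refl, fact+)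
    show "V = fraction R (a \<otimes> d \<oplus> c \<otimes> b) (b \<otimes> d)" if "V \<in> ?Z" for V using that by (elim CollectE exE conjE) (simp only: *)
  qed
  then show ?thesis by (simp add: fraction_field_def)
qed

lemma fraction_field_simps:
  "\<one>\<^bsub>fraction_field R\<^esub> = fraction R \<one> \<one>" "\<zero>\<^bsub>fraction_field R\<^esub> = fraction R \<zero> \<one>"
  by (simp_all add: fraction_field_def)

lemma fraction_closed:
  "\<lbrakk>a \<in> carrier R; b \<in> carrier R - {\<zero>}\<rbrakk> \<Longrightarrow> fraction R a b \<in> carrier (fraction_field R)"
  by (auto simp: fraction_field_def)

lemma fraction_cases:
  assumes "x \<in> carrier (fraction_field R)"
  obtains a b where "a \<in> carrier R" "b \<in> carrier R" "b \<noteq> \<zero>" "x = fraction R a b"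
  using assms by (auto simp: fraction_field_def)

text \<open>The recursion equations of \<^const>\<open>ring.eval\<close> hold in rings, so this is what makes
  \<^const>\<open>integral_over\<close> computable.\<close>

lemma fraction_field_ring: "ring (fraction_field R)"
proof (intro ringI abelian_groupI monoidI)
  fix x assume x: "x \<in> carrier (fraction_field R)"
  then obtain a b where ab: "a \<in> carrier R" "b \<in> carrier R" "b \<noteq> \<zero>" "x = fraction R a b"
    by (rule fraction_cases)
  have "fraction R (\<ominus> a) b \<oplus>\<^bsub>fraction_field R\<^esub> x = \<zero>\<^bsub>fraction_field R\<^esub>"
    using ab by (simp add: fraction_add fraction_field_simps fraction_eq_iff integral_iff l_minus l_neg)
  then show "\<exists>y\<in>carrier (fraction_field R). y \<oplus>\<^bsub>fraction_field R\<^esub> x = \<zero>\<^bsub>fraction_field R\<^esub>"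
    using ab by (intro bexI[of _ "fraction R (\<ominus> a) b"] fraction_closed) auto
next
  fix x y z
  assume xyz: "x \<in> carrier (fraction_field R)" "y \<in> carrier (fraction_field R)" "z \<in> carrier (fraction_field R)"
  obtain a b where r1: "a \<in> carrier R" "b \<in> carrier R" "b \<noteq> \<zero>" "x = fraction R a b"
    using xyz(1) by (rule fraction_cases)
  obtain c d where r2: "c \<in> carrier R" "d \<in> carrier R" "d \<noteq> \<zero>" "y = fraction R c d"
    using xyz(2) by (rule fraction_cases)
  obtain e g where r3: "e \<in> carrier R" "g \<in> carrier R" "g \<noteq> \<zero>" "z = fraction R e g"
    using xyz(3) by (rule fraction_cases)
  note r = r1 r2 r3
  have bd: "b \<otimes> d \<noteq> \<zero>" "d \<otimes> g \<noteq> \<zero>" "b \<otimes> g \<noteq> \<zero>" "b \<otimes> (d \<otimes> g) \<noteq> \<zero>"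
      "b \<otimes> g \<otimes> (d \<otimes> g) \<noteq> \<zero>" "g \<otimes> b \<noteq> \<zero>" "g \<otimes> d \<noteq> \<zero>" "g \<otimes> b \<otimes> (g \<otimes> d) \<noteq> \<zero>" "g \<otimes> (b \<otimes> d) \<noteq> \<zero>"
    using r by (simp_all add: integral_iff)
  show "x \<oplus>\<^bsub>fraction_field R\<^esub> y \<oplus>\<^bsub>fraction_field R\<^esub> z = x \<oplus>\<^bsub>fraction_field R\<^esub> (y \<oplus>\<^bsub>fraction_field R\<^esub> z)"
    using r(1-3,5-7,9-11) bd unfolding r(4,8,12) by (simp add: fraction_add l_distr r_distr m_ac a_ac)
  show "x \<otimes>\<^bsub>fraction_field R\<^esub> y \<otimes>\<^bsub>fraction_field R\<^esub> z = x \<otimes>\<^bsub>fraction_field R\<^esub> (y \<otimes>\<^bsub>fraction_field R\<^esub> z)"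
    using r(1-3,5-7,9-11) bd unfolding r(4,8,12) by (simp add: fraction_mult m_assoc)
  show "(x \<oplus>\<^bsub>fraction_field R\<^esub> y) \<otimes>\<^bsub>fraction_field R\<^esub> z =
      x \<otimes>\<^bsub>fraction_field R\<^esub> z \<oplus>\<^bsub>fraction_field R\<^esub> y \<otimes>\<^bsub>fraction_field R\<^esub> z"
  proof -
    have "((a \<otimes> d \<oplus> c \<otimes> b) \<otimes> e) \<otimes> (b \<otimes> g \<otimes> (d \<otimes> g)) =
        (a \<otimes> e \<otimes> (d \<otimes> g) \<oplus> c \<otimes> e \<otimes> (b \<otimes> g)) \<otimes> (b \<otimes> d \<otimes> g)"
      using r(1-3,5-7,9-11) by (simp add: l_distr r_distr m_ac)
    then show ?thesis using r(1-3,5-7,9-11) bd unfolding r(4,8,12)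
      by (simp add: fraction_add fraction_mult fraction_eq_iff m_assoc)
  qed
  show "z \<otimes>\<^bsub>fraction_field R\<^esub> (x \<oplus>\<^bsub>fraction_field R\<^esub> y) =
      z \<otimes>\<^bsub>fraction_field R\<^esub> x \<oplus>\<^bsub>fraction_field R\<^esub> z \<otimes>\<^bsub>fraction_field R\<^esub> y"
  proof -
    have "(e \<otimes> (a \<otimes> d \<oplus> c \<otimes> b)) \<otimes> (g \<otimes> b \<otimes> (g \<otimes> d)) =
        (e \<otimes> a \<otimes> (g \<otimes> d) \<oplus> e \<otimes> c \<otimes> (g \<otimes> b)) \<otimes> (g \<otimes> (b \<otimes> d))"
      using r(1-3,5-7,9-11) by (simp add: r_distr l_distr m_ac)
    then show ?thesis using r(1-3,5-7,9-11) bd unfolding r(4,8,12)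
      by (simp add: fraction_add fraction_mult fraction_eq_iff)
  qed
next
  fix x y
  assume xy: "x \<in> carrier (fraction_field R)" "y \<in> carrier (fraction_field R)"
  obtain a b where r1: "a \<in> carrier R" "b \<in> carrier R" "b \<noteq> \<zero>" "x = fraction R a b"
    using xy(1) by (rule fraction_cases)
  obtain c d where r2: "c \<in> carrier R" "d \<in> carrier R" "d \<noteq> \<zero>" "y = fraction R c d"
    using xy(2) by (rule fraction_cases)
  note r = r1 r2
  show "x \<oplus>\<^bsub>fraction_field R\<^esub> y \<in> carrier (fraction_field R)"
    "x \<otimes>\<^bsub>fraction_field R\<^esub> y \<in> carrier (fraction_field R)"
    "x \<oplus>\<^bsub>fraction_field R\<^esub> y = y \<oplus>\<^bsub>fraction_field R\<^esub> x"
    using r by (auto simp: fraction_add fraction_mult integral_iff m_comm a_comm intro!: fraction_closed)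
next
  fix x assume "x \<in> carrier (fraction_field R)"
  then obtain a b where ab: "a \<in> carrier R" "b \<in> carrier R" "b \<noteq> \<zero>" "x = fraction R a b"
    by (rule fraction_cases)
  then show "\<zero>\<^bsub>fraction_field R\<^esub> \<oplus>\<^bsub>fraction_field R\<^esub> x = x"
    "\<one>\<^bsub>fraction_field R\<^esub> \<otimes>\<^bsub>fraction_field R\<^esub> x = x"
    "x \<otimes>\<^bsub>fraction_field R\<^esub> \<one>\<^bsub>fraction_field R\<^esub> = x"
    by (simp_all add: fraction_field_simps fraction_mult fraction_add)
next
  show "\<zero>\<^bsub>fraction_field R\<^esub> \<in> carrier (fraction_field R)"
    "\<one>\<^bsub>fraction_field R\<^esub> \<in> carrier (fraction_field R)"
    unfolding fraction_field_simps by (rule fraction_closed; simp)+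
qed

end

text \<open>Zorn's lemma applies because a chain of ideals of a noetherian ring contains its union.\<close>

lemma (in noetherian_ring) exists_maximal_ideal_in:
  assumes "I\<^sub>0 \<in> \<A>" and id: "\<And>I. I \<in> \<A> \<Longrightarrow> ideal I R"
  obtains I where "I \<in> \<A>" "I\<^sub>0 \<subseteq> I" "\<And>J. \<lbrakk>J \<in> \<A>; I \<subseteq> J\<rbrakk> \<Longrightarrow> J = I"
proof -
  have "\<exists>I\<in>{I \<in> \<A>. I\<^sub>0 \<subseteq> I}. \<forall>J\<in>{I \<in> \<A>. I\<^sub>0 \<subseteq> I}. I \<subseteq> J \<longrightarrow> J = I"
  proof (rule subset_Zorn_nonempty)
    show "{I \<in> \<A>. I\<^sub>0 \<subseteq> I} \<noteq> {}" using assms(1) by auto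
    fix C assume "C \<noteq> {}" and C: "subset.chain {I \<in> \<A>. I\<^sub>0 \<subseteq> I} C"
    moreover have "subset.chain {I. ideal I R} C" using C id unfolding pred_on.chain_def by auto
    ultimately have "\<Union>C \<in> C" by (intro ideal_chain_is_trivial)
    then show "\<Union>C \<in> {I \<in> \<A>. I\<^sub>0 \<subseteq> I}" using C unfolding pred_on.chain_def by auto
  qed
  then show thesis using that by auto
qed

text \<open>The ideal quotient \<open>(dR : c)\<close>, which is the annihilator of \<open>c\<close> in \<open>R/dR\<close>.\<close>

definition (in ring) colon :: "'a \<Rightarrow> 'a \<Rightarrow> 'a set" where
  "colon d c = {s \<in> carrier R. \<exists>t\<in>carrier R. s \<otimes> c = d \<otimes> t}"

lemma (in cring) colon_ideal:
  assumes "d \<in> carrier R" "c \<in> carrier R"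
  shows "ideal (colon d c) R"
proof (rule idealI)
  show "ring R" by (rule ring_axioms)
  show "subgroup (colon d c) (add_monoid R)"
  proof (rule add.subgroupI)
    show "colon d c \<subseteq> carrier R" by (auto simp: colon_def)
    have "\<zero> \<in> colon d c" using assms by (auto simp: colon_def intro!: bexI[of _ \<zero>])
    then show "colon d c \<noteq> {}" by auto
    show "\<ominus> a \<in> colon d c" if a: "a \<in> colon d c" for a
    proof -
      obtain t where "a \<in> carrier R" "t \<in> carrier R" "a \<otimes> c = d \<otimes> t"
        using a by (auto simp: colon_def)
      then show ?thesis using assms by (auto simp: colon_def l_minus r_minus intro!: bexI[of _ "\<ominus> t"])
    qed
    fix a b assume "a \<in> colon d c" "b \<in> colon d c"
    then obtain t u where "a \<in> carrier R" "b \<in> carrier R" "t \<in> carrier R" "u \<in> carrier R"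
      "a \<otimes> c = d \<otimes> t" "b \<otimes> c = d \<otimes> u" by (auto simp: colon_def)
    then show "a \<oplus> b \<in> colon d c" using assms
      by (auto simp: colon_def l_distr r_distr intro!: bexI[of _ "t \<oplus> u"])
  qed
  fix a x assume "a \<in> colon d c" and x: "x \<in> carrier R"
  then obtain t where "a \<in> carrier R" "t \<in> carrier R" "a \<otimes> c = d \<otimes> t" by (auto simp: colon_def)
  then have *: "x \<otimes> a \<otimes> c = d \<otimes> (x \<otimes> t)" "a \<in> carrier R" "t \<in> carrier R"
    using assms x by (simp_all add: m_assoc m_lcomm)
  then show "x \<otimes> a \<in> colon d c" using x by (auto simp: colon_def intro!: bexI[of _ "x \<otimes> t"])
  then show "a \<otimes> x \<in> colon d c" using * x by (simp add: m_comm)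
qed

context noetherian_domain begin

text \<open>The fraction \<open>c / d\<close> lies in \<open>J\<^sup>-\<^sup>1\<close> but not in \<open>R\<close>. Let \<open>P\<close> be a maximal ideal that contains \<open>J\<close>. Among
  the annihilators \<open>(dR : c)\<close> that are contained in \<open>P\<close>, a maximal one is prime. It contains \<open>d \<noteq> 0\<close>, so it
  is a maximal ideal and therefore equal to \<open>P\<close>; this says that \<open>cP \<subseteq> dR\<close>.\<close>

lemma proper_ideal_inverse_nontrivial:
  assumes dim1: "\<And>P. \<lbrakk>primeideal P R; P \<noteq> {\<zero>}\<rbrakk> \<Longrightarrow> maximalideal P R"
    and J: "ideal J R" "J \<noteq> carrier R" and d: "d \<in> J" "d \<noteq> \<zero>"
  obtains c where "c \<in> carrier R" "\<not> (\<exists>t\<in>carrier R. c = d \<otimes> t)"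
    "\<And>x. x \<in> J \<Longrightarrow> \<exists>t\<in>carrier R. x \<otimes> c = d \<otimes> t"
proof -
  have "J \<in> {I. ideal I R \<and> I \<noteq> carrier R}" using J by simp
  then obtain P where P': "P \<in> {I. ideal I R \<and> I \<noteq> carrier R}" "J \<subseteq> P"
    and Pm': "\<And>J. \<lbrakk>J \<in> {I. ideal I R \<and> I \<noteq> carrier R}; P \<subseteq> J\<rbrakk> \<Longrightarrow> J = P"
    by (rule exists_maximal_ideal_in) blast+
  have P: "ideal P R" "P \<noteq> carrier R" "J \<subseteq> P" using P' by simp_all
  have Pm: "\<And>J. \<lbrakk>ideal J R; J \<noteq> carrier R; P \<subseteq> J\<rbrakk> \<Longrightarrow> J = P" using Pm' by simp
  interpret P: ideal P R by fact
  have "maximalideal P R" using P Pm by (intro maximalidealI) auto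
  then have Pp: "primeideal P R" by (rule maximalideal_prime)
  have dP: "d \<in> P" and dR: "d \<in> carrier R" using P d P.a_subset by auto
  let ?A = "{I. \<exists>c\<in>carrier R. I = colon d c \<and> colon d c \<subseteq> P}"
  have c1: "colon d \<one> \<in> ?A" using dP dR P.I_r_closed by (auto simp: colon_def)
  obtain Q where Q: "Q \<in> ?A" and Qm: "\<And>J. \<lbrakk>J \<in> ?A; Q \<subseteq> J\<rbrakk> \<Longrightarrow> J = Q"
  proof (rule exists_maximal_ideal_in[OF c1])
    show "ideal I R" if "I \<in> ?A" for I using that colon_ideal dR by auto
  qed blast
  then obtain c where c: "c \<in> carrier R" "Q = colon d c" "Q \<subseteq> P" by auto
  have Qi: "ideal Q R" using c dR colon_ideal by auto
  have dQ: "d \<in> Q" using c dR by (auto simp: colon_def)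
  have nQ: "Q \<noteq> carrier R" using c P P.a_subset by auto
  have "primeideal Q R"
  proof (rule primeidealI[OF Qi is_cring nQ[symmetric]])
    fix a b assume a: "a \<in> carrier R" and b: "b \<in> carrier R" and ab: "a \<otimes> b \<in> Q"
    show "a \<in> Q \<or> b \<in> Q"
    proof (rule ccontr)
      assume no: "\<not> (a \<in> Q \<or> b \<in> Q)"
      \<comment> \<open>\<open>(dR : ac)\<close> contains \<open>Q\<close> and \<open>b\<close>, so maximality of \<open>Q\<close> gives \<open>s \<notin> P\<close> in it. Now \<open>(dR : sc)\<close>
        contains \<open>Q\<close> and \<open>a\<close>, so it has an element \<open>t \<notin> P\<close>, although \<open>ts \<in> Q \<subseteq> P\<close>.\<close>
      have mono: "Q \<subseteq> colon d (a \<otimes> c)" if a: "a \<in> carrier R" for a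
      proof
        fix x assume "x \<in> Q"
        then obtain t where t: "x \<in> carrier R" "t \<in> carrier R" "x \<otimes> c = d \<otimes> t"
          using c by (auto simp: colon_def)
        have "x \<otimes> (a \<otimes> c) = d \<otimes> (a \<otimes> t)" using t a c dR by (simp add: m_lcomm)
        then show "x \<in> colon d (a \<otimes> c)" using t a by (auto simp: colon_def)
      qed
      have "b \<in> colon d (a \<otimes> c)" using ab a b c by (auto simp: colon_def m_ac)
      then have "colon d (a \<otimes> c) \<noteq> Q" using no by auto
      then have "\<not> colon d (a \<otimes> c) \<subseteq> P" using Qm[OF _ mono[OF a]] a c by auto
      then obtain s where s: "s \<in> colon d (a \<otimes> c)" "s \<notin> P" by auto
      then have sR: "s \<in> carrier R" by (auto simp: colon_def)
      have "a \<in> colon d (s \<otimes> c)" using s sR a c by (auto simp: colon_def m_lcomm)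
      then have "colon d (s \<otimes> c) \<noteq> Q" using no by auto
      then have "\<not> colon d (s \<otimes> c) \<subseteq> P" using Qm[OF _ mono[OF sR]] sR c by auto
      then obtain t where t: "t \<in> colon d (s \<otimes> c)" "t \<notin> P" by auto
      then have tR: "t \<in> carrier R" by (auto simp: colon_def)
      have "t \<otimes> s \<in> Q" using t tR sR c by (auto simp: colon_def m_assoc)
      then have "t \<otimes> s \<in> P" using c by auto
      then show False using primeideal.I_prime[OF Pp tR sR] s t by auto
    qed
  qed
  then have "maximalideal Q R" using dim1 dQ d by auto
  then have "Q = P" using maximalideal.I_maximal[of Q R P] P c P.a_subset by auto
  show thesis
  proof
    show "c \<in> carrier R" by fact
    show "\<exists>t\<in>carrier R. x \<otimes> c = d \<otimes> t" if "x \<in> J" for x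
      using that P \<open>Q = P\<close> c by (auto simp: colon_def)
    show "\<not> (\<exists>t\<in>carrier R. c = d \<otimes> t)"
    proof
      assume "\<exists>t\<in>carrier R. c = d \<otimes> t"
      then have "\<one> \<in> Q" using c by (auto simp: colon_def)
      then show False using nQ Qi ideal.one_imp_carrier by blast
    qed
  qed
qed

text \<open>With \<open>x = c / d\<close> the hypothesis reads \<open>y n = x\<^sup>n (y 0)\<close>. The ascending chain of the ideals
  generated by \<open>y 0, \<dots>, y (n - 1)\<close> becomes stationary, so some \<open>y n\<close> is a linear combination of the
  earlier ones; division by \<open>y 0\<close> turns this into a monic equation for \<open>x\<close>.\<close>

lemma almost_integral_imp_integral:
  assumes c: "c \<in> carrier R" and d: "d \<in> carrier R" "d \<noteq> \<zero>"
    and y: "\<And>n. y n \<in> carrier R" "y 0 \<noteq> \<zero>" "\<And>n. c \<otimes> y n = d \<otimes> y (Suc n)"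
  shows "integral_over (fraction_field R) ((\<lambda>a. fraction R a \<one>) ` carrier R) (fraction R c d)"
proof -
  let ?K = "fraction_field R" let ?f = "\<lambda>a. fraction R a \<one>" let ?x = "fraction R c d"
  interpret K: ring ?K by (rule fraction_field_ring)
  have f: "?f a \<in> carrier ?K" if "a \<in> carrier R" for a using that by (simp add: fraction_closed)
  have x: "?x \<in> carrier ?K" using c d by (simp add: fraction_closed)
  have fm: "?f (a \<otimes> b) = ?f a \<otimes>\<^bsub>?K\<^esub> ?f b" if "a \<in> carrier R" "b \<in> carrier R" for a b
    using that by (simp add: fraction_mult)
  have fa: "?f (a \<oplus> b) = ?f a \<oplus>\<^bsub>?K\<^esub> ?f b" if "a \<in> carrier R" "b \<in> carrier R" for a b
    using that by (simp add: fraction_add)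
  have pow: "?x [^]\<^bsub>?K\<^esub> n \<otimes>\<^bsub>?K\<^esub> ?f (y 0) = ?f (y n)" for n
  proof (induct n)
    case 0 then show ?case using y f by simp
  next
    case (Suc n)
    have "?x [^]\<^bsub>?K\<^esub> Suc n \<otimes>\<^bsub>?K\<^esub> ?f (y 0) = ?x \<otimes>\<^bsub>?K\<^esub> ?f (y n)"
      using x f y K.nat_pow_Suc2 Suc by (simp add: K.m_assoc del: K.nat_pow_Suc)
    also have "\<dots> = ?f (y (Suc n))"
      using c d y by (simp add: fraction_mult fraction_eq_iff m_comm)
    finally show ?case .
  qed
  \<comment> \<open>\<open>L n\<close> is the ideal generated by \<open>y 0, \<dots>, y (n - 1)\<close>.\<close>
  define L where "L = rec_nat {\<zero>} (\<lambda>n I. PIdl (y n) <+> I)"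
  have L0: "L 0 = {\<zero>}" and LS: "L (Suc n) = PIdl (y n) <+> L n" for n by (simp_all add: L_def)
  have Li: "ideal (L n) R" for n
    by (induct n) (auto simp: L0 LS zeroideal intro!: add_ideals cgenideal_ideal y)
  have Lmono: "L n \<subseteq> L (Suc n)" for n
  proof
    fix z assume z: "z \<in> L n"
    then have "z \<in> carrier R" using Li ideal.Icarr by metis
    moreover have "\<zero> \<in> PIdl (y n)" using y by (auto simp: cgenideal_def intro!: exI[of _ \<zero>])
    ultimately show "z \<in> L (Suc n)" using z unfolding LS set_add_def'
      by (intro UN_I[of \<zero>] UN_I[of z]) auto
  qed
  have yL: "y n \<in> L (Suc n)" for n
  proof -
    have "\<zero> \<in> L n" using Li additive_subgroup.zero_closed ideal_def by metis
    then show ?thesis using cgenideal_self[OF y(1)[of n]] y(1)[of n] unfolding LS set_add_def'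
      by (intro UN_I[of "y n"] UN_I[of \<zero>]) auto
  qed
  have "\<Union>(range L) \<in> range L"
  proof (rule ideal_chain_is_trivial)
    have mono: "L m \<subseteq> L n" if "m \<le> n" for m n using Lmono that by (rule lift_Suc_mono_le)
    have "L m \<subseteq> L n \<or> L n \<subseteq> L m" for m n using mono[of m n] mono[of n m] by linarith
    then show "subset.chain {I. ideal I R} (range L)"
      using Li unfolding pred_on.chain_def by (simp add: image_subset_iff psubset_eq) blast
  qed auto
  then obtain n where "\<Union>(range L) = L n" by auto
  then have yn: "y n \<in> L n" using yL by blast
  have comb: "\<exists>rs. set rs \<subseteq> carrier R \<and> length rs = n \<and>
      ?f z = K.eval (map ?f rs) ?x \<otimes>\<^bsub>?K\<^esub> ?f (y 0)" if "z \<in> L n" for z n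
    using that
  proof (induct n arbitrary: z)
    case 0
    then show ?case using y f by (simp add: L0 fraction_field_simps[symmetric])
  next
    case (Suc n)
    then obtain r w where r: "r \<in> carrier R" "w \<in> L n" "z = r \<otimes> y n \<oplus> w"
      unfolding LS set_add_def' cgenideal_def by auto
    then obtain rs where rs: "set rs \<subseteq> carrier R" "length rs = n"
      "?f w = K.eval (map ?f rs) ?x \<otimes>\<^bsub>?K\<^esub> ?f (y 0)" using Suc(1) by blast
    have w: "w \<in> carrier R" using r Li ideal.Icarr by metis
    have e: "K.eval (map ?f rs) ?x \<in> carrier ?K" using rs f x by (intro K.eval_in_carrier) auto
    have "K.eval (map ?f (r # rs)) ?x \<otimes>\<^bsub>?K\<^esub> ?f (y 0) =
      ?f r \<otimes>\<^bsub>?K\<^esub> (?x [^]\<^bsub>?K\<^esub> n \<otimes>\<^bsub>?K\<^esub> ?f (y 0)) \<oplus>\<^bsub>?K\<^esub> K.eval (map ?f rs) ?x \<otimes>\<^bsub>?K\<^esub> ?f (y 0)"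
      using rs r e f x y by (simp add: K.l_distr K.m_assoc)
    also have "\<dots> = ?f z" using r rs w y by (simp add: pow fa fm)
    finally show ?case using r rs by (intro exI[of _ "r # rs"]) auto
  qed
  have "\<ominus> y n \<in> L n" using yn Li additive_subgroup.a_inv_closed ideal_def by metis
  then obtain rs where rs: "set rs \<subseteq> carrier R" "length rs = n"
      "?f (\<ominus> y n) = K.eval (map ?f rs) ?x \<otimes>\<^bsub>?K\<^esub> ?f (y 0)" using comb by blast
  have e: "K.eval (map ?f rs) ?x \<in> carrier ?K" using rs f x by (intro K.eval_in_carrier) auto
  let ?e = "K.eval (\<one>\<^bsub>?K\<^esub> # map ?f rs) ?x"
  have "?e \<otimes>\<^bsub>?K\<^esub> ?f (y 0) = ?f (y n) \<oplus>\<^bsub>?K\<^esub> ?f (\<ominus> y n)"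
    using rs e x f y by (simp add: K.l_distr pow)
  also have "\<dots> = ?f \<zero>" using y by (simp add: fa[symmetric] r_neg)
  finally have ez: "?e \<otimes>\<^bsub>?K\<^esub> ?f (y 0) = ?f \<zero>" .
  have "?e \<in> carrier ?K" using rs f x by (intro K.eval_in_carrier) auto
  then obtain u v where uv: "u \<in> carrier R" "v \<in> carrier R" "v \<noteq> \<zero>" "?e = fraction R u v"
    by (rule fraction_cases)
  then have "u = \<zero>" using ez y by (simp add: fraction_mult fraction_eq_iff integral_iff)
  then have "?e = \<zero>\<^bsub>?K\<^esub>" using uv by (simp add: fraction_field_simps fraction_eq_iff)
  then show ?thesis unfolding integral_over_def using rs by (intro exI[of _ "map ?f rs"]) auto
qed

end

lemma (in dedekind_ring) integral_fraction:
  assumes c: "c \<in> carrier R" and d: "d \<in> carrier R" "d \<noteq> \<zero>"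
    and "integral_over (fraction_field R) ((\<lambda>a. fraction R a \<one>) ` carrier R) (fraction R c d)"
  shows "\<exists>t\<in>carrier R. c = d \<otimes> t"
proof -
  have "fraction R c d \<in> (\<lambda>a. fraction R a \<one>) ` carrier R"
    using assms integrally_closed fraction_closed by (auto simp: integrally_closed_def Let_def)
  then show ?thesis using c d by (auto simp: fraction_eq_iff m_comm)
qed

text \<open>The hypothesis on \<open>J\<close> says that \<open>I\<^sup>-\<^sup>1 I \<subseteq> J\<close>: the element \<open>y\<close> is \<open>(c / b) x\<close> with \<open>x \<in> I\<close> and
  \<open>c / b \<in> I\<^sup>-\<^sup>1\<close>. Hence the lemma is the invertibility of \<open>I\<close>. If \<open>J\<close> were proper, some fraction
  \<open>z \<notin> R\<close> would satisfy \<open>z J \<subseteq> R\<close>; then \<open>z I\<^sup>-\<^sup>1 I \<subseteq> R\<close>, so \<open>z I\<^sup>-\<^sup>1 \<subseteq> I\<^sup>-\<^sup>1\<close>, and iterating this on an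
  element of \<open>I\<^sup>-\<^sup>1\<close> makes \<open>z\<close> integral over \<open>R\<close>, which is a contradiction.\<close>

lemma (in dedekind_ring) trace_ideal_unit:
  assumes I: "I \<subseteq> carrier R" "I \<noteq> {}" "I \<noteq> {\<zero>}" and J: "ideal J R"
    and tr: "\<And>b c x y. \<lbrakk>b \<in> carrier R; b \<noteq> \<zero>; c \<in> carrier R;
      \<And>x. x \<in> I \<Longrightarrow> \<exists>y\<in>carrier R. c \<otimes> x = b \<otimes> y; x \<in> I; y \<in> carrier R; c \<otimes> x = b \<otimes> y\<rbrakk> \<Longrightarrow> y \<in> J"
  shows "J = carrier R"
proof (rule ccontr)
  assume nJ: "J \<noteq> carrier R"
  obtain b where b: "b \<in> I" "b \<noteq> \<zero>" "b \<in> carrier R" using I by auto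
  have bJ: "b \<in> J" using I b by (intro tr[of \<one> \<one> b b]) auto
  obtain c where c: "c \<in> carrier R" "\<not> (\<exists>t\<in>carrier R. c = b \<otimes> t)"
    "\<And>x. x \<in> J \<Longrightarrow> \<exists>t\<in>carrier R. x \<otimes> c = b \<otimes> t"
    using proper_ideal_inverse_nontrivial[OF nonzero_prime_maximal J nJ bJ b(2)] by blast
  \<comment> \<open>\<open>A\<close> is \<open>b I\<^sup>-\<^sup>1\<close>, and the claim \<open>step\<close> is \<open>(c / b) A \<subseteq> A\<close>.\<close>
  define A where "A = {a \<in> carrier R. \<forall>x\<in>I. \<exists>y\<in>carrier R. a \<otimes> x = b \<otimes> y}"
  have step: "\<exists>a'. a' \<in> A \<and> c \<otimes> a = b \<otimes> a'" if a: "a \<in> A" for a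
  proof -
    have aR: "a \<in> carrier R" using a by (auto simp: A_def)
    have ex: "\<exists>z\<in>carrier R. c \<otimes> (a \<otimes> x) = b \<otimes> (b \<otimes> z)" if x: "x \<in> I" for x
    proof -
      obtain y where y: "y \<in> carrier R" "a \<otimes> x = b \<otimes> y" using a x by (auto simp: A_def)
      have "y \<in> J" using a x y b by (intro tr[of b a x y]) (auto simp: A_def)
      then obtain z where z: "z \<in> carrier R" "y \<otimes> c = b \<otimes> z" using c by auto
      have "c \<otimes> (a \<otimes> x) = b \<otimes> (y \<otimes> c)" using c y b by (simp add: m_ac)
      then show ?thesis using z by auto
    qed
    obtain a' where a': "a' \<in> carrier R" "c \<otimes> (a \<otimes> b) = b \<otimes> (b \<otimes> a')" using ex b by blast
    have "b \<otimes> (c \<otimes> a) = b \<otimes> (b \<otimes> a')" using a' aR b c by (simp add: m_ac)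
    then have e: "c \<otimes> a = b \<otimes> a'" using a' aR b c by (simp add: m_lcancel)
    have "\<exists>z\<in>carrier R. a' \<otimes> x = b \<otimes> z" if x: "x \<in> I" for x
    proof -
      obtain z where z: "z \<in> carrier R" "c \<otimes> (a \<otimes> x) = b \<otimes> (b \<otimes> z)" using ex x by blast
      have xR: "x \<in> carrier R" using x I by auto
      have "b \<otimes> (a' \<otimes> x) = (b \<otimes> a') \<otimes> x" using a' xR b by (simp add: m_assoc)
      also have "\<dots> = c \<otimes> (a \<otimes> x)" using aR xR c by (simp add: e[symmetric] m_assoc)
      finally have "b \<otimes> (a' \<otimes> x) = b \<otimes> (b \<otimes> z)" using z by simp
      then have "a' \<otimes> x = b \<otimes> z" using a' z xR b by (simp add: m_lcancel)
      then show ?thesis using z by auto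
    qed
    then show ?thesis using a' e by (auto simp: A_def)
  qed
  define y where "y = rec_nat b (\<lambda>_ a. SOME a'. a' \<in> A \<and> c \<otimes> a = b \<otimes> a')"
  have y0: "y 0 = b" and yS: "y (Suc n) = (SOME a'. a' \<in> A \<and> c \<otimes> y n = b \<otimes> a')" for n
    by (simp_all add: y_def)
  have "b \<in> A" using b I by (auto simp: A_def)
  then have yA: "y n \<in> A" for n
    by (induct n) (use someI_ex[OF step] in \<open>auto simp: y0 yS\<close>)
  have "c \<otimes> y n = b \<otimes> y (Suc n)" for n using someI_ex[OF step[OF yA]] by (auto simp: yS)
  moreover have "y n \<in> carrier R" for n using yA by (auto simp: A_def)
  ultimately have "integral_over (fraction_field R) ((\<lambda>a. fraction R a \<one>) ` carrier R) (fraction R c b)"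
    using b c y0 by (intro almost_integral_imp_integral[where y = y]) auto
  then show False using integral_fraction b c by blast
qed


section \<open>Linear maps and dual bases\<close>

lemma lin_mapI:
  assumes "\<And>x. x \<in> carrier M \<Longrightarrow> f x \<in> carrier N"
    and "\<And>x y. \<lbrakk>x \<in> carrier M; y \<in> carrier M\<rbrakk> \<Longrightarrow> f (x \<oplus>\<^bsub>M\<^esub> y) = f x \<oplus>\<^bsub>N\<^esub> f y"
    and "\<And>a x. \<lbrakk>a \<in> carrier A; x \<in> carrier M\<rbrakk> \<Longrightarrow> f (a \<odot>\<^bsub>M\<^esub> x) = a \<odot>\<^bsub>N\<^esub> f x"
  shows "f \<in> lin_map A M N"
  using assms by (auto simp: lin_map_def)

lemma lin_mapD:
  assumes "f \<in> lin_map A M N"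
  shows "x \<in> carrier M \<Longrightarrow> f x \<in> carrier N"
    and "\<lbrakk>x \<in> carrier M; y \<in> carrier M\<rbrakk> \<Longrightarrow> f (x \<oplus>\<^bsub>M\<^esub> y) = f x \<oplus>\<^bsub>N\<^esub> f y"
    and "\<lbrakk>a \<in> carrier A; x \<in> carrier M\<rbrakk> \<Longrightarrow> f (a \<odot>\<^bsub>M\<^esub> x) = a \<odot>\<^bsub>N\<^esub> f x"
  using assms by (auto simp: lin_map_def)

lemma lin_map_cong:
  assumes "f \<in> lin_map A M N" "left_module A M" "\<And>x. x \<in> carrier M \<Longrightarrow> f x = g x"
  shows "g \<in> lin_map A M N"
proof -
  interpret M: left_module A M by fact
  have eq: "g x = f x" if "x \<in> carrier M" for x using assms(3)[OF that] by simp
  show ?thesis using lin_mapD[OF assms(1)]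
    by (intro lin_mapI) (simp_all add: eq)
qed

lemma regular_module_simps [simp]:
  "carrier (regular_module A) = carrier A" "\<zero>\<^bsub>regular_module A\<^esub> = \<zero>\<^bsub>A\<^esub>"
  "x \<oplus>\<^bsub>regular_module A\<^esub> y = x \<oplus>\<^bsub>A\<^esub> y" "a \<odot>\<^bsub>regular_module A\<^esub> x = a \<otimes>\<^bsub>A\<^esub> x"
  by (simp_all add: regular_module_def)

lemma regular_module_left_module:
  assumes "ring A" shows "left_module A (regular_module A)"
proof -
  interpret A: ring A by fact
  have inv: "\<exists>y\<in>carrier A. y \<oplus>\<^bsub>A\<^esub> x = \<zero>\<^bsub>A\<^esub>" if "x \<in> carrier A" for x
    using that A.l_neg A.a_inv_closed by blast
  show ?thesis
    by (intro left_module.intro left_module_axioms.intro abelian_groupI)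
       (simp_all add: A.a_assoc A.a_comm A.a_lcomm A.l_distr A.r_distr A.m_assoc A.ring_axioms inv)
qed

lemma regular_module_module:
  assumes "cring R" shows "module R (regular_module R)"
proof -
  interpret left_module R "regular_module R"
    using assms by (intro regular_module_left_module) (simp add: cring_def)
  show ?thesis
    by (intro moduleI assms M.abelian_group_axioms smult_closed smult_l_distr smult_r_distr smult_assoc1 smult_one)
qed

lemma lin_map_mult:
  assumes "cring R" "f \<in> lin_map R M (regular_module R)" "a \<in> carrier R"
  shows "(\<lambda>x. f x \<otimes>\<^bsub>R\<^esub> a) \<in> lin_map R M (regular_module R)"
    "(\<lambda>x. a \<otimes>\<^bsub>R\<^esub> f x) \<in> lin_map R M (regular_module R)"
proof -
  interpret cring R by fact
  show "(\<lambda>x. f x \<otimes>\<^bsub>R\<^esub> a) \<in> lin_map R M (regular_module R)"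
    "(\<lambda>x. a \<otimes>\<^bsub>R\<^esub> f x) \<in> lin_map R M (regular_module R)"
    using lin_mapD[OF assms(2)] assms(3) by (auto intro!: lin_mapI simp: l_distr r_distr m_assoc m_lcomm)
qed

lemma free_module_expansion:
  assumes "ring A" and x: "x \<in> carrier (free_module A S)"
  shows "lin_ext A (free_module A S) (basis_vector A) x = x"
proof
  fix q
  interpret A: ring A by fact
  let ?F = "free_module A S"
  interpret F: left_module A ?F by (rule free_module_left_module) fact
  interpret reg: left_module A "regular_module A" by (rule regular_module_left_module) fact
  let ?T = "{p. x p \<noteq> \<zero>\<^bsub>A\<^esub>}"
  have T: "finite ?T" "?T \<subseteq> S" "\<And>p. x p \<in> carrier A" using x by (auto simp: free_module_def)
  have ev: "(\<lambda>u. u q) \<in> lin_map A ?F (regular_module A)"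
    by (intro lin_mapI) (auto simp: free_module_def)
  have "lin_ext A ?F (basis_vector A) x q = (\<Oplus>\<^bsub>regular_module A\<^esub>p\<in>?T. (x p \<odot>\<^bsub>?F\<^esub> basis_vector A p) q)"
    unfolding lin_ext_def using T
    by (intro lin_map_finsum[OF F.left_module_axioms reg.left_module_axioms ev])
       (auto intro!: F.smult_closed F.basis_vector_closed)
  also have "\<dots> = (\<Oplus>\<^bsub>regular_module A\<^esub>p\<in>?T. if q = p then x p else \<zero>\<^bsub>regular_module A\<^esub>)"
    using T by (intro reg.M.finsum_cong') (auto simp: free_module_def basis_vector_def)
  also have "\<dots> = x q"
  proof (cases "q \<in> ?T")
    case True then show ?thesis using T reg.M.finsum_singleton[of q ?T x] by auto
  next
    case False
    then have "(\<Oplus>\<^bsub>regular_module A\<^esub>p\<in>?T. if q = p then x p else \<zero>\<^bsub>regular_module A\<^esub>) = \<zero>\<^bsub>regular_module A\<^esub>"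
      by (intro reg.M.add.finprod_one_eqI) auto
    then show ?thesis using False by simp
  qed
  finally show "lin_ext A ?F (basis_vector A) x q = x q" .
qed

lemma lin_map_lin_ext:
  assumes M: "left_module A M" and N: "left_module A N" and L: "L \<in> lin_map A M N"
    and b: "b \<in> S \<rightarrow> carrier M" and x: "x \<in> carrier (free_module A S)"
  shows "L (lin_ext A M b x) = lin_ext A N (\<lambda>p. L (b p)) x"
proof -
  interpret M: left_module A M by fact
  interpret N: left_module A N by fact
  let ?T = "{p. x p \<noteq> \<zero>\<^bsub>A\<^esub>}"
  have T: "finite ?T" "?T \<subseteq> S" "\<And>p. x p \<in> carrier A" using x by (auto simp: free_module_def)
  have b': "b p \<in> carrier M" if "p \<in> ?T" for p using b T that by blast
  have "L (lin_ext A M b x) = (\<Oplus>\<^bsub>N\<^esub>p\<in>?T. L (x p \<odot>\<^bsub>M\<^esub> b p))"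
    unfolding lin_ext_def using T b' by (intro lin_map_finsum[OF M N L]) auto
  also have "\<dots> = lin_ext A N (\<lambda>p. L (b p)) x"
    unfolding lin_ext_def using T b' lin_mapD[OF L] by (intro N.M.finsum_cong') auto
  finally show ?thesis .
qed

text \<open>The elements \<open>p\<close> of \<open>P\<close> together with the coordinates \<open>\<lambda>x. s x p\<close> form a dual basis: the
  identity of \<open>P\<close> lifts along the surjection onto \<open>P\<close> from the free module on the elements of \<open>P\<close>.\<close>

lemma projective_module_dual_basis:
  assumes "projective_module A P"
  obtains s where "s \<in> lin_map A P (free_module A (carrier P))"
    "\<And>x. x \<in> carrier P \<Longrightarrow> lin_ext A P (\<lambda>p. p) (s x) = x"
proof -
  have lP: "left_module A P" using assms by (simp add: projective_module_def)
  interpret P: left_module A P by fact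
  let ?F = "free_module A (carrier P)"
  have lF: "left_module A ?F" by (rule free_module_left_module) unfold_locales
  have idb: "(\<lambda>p. p) \<in> carrier P \<rightarrow> carrier P" by simp
  have q: "lin_ext A P (\<lambda>p. p) \<in> lin_map A ?F P" by (rule P.lin_ext_lin_map[OF idb])
  have surj: "lin_ext A P (\<lambda>p. p) ` carrier ?F = carrier P"
  proof (intro equalityI subsetI)
    fix y assume y: "y \<in> carrier P"
    show "y \<in> lin_ext A P (\<lambda>p. p) ` carrier ?F"
      by (rule image_eqI[where x = "basis_vector A y"])
         (simp_all add: P.lin_ext_basis[OF idb y] P.basis_vector_closed[OF y])
  qed (use q in \<open>auto simp: lin_map_def\<close>)
  have id: "(\<lambda>x. x) \<in> lin_map A P P" by (simp add: lin_map_def)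
  have "\<exists>s\<in>lin_map A P ?F. \<forall>x\<in>carrier P. lin_ext A P (\<lambda>p. p) (s x) = x"
    using projective_module_lift[OF assms lF lP, unfolded lifting_property_def, rule_format, OF q id surj] .
  then show thesis using that by (elim bexE) simp
qed


section \<open>Tensor products\<close>

locale tensor_pair =
  fixes R :: "('r, 'k) ring_scheme" and M :: "('r, 'm) module" and N :: "('r, 'n) module"
  assumes cring: "cring R" and module_left: "module R M" and module_right: "module R N"
begin

interpretation R: cring R by (rule cring)
interpretation M: module R M by (rule module_left)
interpretation N: module R N by (rule module_right)

abbreviation "rep U \<equiv> (SOME x. x \<in> U)"

lemma rep:
  assumes "U \<in> carrier (tensor R M N)"
  shows "rep U \<in> carrier (free_module R (carrier M \<times> carrier N))"
    and "tensor_kernel R M N +>\<^bsub>free_module R (carrier M \<times> carrier N)\<^esub> rep U = U"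
proof -
  let ?F = "free_module R (carrier M \<times> carrier N)" let ?K = "tensor_kernel R M N"
  interpret F: module R ?F by (rule free_module_module) (rule cring)
  interpret K: submodule ?K R ?F by (rule tensor_kernel_submodule(1)) (rule cring module_left module_right)+
  interpret K: abelian_subgroup ?K ?F
    by (rule abelian_subgroupI3) (auto simp: additive_subgroup_def K.subgroup_axioms F.M.abelian_group_axioms)
  obtain x where x: "x \<in> carrier ?F" "U = ?K +>\<^bsub>?F\<^esub> x"
    using assms by (auto simp: tensor_coset_ops[OF cring module_left module_right])
  have "x \<in> U" using x K.a_rcos_self by simp
  then have r: "rep U \<in> ?K +>\<^bsub>?F\<^esub> x" unfolding x(2)[symmetric] by (rule someI[of "\<lambda>x. x \<in> U"])
  then show "rep U \<in> carrier ?F" using x(1) K.a_elemrcos_carrier by blast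
  show "?K +>\<^bsub>?F\<^esub> rep U = U" using K.a_repr_independence'[OF r x(1)] x(2) by simp
qed

lemma rep_support:
  assumes "U \<in> carrier (tensor R M N)"
  shows "finite {p. rep U p \<noteq> \<zero>\<^bsub>R\<^esub>}" "{p. rep U p \<noteq> \<zero>\<^bsub>R\<^esub>} \<subseteq> carrier M \<times> carrier N"
    "rep U p \<in> carrier R"
  using rep(1)[OF assms] by (auto simp: free_module_def)

text \<open>Being a finite sum over a chosen representative, \<^const>\<open>tensor_lift\<close> is well behaved for arbitrary
  functions \<open>b\<close>; bilinearity of \<open>b\<close> enters only where two representatives are compared.\<close>

lemma tensor_lift_eq_sum:
  "tensor_lift R P b U = (\<Oplus>\<^bsub>P\<^esub>p\<in>{p. rep U p \<noteq> \<zero>\<^bsub>R\<^esub>}. rep U p \<odot>\<^bsub>P\<^esub> b (fst p) (snd p))"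
  by (simp add: tensor_lift_def lin_ext_def)

context
  fixes P :: "('r, 'p) module"
  assumes P: "module R P"
begin

interpretation P: left_module R P by (rule module_imp_left_module) (rule P)

lemma tensor_lift_closed:
  assumes U: "U \<in> carrier (tensor R M N)"
    and b: "\<And>x y. \<lbrakk>x \<in> carrier M; y \<in> carrier N\<rbrakk> \<Longrightarrow> b x y \<in> carrier P"
  shows "tensor_lift R P b U \<in> carrier P"
  unfolding tensor_lift_eq_sum using rep_support[OF U] b
  by (intro P.M.finsum_closed) (auto intro!: P.smult_closed)

lemma tensor_lift_cong:
  assumes U: "U \<in> carrier (tensor R M N)"
    and b: "\<And>x y. \<lbrakk>x \<in> carrier M; y \<in> carrier N\<rbrakk> \<Longrightarrow> b' x y \<in> carrier P"
    and eq: "\<And>x y. \<lbrakk>x \<in> carrier M; y \<in> carrier N\<rbrakk> \<Longrightarrow> b x y = b' x y"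
  shows "tensor_lift R P b U = tensor_lift R P b' U"
  unfolding tensor_lift_eq_sum using rep_support[OF U] b eq
  by (intro P.M.finsum_cong') (auto simp: Pi_iff subset_iff intro!: P.smult_closed)

lemma tensor_lift_add:
  assumes U: "U \<in> carrier (tensor R M N)"
    and b: "\<And>x y. \<lbrakk>x \<in> carrier M; y \<in> carrier N\<rbrakk> \<Longrightarrow> b x y \<in> carrier P"
    and b': "\<And>x y. \<lbrakk>x \<in> carrier M; y \<in> carrier N\<rbrakk> \<Longrightarrow> b' x y \<in> carrier P"
  shows "tensor_lift R P (\<lambda>x y. b x y \<oplus>\<^bsub>P\<^esub> b' x y) U = tensor_lift R P b U \<oplus>\<^bsub>P\<^esub> tensor_lift R P b' U"
proof -
  let ?S = "{p. rep U p \<noteq> \<zero>\<^bsub>R\<^esub>}"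
  note s = rep_support[OF U]
  have c: "b (fst p) (snd p) \<in> carrier P" "b' (fst p) (snd p) \<in> carrier P" if "p \<in> ?S" for p
    using that s(2) b b' by (cases p; auto simp: subset_iff)+
  have "tensor_lift R P (\<lambda>x y. b x y \<oplus>\<^bsub>P\<^esub> b' x y) U
      = (\<Oplus>\<^bsub>P\<^esub>p\<in>?S. rep U p \<odot>\<^bsub>P\<^esub> b (fst p) (snd p) \<oplus>\<^bsub>P\<^esub> rep U p \<odot>\<^bsub>P\<^esub> b' (fst p) (snd p))"
    unfolding tensor_lift_eq_sum using s(3) c
    by (intro P.M.finsum_cong' funcsetI P.M.a_closed P.smult_closed P.smult_r_distr refl) auto
  also have "\<dots> = tensor_lift R P b U \<oplus>\<^bsub>P\<^esub> tensor_lift R P b' U"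
    unfolding tensor_lift_eq_sum using s(3) c by (intro P.M.finsum_addf funcsetI P.smult_closed) auto
  finally show ?thesis .
qed

lemma lin_map_tensor_lift:
  assumes U: "U \<in> carrier (tensor R M N)"
    and b: "\<And>x y. \<lbrakk>x \<in> carrier M; y \<in> carrier N\<rbrakk> \<Longrightarrow> b x y \<in> carrier P"
    and Q: "module R Q" and L: "L \<in> lin_map R P Q"
  shows "L (tensor_lift R P b U) = tensor_lift R Q (\<lambda>x y. L (b x y)) U"
proof -
  interpret Q: left_module R Q by (rule module_imp_left_module) (rule Q)
  let ?S = "{p. rep U p \<noteq> \<zero>\<^bsub>R\<^esub>}"
  note s = rep_support[OF U]
  have c: "b (fst p) (snd p) \<in> carrier P" if "p \<in> ?S" for p
    using that s(2) b by (cases p; auto simp: subset_iff)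
  have "L (tensor_lift R P b U) = (\<Oplus>\<^bsub>Q\<^esub>p\<in>?S. L (rep U p \<odot>\<^bsub>P\<^esub> b (fst p) (snd p)))"
    unfolding tensor_lift_eq_sum using s c
    by (intro lin_map_finsum[OF P.left_module_axioms Q.left_module_axioms L]) auto
  also have "\<dots> = tensor_lift R Q (\<lambda>x y. L (b x y)) U"
    unfolding tensor_lift_eq_sum using s c lin_mapD[OF L]
    by (intro Q.M.finsum_cong') auto
  finally show ?thesis .
qed

lemma tensor_lift_smult:
  assumes U: "U \<in> carrier (tensor R M N)"
    and b: "\<And>x y. \<lbrakk>x \<in> carrier M; y \<in> carrier N\<rbrakk> \<Longrightarrow> b x y \<in> carrier P"
    and a: "a \<in> carrier R"
  shows "tensor_lift R P (\<lambda>x y. a \<odot>\<^bsub>P\<^esub> b x y) U = a \<odot>\<^bsub>P\<^esub> tensor_lift R P b U"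
proof -
  have "(\<lambda>x. a \<odot>\<^bsub>P\<^esub> x) \<in> lin_map R P P"
    using a by (intro lin_mapI) (auto simp: P.smult_r_distr P.smult_assoc1[symmetric] R.m_comm)
  from lin_map_tensor_lift[OF U b P this] show ?thesis by simp
qed

lemma tensor_lift_zero:
  assumes U: "U \<in> carrier (tensor R M N)"
  shows "tensor_lift R P (\<lambda>x y. \<zero>\<^bsub>P\<^esub>) U = \<zero>\<^bsub>P\<^esub>"
  unfolding tensor_lift_eq_sum using rep_support[OF U]
  by (intro P.add.finprod_one_eqI) (auto simp: P.smult_r_null)

lemma tensor_lift_finsum:
  assumes U: "U \<in> carrier (tensor R M N)" and I: "finite I"
    and b: "\<And>i x y. \<lbrakk>i \<in> I; x \<in> carrier M; y \<in> carrier N\<rbrakk> \<Longrightarrow> b i x y \<in> carrier P"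
  shows "tensor_lift R P (\<lambda>x y. \<Oplus>\<^bsub>P\<^esub>i\<in>I. b i x y) U = (\<Oplus>\<^bsub>P\<^esub>i\<in>I. tensor_lift R P (b i) U)"
  using I b
proof (induct I)
  case empty then show ?case by (simp add: tensor_lift_zero[OF U])
next
  case (insert i I)
  have "tensor_lift R P (\<lambda>x y. \<Oplus>\<^bsub>P\<^esub>i\<in>insert i I. b i x y) U
      = tensor_lift R P (\<lambda>x y. b i x y \<oplus>\<^bsub>P\<^esub> (\<Oplus>\<^bsub>P\<^esub>i\<in>I. b i x y)) U"
    using insert(1,2,4) by (intro tensor_lift_cong[OF U]) (auto intro!: P.M.finsum_insert P.M.a_closed P.M.finsum_closed)
  also have "\<dots> = tensor_lift R P (b i) U \<oplus>\<^bsub>P\<^esub> tensor_lift R P (\<lambda>x y. \<Oplus>\<^bsub>P\<^esub>i\<in>I. b i x y) U"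
    using insert(4) by (intro tensor_lift_add[OF U]) (auto intro!: P.M.finsum_closed)
  also have "\<dots> = (\<Oplus>\<^bsub>P\<^esub>i\<in>insert i I. tensor_lift R P (b i) U)"
    using insert by (simp add: tensor_lift_closed[OF U] Pi_iff)
  finally show ?case .
qed

lemma lin_map_tensor_lift_param:
  assumes U: "U \<in> carrier (tensor R M N)" and Q: "module R Q"
    and b: "\<And>x y. \<lbrakk>x \<in> carrier M; y \<in> carrier N\<rbrakk> \<Longrightarrow> (\<lambda>q. b q x y) \<in> lin_map R Q P"
  shows "(\<lambda>q. tensor_lift R P (b q) U) \<in> lin_map R Q P"
proof -
  interpret Q: module R Q by (rule Q)
  note b' = lin_mapD[OF b]
  show ?thesis
  proof (rule lin_mapI)
    fix q q' assume q: "q \<in> carrier Q" "q' \<in> carrier Q"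
    show "tensor_lift R P (b (q \<oplus>\<^bsub>Q\<^esub> q')) U = tensor_lift R P (b q) U \<oplus>\<^bsub>P\<^esub> tensor_lift R P (b q') U"
      using q b' by (subst tensor_lift_add[OF U, symmetric]) (auto intro!: tensor_lift_cong[OF U])
  next
    fix a q assume q: "a \<in> carrier R" "q \<in> carrier Q"
    show "tensor_lift R P (b (a \<odot>\<^bsub>Q\<^esub> q)) U = a \<odot>\<^bsub>P\<^esub> tensor_lift R P (b q) U"
      using q b' by (subst tensor_lift_smult[OF U, symmetric]) (auto intro!: tensor_lift_cong[OF U])
  qed (auto intro!: tensor_lift_closed[OF U] b')
qed

end

lemma pure_tensor_bilinear: "pure_tensor R M N \<in> bilinear_map R M N (tensor R M N)"
  and pure_tensor_closed: "\<lbrakk>m \<in> carrier M; n \<in> carrier N\<rbrakk> \<Longrightarrow> pure_tensor R M N m n \<in> carrier (tensor R M N)"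
proof -
  let ?F = "free_module R (carrier M \<times> carrier N)" let ?K = "tensor_kernel R M N"
  note ops = tensor_coset_ops[OF cring module_left module_right]
  interpret F: module R ?F by (rule free_module_module) (rule cring)
  interpret LF: left_module R ?F by (rule module_imp_left_module) unfold_locales
  interpret K: submodule ?K R ?F by (rule tensor_kernel_submodule(1)) (rule cring module_left module_right)+
  interpret K: abelian_subgroup ?K ?F
    by (rule abelian_subgroupI3) (auto simp: additive_subgroup_def K.subgroup_axioms F.M.abelian_group_axioms)
  have rel: "tensor_relators R M N \<subseteq> ?K"
    by (rule tensor_kernel_submodule(2)) (rule cring module_left module_right)+
  have e: "basis_vector R (m, n) \<in> carrier ?F" if "m \<in> carrier M" "n \<in> carrier N" for m n
    using that by (intro LF.basis_vector_closed) simp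
  then show c: "pure_tensor R M N m n \<in> carrier (tensor R M N)" if "m \<in> carrier M" "n \<in> carrier N" for m n
    using that by (auto simp: ops pure_tensor_def)
  have eq: "?K +>\<^bsub>?F\<^esub> u = ?K +>\<^bsub>?F\<^esub> v"
    if "u \<ominus>\<^bsub>?F\<^esub> v \<in> ?K" "u \<in> carrier ?F" "v \<in> carrier ?F" for u v
  proof -
    have "u = (u \<ominus>\<^bsub>?F\<^esub> v) \<oplus>\<^bsub>?F\<^esub> v" using that by (simp add: F.M.minus_eq F.M.a_assoc F.M.l_neg)
    then have "u \<in> ?K +>\<^bsub>?F\<^esub> v" using that(1) unfolding a_r_coset_def' by blast
    then show ?thesis using K.a_repr_independence' that(3) by metis
  qed
  show "pure_tensor R M N \<in> bilinear_map R M N (tensor R M N)"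
    unfolding bilinear_map_def
  proof (intro CollectI conjI ballI lin_mapI)
    fix n m m' assume a: "n \<in> carrier N" "m \<in> carrier M" "m' \<in> carrier M"
    then have "basis_vector R (m \<oplus>\<^bsub>M\<^esub> m', n) \<ominus>\<^bsub>?F\<^esub> (basis_vector R (m, n) \<oplus>\<^bsub>?F\<^esub> basis_vector R (m', n)) \<in> ?K"
      using rel unfolding tensor_relators_def Let_def by blast
    from eq[OF this] show "pure_tensor R M N (m \<oplus>\<^bsub>M\<^esub> m') n = pure_tensor R M N m n \<oplus>\<^bsub>tensor R M N\<^esub> pure_tensor R M N m' n"
      using a e by (simp add: pure_tensor_def ops)
  next
    fix m n n' assume a: "m \<in> carrier M" "n \<in> carrier N" "n' \<in> carrier N"
    then have "basis_vector R (m, n \<oplus>\<^bsub>N\<^esub> n') \<ominus>\<^bsub>?F\<^esub> (basis_vector R (m, n) \<oplus>\<^bsub>?F\<^esub> basis_vector R (m, n')) \<in> ?K"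
      using rel unfolding tensor_relators_def Let_def by blast
    from eq[OF this] show "pure_tensor R M N m (n \<oplus>\<^bsub>N\<^esub> n') = pure_tensor R M N m n \<oplus>\<^bsub>tensor R M N\<^esub> pure_tensor R M N m n'"
      using a e by (simp add: pure_tensor_def ops)
  next
    fix n r m assume a: "n \<in> carrier N" "r \<in> carrier R" "m \<in> carrier M"
    then have "basis_vector R (r \<odot>\<^bsub>M\<^esub> m, n) \<ominus>\<^bsub>?F\<^esub> (r \<odot>\<^bsub>?F\<^esub> basis_vector R (m, n)) \<in> ?K"
      using rel unfolding tensor_relators_def Let_def by blast
    from eq[OF this] show "pure_tensor R M N (r \<odot>\<^bsub>M\<^esub> m) n = r \<odot>\<^bsub>tensor R M N\<^esub> pure_tensor R M N m n"
      using a e by (simp add: pure_tensor_def ops)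
  next
    fix m r n assume a: "m \<in> carrier M" "r \<in> carrier R" "n \<in> carrier N"
    then have "basis_vector R (m, r \<odot>\<^bsub>N\<^esub> n) \<ominus>\<^bsub>?F\<^esub> (r \<odot>\<^bsub>?F\<^esub> basis_vector R (m, n)) \<in> ?K"
      using rel unfolding tensor_relators_def Let_def by blast
    from eq[OF this] show "pure_tensor R M N m (r \<odot>\<^bsub>N\<^esub> n) = r \<odot>\<^bsub>tensor R M N\<^esub> pure_tensor R M N m n"
      using a e by (simp add: pure_tensor_def ops)
  qed (auto intro: c)
qed

lemma module_tensor: "module R (tensor R M N)"
  by (rule tensor_module[OF cring module_left module_right])

lemma tensor_lift_pure_tensor:
  assumes U: "U \<in> carrier (tensor R M N)"
  shows "tensor_lift R (tensor R M N) (pure_tensor R M N) U = U"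
proof -
  let ?F = "free_module R (carrier M \<times> carrier N)" let ?K = "tensor_kernel R M N"
  note ops = tensor_coset_ops[OF cring module_left module_right]
  interpret F: left_module R ?F by (rule free_module_left_module) (rule R.ring_axioms)
  interpret T: left_module R "tensor R M N" by (rule module_imp_left_module) (rule module_tensor)
  have L: "(\<lambda>x. ?K +>\<^bsub>?F\<^esub> x) \<in> lin_map R ?F (tensor R M N)"
    by (intro lin_mapI) (auto simp: ops)
  note s = rep_support[OF U]
  let ?S = "{p. rep U p \<noteq> \<zero>\<^bsub>R\<^esub>}"
  have bv: "basis_vector R p \<in> carrier ?F" if "p \<in> ?S" for p
    using that s(2) by (intro F.basis_vector_closed) auto
  have "U = ?K +>\<^bsub>?F\<^esub> lin_ext R ?F (basis_vector R) (rep U)"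
    using rep[OF U] by (simp add: free_module_expansion[OF R.ring_axioms])
  also have "\<dots> = (\<Oplus>\<^bsub>tensor R M N\<^esub>p\<in>?S. ?K +>\<^bsub>?F\<^esub> (rep U p \<odot>\<^bsub>?F\<^esub> basis_vector R p))"
    unfolding lin_ext_def using s bv
    by (intro lin_map_finsum[OF F.left_module_axioms T.left_module_axioms L]) auto
  also have "\<dots> = tensor_lift R (tensor R M N) (pure_tensor R M N) U"
    unfolding tensor_lift_eq_sum using s bv
    by (intro T.M.finsum_cong') (auto simp: ops pure_tensor_def subset_iff intro!: pure_tensor_closed T.smult_closed)
  finally show ?thesis by simp
qed

end

text \<open>Both sides are the same finite double sum.\<close>

lemma tensor_lift_swap:
  assumes UV: "tensor_pair R M N" "tensor_pair R M' N'" and P: "module R P"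
    and U: "U \<in> carrier (tensor R M N)" and V: "V \<in> carrier (tensor R M' N')"
    and b: "\<And>x y u v. \<lbrakk>x \<in> carrier M; y \<in> carrier N; u \<in> carrier M'; v \<in> carrier N'\<rbrakk> \<Longrightarrow> b x y u v \<in> carrier P"
  shows "tensor_lift R P (\<lambda>x y. tensor_lift R P (\<lambda>u v. b x y u v) V) U
    = tensor_lift R P (\<lambda>u v. tensor_lift R P (\<lambda>x y. b x y u v) U) V"
proof -
  interpret P: left_module R P by (rule module_imp_left_module) (rule P)
  interpret A: tensor_pair R M N by fact
  interpret B: tensor_pair R M' N' by fact
  let ?v = "SOME x. x \<in> V" let ?S = "{p. ?v p \<noteq> \<zero>\<^bsub>R\<^esub>}"
  note s = B.rep_support[OF V]
  have bc: "b x y (fst p) (snd p) \<in> carrier P" if "x \<in> carrier M" "y \<in> carrier N" "p \<in> ?S" for x y p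
    using that s(2) b by (cases p; auto simp: subset_iff)
  have "tensor_lift R P (\<lambda>x y. tensor_lift R P (\<lambda>u v. b x y u v) V) U
    = tensor_lift R P (\<lambda>x y. \<Oplus>\<^bsub>P\<^esub>p\<in>?S. ?v p \<odot>\<^bsub>P\<^esub> b x y (fst p) (snd p)) U"
    by (simp add: B.tensor_lift_eq_sum)
  also have "\<dots> = (\<Oplus>\<^bsub>P\<^esub>p\<in>?S. tensor_lift R P (\<lambda>x y. ?v p \<odot>\<^bsub>P\<^esub> b x y (fst p) (snd p)) U)"
    using s bc by (intro A.tensor_lift_finsum[OF P U]) (auto intro!: P.smult_closed)
  also have "\<dots> = (\<Oplus>\<^bsub>P\<^esub>p\<in>?S. ?v p \<odot>\<^bsub>P\<^esub> tensor_lift R P (\<lambda>x y. b x y (fst p) (snd p)) U)"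
    using s bc
    by (intro P.M.finsum_cong') (auto intro!: A.tensor_lift_smult[OF P U] P.smult_closed A.tensor_lift_closed[OF P U])
  also have "\<dots> = tensor_lift R P (\<lambda>u v. tensor_lift R P (\<lambda>x y. b x y u v) U) V"
    by (simp add: B.tensor_lift_eq_sum)
  finally show ?thesis .
qed

lemma bilinear_mapD:
  assumes "b \<in> bilinear_map R M N P"
  shows "n \<in> carrier N \<Longrightarrow> (\<lambda>m. b m n) \<in> lin_map R M P" "m \<in> carrier M \<Longrightarrow> b m \<in> lin_map R N P"
    "\<lbrakk>m \<in> carrier M; n \<in> carrier N\<rbrakk> \<Longrightarrow> b m n \<in> carrier P"
  using assms by (auto simp: bilinear_map_def lin_map_def)

lemma bilinear_mapI:
  assumes "\<And>n. n \<in> carrier N \<Longrightarrow> (\<lambda>m. b m n) \<in> lin_map R M P" "\<And>m. m \<in> carrier M \<Longrightarrow> b m \<in> lin_map R N P"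
  shows "b \<in> bilinear_map R M N P"
  using assms by (auto simp: bilinear_map_def)

lemma tensor_lift_tensor_map:
  assumes MN: "tensor_pair R M N" and MN': "tensor_pair R M' N'" and P: "module R P"
    and U: "U \<in> carrier (tensor R M N)" and b: "b \<in> bilinear_map R M' N' P"
    and f: "\<And>m. m \<in> carrier M \<Longrightarrow> f m \<in> carrier M'" and g: "\<And>n. n \<in> carrier N \<Longrightarrow> g n \<in> carrier N'"
  shows "tensor_lift R P b (tensor_map R M' N' f g U) = tensor_lift R P (\<lambda>m n. b (f m) (g n)) U"
proof -
  interpret A: tensor_pair R M N by fact
  interpret B: tensor_pair R M' N' by fact
  note m = B.cring B.module_left B.module_right
  have L: "tensor_lift R P b \<in> lin_map R (tensor R M' N') P"
    by (rule tensor_lift_lin_map[OF m P b])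
  have "tensor_lift R P b (tensor_map R M' N' f g U)
      = tensor_lift R P (\<lambda>x y. tensor_lift R P b (pure_tensor R M' N' (f x) (g y))) U"
    unfolding tensor_map_def
    by (rule A.lin_map_tensor_lift[OF B.module_tensor U _ P L]) (intro B.pure_tensor_closed f g)
  also have "\<dots> = tensor_lift R P (\<lambda>m n. b (f m) (g n)) U"
    by (rule A.tensor_lift_cong[OF P U])
       (simp_all add: bilinear_mapD[OF b] f g tensor_lift_pure[OF m P b])
  finally show ?thesis .
qed

lemma tensor_map_closed:
  assumes MN: "tensor_pair R M N" and MN': "tensor_pair R M' N'"
    and U: "U \<in> carrier (tensor R M N)"
    and f: "\<And>m. m \<in> carrier M \<Longrightarrow> f m \<in> carrier M'" and g: "\<And>n. n \<in> carrier N \<Longrightarrow> g n \<in> carrier N'"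
  shows "tensor_map R M' N' f g U \<in> carrier (tensor R M' N')"
  unfolding tensor_map_def
  using tensor_pair.tensor_lift_closed[OF MN tensor_pair.module_tensor[OF MN'] U]
    tensor_pair.pure_tensor_closed[OF MN'] f g by metis

definition trilinear_map :: "('r, 'k) ring_scheme \<Rightarrow> ('r, 'm) module \<Rightarrow> ('r, 'n) module \<Rightarrow> ('r, 'l) module \<Rightarrow>
    ('r, 'p) module \<Rightarrow> ('m \<Rightarrow> 'n \<Rightarrow> 'l \<Rightarrow> 'p) set" where
  "trilinear_map R M N L P = {t. (\<forall>n\<in>carrier N. \<forall>l\<in>carrier L. (\<lambda>m. t m n l) \<in> lin_map R M P) \<and>
     (\<forall>m\<in>carrier M. \<forall>l\<in>carrier L. (\<lambda>n. t m n l) \<in> lin_map R N P) \<and>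
     (\<forall>m\<in>carrier M. \<forall>n\<in>carrier N. t m n \<in> lin_map R L P)}"

lemma trilinear_mapI:
  assumes "\<And>n l. \<lbrakk>n \<in> carrier N; l \<in> carrier L\<rbrakk> \<Longrightarrow> (\<lambda>m. t m n l) \<in> lin_map R M P"
    "\<And>m l. \<lbrakk>m \<in> carrier M; l \<in> carrier L\<rbrakk> \<Longrightarrow> (\<lambda>n. t m n l) \<in> lin_map R N P"
    "\<And>m n. \<lbrakk>m \<in> carrier M; n \<in> carrier N\<rbrakk> \<Longrightarrow> (\<lambda>l. t m n l) \<in> lin_map R L P"
  shows "t \<in> trilinear_map R M N L P"
  using assms by (auto simp: trilinear_map_def)

context
  fixes R :: "('r, 'k) ring_scheme" and M :: "('r, 'm) module" and N :: "('r, 'n) module" and L :: "('r, 'l) module"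
    and P :: "('r, 'p) module" and t
  assumes R: "cring R" and M: "module R M" and N: "module R N" and L: "module R L" and P: "module R P"
    and t: "t \<in> trilinear_map R M N L P"
begin

lemma trilinear_mapD:
  "\<lbrakk>n \<in> carrier N; l \<in> carrier L\<rbrakk> \<Longrightarrow> (\<lambda>m. t m n l) \<in> lin_map R M P"
  "\<lbrakk>m \<in> carrier M; l \<in> carrier L\<rbrakk> \<Longrightarrow> (\<lambda>n. t m n l) \<in> lin_map R N P"
  "\<lbrakk>m \<in> carrier M; n \<in> carrier N\<rbrakk> \<Longrightarrow> t m n \<in> lin_map R L P"
  "\<lbrakk>m \<in> carrier M; n \<in> carrier N; l \<in> carrier L\<rbrakk> \<Longrightarrow> t m n l \<in> carrier P"
  using t lin_mapD(1)[of "t m n" R L P l] by (auto simp: trilinear_map_def)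

lemma tensor_lift_right_bilinear:
  "(\<lambda>m w. tensor_lift R P (t m) w) \<in> bilinear_map R M (tensor R N L) P"
proof (rule bilinear_mapI)
  interpret NL: tensor_pair R N L by (intro tensor_pair.intro R N L)
  show "(\<lambda>m. tensor_lift R P (t m) w) \<in> lin_map R M P" if "w \<in> carrier (tensor R N L)" for w
    using that by (intro NL.lin_map_tensor_lift_param P M trilinear_mapD)
  show "tensor_lift R P (t m) \<in> lin_map R (tensor R N L) P" if "m \<in> carrier M" for m
    using that by (intro tensor_lift_lin_map R N L P bilinear_mapI trilinear_mapD)
qed

lemma tensor_lift_left_bilinear:
  "(\<lambda>w l. tensor_lift R P (\<lambda>m n. t m n l) w) \<in> bilinear_map R (tensor R M N) L P"
proof (rule bilinear_mapI)
  interpret MN: tensor_pair R M N by (intro tensor_pair.intro R M N)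
  show "(\<lambda>l. tensor_lift R P (\<lambda>m n. t m n l) w) \<in> lin_map R L P" if "w \<in> carrier (tensor R M N)" for w
    using that by (intro MN.lin_map_tensor_lift_param P L trilinear_mapD)
  show "tensor_lift R P (\<lambda>m n. t m n l) \<in> lin_map R (tensor R M N) P" if "l \<in> carrier L" for l
    using that by (intro tensor_lift_lin_map R N M P bilinear_mapI trilinear_mapD)
qed

lemma tensor_lift_tensor_assoc:
  assumes V: "V \<in> carrier (tensor R (tensor R M N) L)"
  shows "tensor_lift R P (\<lambda>m w. tensor_lift R P (t m) w) (tensor_assoc R M N L V)
    = tensor_lift R P (\<lambda>w l. tensor_lift R P (\<lambda>m n. t m n l) w) V"
proof -
  interpret NL: tensor_pair R N L by (intro tensor_pair.intro R N L)
  interpret MN: tensor_pair R M N by (intro tensor_pair.intro R M N)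
  let ?T = "tensor R M (tensor R N L)"
  interpret T: tensor_pair R M "tensor R N L" by (intro tensor_pair.intro R M NL.module_tensor)
  interpret V: tensor_pair R "tensor R M N" L by (intro tensor_pair.intro R L MN.module_tensor)
  let ?L = "tensor_lift R P (\<lambda>m w. tensor_lift R P (t m) w)"
  let ?p = "\<lambda>m n l. pure_tensor R M (tensor R N L) m (pure_tensor R N L n l)"
  have L': "?L \<in> lin_map R ?T P"
    by (rule tensor_lift_lin_map[OF R M NL.module_tensor P tensor_lift_right_bilinear])
  have pc: "?p m n l \<in> carrier ?T" if "m \<in> carrier M" "n \<in> carrier N" "l \<in> carrier L" for m n l
    using that by (intro T.pure_tensor_closed NL.pure_tensor_closed)
  have "?L (tensor_assoc R M N L V) = tensor_lift R P (\<lambda>w l. ?L (tensor_lift R ?T (\<lambda>m n. ?p m n l) w)) V"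
    unfolding tensor_assoc_def Let_def
    by (rule V.lin_map_tensor_lift[OF T.module_tensor V _ P L'])
       (intro MN.tensor_lift_closed T.module_tensor pc)
  also have "\<dots> = tensor_lift R P (\<lambda>w l. tensor_lift R P (\<lambda>m n. t m n l) w) V"
  proof (rule V.tensor_lift_cong[OF P V])
    fix w l assume w: "w \<in> carrier (tensor R M N)" and l: "l \<in> carrier L"
    show "tensor_lift R P (\<lambda>m n. t m n l) w \<in> carrier P"
      using w l by (intro MN.tensor_lift_closed P trilinear_mapD)
    have "?L (tensor_lift R ?T (\<lambda>m n. ?p m n l) w) = tensor_lift R P (\<lambda>m n. ?L (?p m n l)) w"
      using l by (intro MN.lin_map_tensor_lift[OF T.module_tensor w _ P L'] pc)
    also have "\<dots> = tensor_lift R P (\<lambda>m n. t m n l) w"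
    proof (rule MN.tensor_lift_cong[OF P w])
      fix m n assume mn: "m \<in> carrier M" "n \<in> carrier N"
      show "t m n l \<in> carrier P" using mn l by (intro trilinear_mapD)
      have "?L (?p m n l) = tensor_lift R P (t m) (pure_tensor R N L n l)"
        using mn l by (intro tensor_lift_pure R M NL.module_tensor P tensor_lift_right_bilinear NL.pure_tensor_closed)
      also have "\<dots> = t m n l"
        using mn l by (intro tensor_lift_pure R N L P bilinear_mapI trilinear_mapD)
      finally show "?L (?p m n l) = t m n l" .
    qed
    finally show "?L (tensor_lift R ?T (\<lambda>m n. ?p m n l) w) = tensor_lift R P (\<lambda>m n. t m n l) w" .
  qed
  finally show ?thesis .
qed

end

text \<open>The coassociativity axiom is an equation in \<open>M \<otimes> (C \<otimes> C)\<close>. This is its image under the linear map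
  that a trilinear function induces there.\<close>

lemma coaction_coassoc:
  assumes C: "coalgebra R C \<Delta> \<epsilon>" and M: "right_comodule R C \<Delta> \<epsilon> M \<rho>" and P: "module R P"
    and t: "t \<in> trilinear_map R M C C P" and m: "m \<in> carrier M"
  shows "tensor_lift R P (\<lambda>x c. tensor_lift R P (\<lambda>x' c'. t x' c' c) (\<rho> x)) (\<rho> m)
    = tensor_lift R P (\<lambda>x c. tensor_lift R P (\<lambda>c' c''. t x c' c'') (\<Delta> c)) (\<rho> m)"
proof -
  interpret C: coalgebra R C \<Delta> \<epsilon> by fact
  interpret M: right_comodule R C \<Delta> \<epsilon> M \<rho> by fact
  have R: "cring R" using C.module by (simp add: module_def)
  interpret MC: tensor_pair R M C by (intro tensor_pair.intro R M.module C.module)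
  interpret CC: tensor_pair R C C by (intro tensor_pair.intro R C.module)
  note D = lin_mapD(1)[OF C.coaction] and r = lin_mapD(1)[OF M.coaction]
  have 1: "tensor_pair R (tensor R M C) C" by (intro tensor_pair.intro R C.module MC.module_tensor)
  have 2: "tensor_pair R M (tensor R C C)" by (intro tensor_pair.intro R M.module CC.module_tensor)
  note b1 = tensor_lift_left_bilinear[OF R M.module C.module C.module P t]
  note b2 = tensor_lift_right_bilinear[OF R M.module C.module C.module P t]
  have "tensor_lift R P (\<lambda>x c. tensor_lift R P (\<lambda>x' c'. t x' c' c) (\<rho> x)) (\<rho> m)
      = tensor_lift R P (\<lambda>w c. tensor_lift R P (\<lambda>x' c'. t x' c' c) w) (tensor_map R (tensor R M C) C \<rho> id (\<rho> m))"
    using m by (subst tensor_lift_tensor_map[OF MC.tensor_pair_axioms 1 P _ b1]) (auto intro: r)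
  also have "\<dots> = tensor_lift R P (\<lambda>x w. tensor_lift R P (t x) w)
      (tensor_assoc R M C C (tensor_map R (tensor R M C) C \<rho> id (\<rho> m)))"
    by (intro tensor_lift_tensor_assoc[OF R M.module C.module C.module P t, symmetric]
        tensor_map_closed[OF MC.tensor_pair_axioms 1] r m) auto
  also have "\<dots> = tensor_lift R P (\<lambda>x w. tensor_lift R P (t x) w) (tensor_map R M (tensor R C C) id \<Delta> (\<rho> m))"
    by (simp only: M.coaction_assoc[OF m])
  also have "\<dots> = tensor_lift R P (\<lambda>x c. tensor_lift R P (\<lambda>c' c''. t x c' c'') (\<Delta> c)) (\<rho> m)"
    using m by (subst tensor_lift_tensor_map[OF MC.tensor_pair_axioms 2 P _ b2]) (auto intro: r D)
  finally show ?thesis .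
qed

lemma (in tensor_pair) tensor_lift_cong_support:
  assumes P: "module R P" and U: "U \<in> carrier (tensor R M N)"
    and b: "\<And>x y. \<lbrakk>x \<in> carrier M; y \<in> carrier N\<rbrakk> \<Longrightarrow> b' x y \<in> carrier P"
    and eq: "\<And>x y. \<lbrakk>x \<in> carrier M; y \<in> carrier N; rep U (x, y) \<noteq> \<zero>\<^bsub>R\<^esub>\<rbrakk> \<Longrightarrow> b x y = b' x y"
  shows "tensor_lift R P b U = tensor_lift R P b' U"
proof -
  interpret P: left_module R P by (rule module_imp_left_module) (rule P)
  show ?thesis
    unfolding tensor_lift_eq_sum using rep_support[OF U] b eq
    by (intro P.M.finsum_cong') (auto simp: Pi_iff subset_iff intro!: P.smult_closed)
qed

text \<open>Applying the coordinates of a dual basis of \<open>N\<close> to the second factor separates the elements of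
  \<open>M \<otimes> N\<close>. Writing each \<open>n\<close> as the sum of the \<open>s n p \<odot> p\<close> shows that \<open>U = \<Sum> m \<otimes> n\<close> is the sum over \<open>p\<close> of
  \<open>(\<Sum> s n p \<odot> m) \<otimes> p\<close>, where \<open>p\<close> may range over any finite set that suffices for the finitely many
  \<open>n\<close> in a representative of \<open>U\<close>.\<close>

lemma (in tensor_pair) tensor_eqI:
  assumes s: "s \<in> lin_map R N (free_module R (carrier N))"
      "\<And>x. x \<in> carrier N \<Longrightarrow> lin_ext R N (\<lambda>p. p) (s x) = x"
    and U: "U \<in> carrier (tensor R M N)" and V: "V \<in> carrier (tensor R M N)"
    and eq: "\<And>p. p \<in> carrier N \<Longrightarrow>
      tensor_lift R M (\<lambda>m n. s n p \<odot>\<^bsub>M\<^esub> m) U = tensor_lift R M (\<lambda>m n. s n p \<odot>\<^bsub>M\<^esub> m) V"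
  shows "U = V"
proof -
  interpret R: cring R by (rule cring)
  interpret M: left_module R M by (rule module_imp_left_module) (rule module_left)
  interpret N: left_module R N by (rule module_imp_left_module) (rule module_right)
  interpret T: left_module R "tensor R M N" by (rule module_imp_left_module) (rule module_tensor)
  have sc: "s n \<in> carrier (free_module R (carrier N))" if "n \<in> carrier N" for n
    using lin_mapD(1)[OF s(1) that] .
  have spR: "s n p \<in> carrier R" if "n \<in> carrier N" for n p
    using sc[OF that] by (auto simp: free_module_def)
  define supp where "supp U = (\<Union>q\<in>{q. rep U q \<noteq> \<zero>\<^bsub>R\<^esub>}. {p. s (snd q) p \<noteq> \<zero>\<^bsub>R\<^esub>})" for U :: "('m \<times> 'n \<Rightarrow> 'r) set"
  have supp: "finite (supp U)" "supp U \<subseteq> carrier N" if "U \<in> carrier (tensor R M N)" for U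
  proof -
    have "finite {p. s (snd q) p \<noteq> \<zero>\<^bsub>R\<^esub>}" "{p. s (snd q) p \<noteq> \<zero>\<^bsub>R\<^esub>} \<subseteq> carrier N"
      if "rep U q \<noteq> \<zero>\<^bsub>R\<^esub>" for q
    proof -
      have "snd q \<in> carrier N" using rep_support(2)[OF \<open>U \<in> carrier (tensor R M N)\<close>] that by force
      from sc[OF this] show "finite {p. s (snd q) p \<noteq> \<zero>\<^bsub>R\<^esub>}" "{p. s (snd q) p \<noteq> \<zero>\<^bsub>R\<^esub>} \<subseteq> carrier N"
        by (auto simp: free_module_def)
    qed
    then show "finite (supp U)" "supp U \<subseteq> carrier N"
      using rep_support(1)[OF that] unfolding supp_def by blast+
  qed
  note pb = bilinear_mapD[OF pure_tensor_bilinear]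
  have expand: "U = (\<Oplus>\<^bsub>tensor R M N\<^esub>p\<in>I. pure_tensor R M N (tensor_lift R M (\<lambda>m n. s n p \<odot>\<^bsub>M\<^esub> m) U) p)"
    if U: "U \<in> carrier (tensor R M N)" and I: "finite I" "supp U \<subseteq> I" "I \<subseteq> carrier N" for U I
  proof -
    have c: "pure_tensor R M N (s n p \<odot>\<^bsub>M\<^esub> m) p \<in> carrier (tensor R M N)"
      if "m \<in> carrier M" "n \<in> carrier N" "p \<in> I" for m n p
      using that spR I by (intro pure_tensor_closed) auto
    have "U = tensor_lift R (tensor R M N) (pure_tensor R M N) U" by (simp add: tensor_lift_pure_tensor[OF U])
    also have "\<dots> = tensor_lift R (tensor R M N)
        (\<lambda>m n. \<Oplus>\<^bsub>tensor R M N\<^esub>p\<in>I. pure_tensor R M N (s n p \<odot>\<^bsub>M\<^esub> m) p) U"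
    proof (rule tensor_lift_cong_support[OF module_tensor U])
      fix m n assume m: "m \<in> carrier M" and n: "n \<in> carrier N"
      then show "(\<Oplus>\<^bsub>tensor R M N\<^esub>p\<in>I. pure_tensor R M N (s n p \<odot>\<^bsub>M\<^esub> m) p) \<in> carrier (tensor R M N)"
        using c by (intro T.M.finsum_closed) auto
      assume "rep U (m, n) \<noteq> \<zero>\<^bsub>R\<^esub>"
      then have sI: "{p. s n p \<noteq> \<zero>\<^bsub>R\<^esub>} \<subseteq> I" using I(2) unfolding supp_def by fastforce
      have "pure_tensor R M N m n = pure_tensor R M N m (lin_ext R N (\<lambda>p. p) (s n))" using s(2)[OF n] by simp
      also have "\<dots> = lin_ext R (tensor R M N) (\<lambda>p. pure_tensor R M N m p) (s n)"
        by (rule lin_map_lin_ext[OF N.left_module_axioms T.left_module_axioms pb(2)[OF m] _ sc[OF n]]) simp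
      also have "\<dots> = (\<Oplus>\<^bsub>tensor R M N\<^esub>p\<in>I. s n p \<odot>\<^bsub>tensor R M N\<^esub> pure_tensor R M N m p)"
        using pure_tensor_closed m by (intro T.lin_ext_superset[OF _ sc[OF n] I(1) sI I(3)]) auto
      also have "\<dots> = (\<Oplus>\<^bsub>tensor R M N\<^esub>p\<in>I. pure_tensor R M N (s n p \<odot>\<^bsub>M\<^esub> m) p)"
        using I(3) c m n lin_mapD(3)[OF pb(1)] spR[OF n]
        by (intro T.M.finsum_cong') (auto simp: subset_iff)
      finally show "pure_tensor R M N m n = (\<Oplus>\<^bsub>tensor R M N\<^esub>p\<in>I. pure_tensor R M N (s n p \<odot>\<^bsub>M\<^esub> m) p)" .
    qed
    also have "\<dots> = (\<Oplus>\<^bsub>tensor R M N\<^esub>p\<in>I. tensor_lift R (tensor R M N) (\<lambda>m n. pure_tensor R M N (s n p \<odot>\<^bsub>M\<^esub> m) p) U)"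
      using c by (intro tensor_lift_finsum module_tensor U I)
    also have "\<dots> = (\<Oplus>\<^bsub>tensor R M N\<^esub>p\<in>I. pure_tensor R M N (tensor_lift R M (\<lambda>m n. s n p \<odot>\<^bsub>M\<^esub> m) U) p)"
    proof (intro T.M.finsum_cong' refl)
      have tl: "tensor_lift R M (\<lambda>m n. s n p \<odot>\<^bsub>M\<^esub> m) U \<in> carrier M" for p
        using spR by (intro tensor_lift_closed module_left U M.smult_closed)
      then show "(\<lambda>p. pure_tensor R M N (tensor_lift R M (\<lambda>m n. s n p \<odot>\<^bsub>M\<^esub> m) U) p) \<in> I \<rightarrow> carrier (tensor R M N)"
        using I(3) by (auto intro!: pure_tensor_closed)
      fix p assume "p \<in> I"
      then have "p \<in> carrier N" using I by auto
      then show "tensor_lift R (tensor R M N) (\<lambda>m n. pure_tensor R M N (s n p \<odot>\<^bsub>M\<^esub> m) p) U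
          = pure_tensor R M N (tensor_lift R M (\<lambda>m n. s n p \<odot>\<^bsub>M\<^esub> m) U) p"
        using spR by (intro lin_map_tensor_lift[OF module_left U _ module_tensor pb(1), symmetric]) auto
    qed
    finally show ?thesis .
  qed
  let ?I = "supp U \<union> supp V"
  have I: "finite ?I" "?I \<subseteq> carrier N" using supp[OF U] supp[OF V] by auto
  have "U = (\<Oplus>\<^bsub>tensor R M N\<^esub>p\<in>?I. pure_tensor R M N (tensor_lift R M (\<lambda>m n. s n p \<odot>\<^bsub>M\<^esub> m) U) p)"
    using I by (intro expand U) auto
  also have "\<dots> = (\<Oplus>\<^bsub>tensor R M N\<^esub>p\<in>?I. pure_tensor R M N (tensor_lift R M (\<lambda>m n. s n p \<odot>\<^bsub>M\<^esub> m) V) p)"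
  proof (intro T.M.finsum_cong' refl)
    have tl: "tensor_lift R M (\<lambda>m n. s n p \<odot>\<^bsub>M\<^esub> m) V \<in> carrier M" for p
      using spR by (intro tensor_lift_closed module_left V M.smult_closed)
    then show "(\<lambda>p. pure_tensor R M N (tensor_lift R M (\<lambda>m n. s n p \<odot>\<^bsub>M\<^esub> m) V) p) \<in> ?I \<rightarrow> carrier (tensor R M N)"
      using I(2) by (intro funcsetI pure_tensor_closed tl) auto
    show "pure_tensor R M N (tensor_lift R M (\<lambda>m n. s n p \<odot>\<^bsub>M\<^esub> m) U) p
        = pure_tensor R M N (tensor_lift R M (\<lambda>m n. s n p \<odot>\<^bsub>M\<^esub> m) V) p" if "p \<in> ?I" for p
    proof -
      have "p \<in> carrier N" using I(2) that by blast
      then show ?thesis by (simp only: eq)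
    qed
  qed
  also have "\<dots> = V" using I by (intro expand[symmetric] V) auto
  finally show ?thesis .
qed


section \<open>The dual algebra of a coalgebra\<close>

context coalgebra
begin

abbreviation "dual \<equiv> dual_algebra R C \<Delta> \<epsilon>"
abbreviation "scalar \<equiv> regular_module R"
text \<open>The scalar Sweedler sum \<open>\<Sum> B c\<^sub>1 c\<^sub>2\<close>. Identities between elements of a Hopf algebra are reduced to
  identities between such sums, by applying functionals.\<close>

abbreviation "sw B c \<equiv> tensor_lift R scalar B (\<Delta> c)"

lemma cring: "cring R" using module by (simp add: module_def)

interpretation R: cring R by (rule cring)
interpretation C: left_module R C by (rule module_imp_left_module) (rule module)

lemma scalar_module: "module R scalar" by (rule regular_module_module) (rule cring)

lemma tensor_pair_self: "tensor_pair R C C" by (intro tensor_pair.intro cring module)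

lemma comult_closed: "c \<in> carrier C \<Longrightarrow> \<Delta> c \<in> carrier (tensor R C C)"
  using lin_mapD(1)[OF coaction] .

lemma sw_closed:
  assumes "c \<in> carrier C" "\<And>x y. \<lbrakk>x \<in> carrier C; y \<in> carrier C\<rbrakk> \<Longrightarrow> B x y \<in> carrier R"
  shows "sw B c \<in> carrier R"
  using tensor_pair.tensor_lift_closed[OF tensor_pair_self scalar_module comult_closed[OF assms(1)]] assms(2) by auto

lemma sw_cong:
  assumes "c \<in> carrier C" "\<And>x y. \<lbrakk>x \<in> carrier C; y \<in> carrier C\<rbrakk> \<Longrightarrow> B' x y \<in> carrier R"
    "\<And>x y. \<lbrakk>x \<in> carrier C; y \<in> carrier C\<rbrakk> \<Longrightarrow> B x y = B' x y"
  shows "sw B c = sw B' c"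
  using tensor_pair.tensor_lift_cong[OF tensor_pair_self scalar_module comult_closed[OF assms(1)]] assms(2,3) by auto

lemma sw_scalar_mult:
  assumes "c \<in> carrier C" "a \<in> carrier R" "\<And>x y. \<lbrakk>x \<in> carrier C; y \<in> carrier C\<rbrakk> \<Longrightarrow> B x y \<in> carrier R"
  shows "sw (\<lambda>x y. a \<otimes>\<^bsub>R\<^esub> B x y) c = a \<otimes>\<^bsub>R\<^esub> sw B c" "sw (\<lambda>x y. B x y \<otimes>\<^bsub>R\<^esub> a) c = sw B c \<otimes>\<^bsub>R\<^esub> a"
proof -
  show 1: "sw (\<lambda>x y. a \<otimes>\<^bsub>R\<^esub> B x y) c = a \<otimes>\<^bsub>R\<^esub> sw B c"
    using tensor_pair.tensor_lift_smult[OF tensor_pair_self scalar_module comult_closed[OF assms(1)], of B a] assms(2,3) by auto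
  have "sw (\<lambda>x y. B x y \<otimes>\<^bsub>R\<^esub> a) c = sw (\<lambda>x y. a \<otimes>\<^bsub>R\<^esub> B x y) c"
    using assms by (intro sw_cong) (auto simp: R.m_comm)
  then show "sw (\<lambda>x y. B x y \<otimes>\<^bsub>R\<^esub> a) c = sw B c \<otimes>\<^bsub>R\<^esub> a"
    using 1 assms sw_closed by (simp add: R.m_comm)
qed

lemma sw_add:
  assumes "c \<in> carrier C" "\<And>x y. \<lbrakk>x \<in> carrier C; y \<in> carrier C\<rbrakk> \<Longrightarrow> B x y \<in> carrier R"
    "\<And>x y. \<lbrakk>x \<in> carrier C; y \<in> carrier C\<rbrakk> \<Longrightarrow> B' x y \<in> carrier R"
  shows "sw (\<lambda>x y. B x y \<oplus>\<^bsub>R\<^esub> B' x y) c = sw B c \<oplus>\<^bsub>R\<^esub> sw B' c"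
  using tensor_pair.tensor_lift_add[OF tensor_pair_self scalar_module comult_closed[OF assms(1)], of B B'] assms(2,3) by auto

lemma sw_swap:
  assumes "c \<in> carrier C" "d \<in> carrier C"
    "\<And>x y u v. \<lbrakk>x \<in> carrier C; y \<in> carrier C; u \<in> carrier C; v \<in> carrier C\<rbrakk> \<Longrightarrow> B x y u v \<in> carrier R"
  shows "sw (\<lambda>x y. sw (\<lambda>u v. B x y u v) d) c = sw (\<lambda>u v. sw (\<lambda>x y. B x y u v) c) d"
  by (rule tensor_lift_swap[OF tensor_pair_self tensor_pair_self scalar_module comult_closed comult_closed]) (auto intro: assms)

lemma sw_coassoc:
  assumes "t \<in> trilinear_map R C C C scalar" "c \<in> carrier C"
  shows "sw (\<lambda>x z. sw (\<lambda>x' y. t x' y z) x) c = sw (\<lambda>x w. sw (\<lambda>y z. t x y z) w) c"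
  by (rule coaction_coassoc[OF coalgebra_axioms right_comodule_axioms scalar_module assms])

lemma sw_lin_map:
  assumes "B \<in> bilinear_map R C C scalar"
  shows "(\<lambda>c. sw B c) \<in> lin_map R C scalar"
proof -
  note L = lin_mapD[OF tensor_lift_lin_map[OF cring module module scalar_module assms]]
  show ?thesis using L lin_mapD[OF coaction] by (intro lin_mapI) simp_all
qed

lemma sw_lin_map_param:
  assumes "c \<in> carrier C" "module R Q"
    "\<And>x y. \<lbrakk>x \<in> carrier C; y \<in> carrier C\<rbrakk> \<Longrightarrow> (\<lambda>q. B q x y) \<in> lin_map R Q scalar"
  shows "(\<lambda>q. sw (B q) c) \<in> lin_map R Q scalar"
  using tensor_pair.lin_map_tensor_lift_param[OF tensor_pair_self scalar_module comult_closed[OF assms(1)] assms(2)] assms(3) by blast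

lemma counit_closed: "c \<in> carrier C \<Longrightarrow> \<epsilon> c \<in> carrier R"
  using lin_mapD(1)[OF counit] by simp

lemma sw_counit:
  assumes f: "f \<in> lin_map R C scalar" and c: "c \<in> carrier C"
  shows "sw (\<lambda>x y. \<epsilon> y \<otimes>\<^bsub>R\<^esub> f x) c = f c" "sw (\<lambda>x y. \<epsilon> x \<otimes>\<^bsub>R\<^esub> f y) c = f c"
proof -
  interpret CC: tensor_pair R C C by (rule tensor_pair_self)
  have "f (tensor_lift R C (\<lambda>x y. \<epsilon> y \<odot>\<^bsub>C\<^esub> x) (\<Delta> c)) = sw (\<lambda>x y. f (\<epsilon> y \<odot>\<^bsub>C\<^esub> x)) c"
    by (rule CC.lin_map_tensor_lift[OF module comult_closed[OF c] _ scalar_module f]) (simp add: counit_closed)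
  also have "\<dots> = sw (\<lambda>x y. \<epsilon> y \<otimes>\<^bsub>R\<^esub> f x) c"
    using lin_mapD[OF f] by (intro sw_cong c) (auto simp: counit_closed)
  finally show "sw (\<lambda>x y. \<epsilon> y \<otimes>\<^bsub>R\<^esub> f x) c = f c" using coaction_counit[OF c] by simp
  have "f (tensor_lift R C (\<lambda>x y. \<epsilon> x \<odot>\<^bsub>C\<^esub> y) (\<Delta> c)) = sw (\<lambda>x y. f (\<epsilon> x \<odot>\<^bsub>C\<^esub> y)) c"
    by (rule CC.lin_map_tensor_lift[OF module comult_closed[OF c] _ scalar_module f]) (simp add: counit_closed)
  also have "\<dots> = sw (\<lambda>x y. \<epsilon> x \<otimes>\<^bsub>R\<^esub> f y) c"
    using lin_mapD[OF f] by (intro sw_cong c) (auto simp: counit_closed)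
  finally show "sw (\<lambda>x y. \<epsilon> x \<otimes>\<^bsub>R\<^esub> f y) c = f c" using left_counit[OF c] by simp
qed

lemma dual_simps:
  "\<one>\<^bsub>dual\<^esub> = (\<lambda>c\<in>carrier C. \<epsilon> c)" "\<zero>\<^bsub>dual\<^esub> = (\<lambda>c\<in>carrier C. \<zero>\<^bsub>R\<^esub>)"
  "f \<otimes>\<^bsub>dual\<^esub> g = (\<lambda>c\<in>carrier C. sw (\<lambda>x y. f x \<otimes>\<^bsub>R\<^esub> g y) c)"
  "f \<oplus>\<^bsub>dual\<^esub> g = (\<lambda>c\<in>carrier C. f c \<oplus>\<^bsub>R\<^esub> g c)"
  by (simp_all add: dual_algebra_def)

lemma dual_carrierD:
  assumes "f \<in> carrier dual"
  shows "f \<in> lin_map R C scalar" "c \<in> carrier C \<Longrightarrow> f c \<in> carrier R"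
  using assms lin_mapD(1)[of f R C scalar c] by (auto simp: dual_algebra_def)

lemma restrict_dual: "f \<in> lin_map R C scalar \<Longrightarrow> restrict f (carrier C) \<in> carrier dual"
  by (auto simp: dual_algebra_def intro: lin_map_cong[OF _ C.left_module_axioms])

lemma dual_eqI:
  assumes "f \<in> carrier dual" "g \<in> carrier dual" "\<And>c. c \<in> carrier C \<Longrightarrow> f c = g c"
  shows "f = g"
  using assms by (auto simp: dual_algebra_def intro: extensionalityI)

lemma mult_bilinear:
  assumes "f \<in> lin_map R C scalar" "g \<in> lin_map R C scalar"
  shows "(\<lambda>x y. f x \<otimes>\<^bsub>R\<^esub> g y) \<in> bilinear_map R C C scalar"
  using lin_mapD(1)[OF assms(1)] lin_mapD(1)[OF assms(2)]
  by (intro bilinear_mapI lin_map_mult cring assms) auto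

lemma dual_mult_closed:
  assumes "f \<in> carrier dual" "g \<in> carrier dual"
  shows "f \<otimes>\<^bsub>dual\<^esub> g \<in> carrier dual"
  unfolding dual_simps using assms by (intro restrict_dual sw_lin_map mult_bilinear dual_carrierD)

lemma dual_ring: "ring dual"
proof (intro ringI abelian_groupI monoidI)
  fix f g assume f: "f \<in> carrier dual" and g: "g \<in> carrier dual"
  note fD = dual_carrierD[OF f] lin_mapD[OF dual_carrierD(1)[OF f]]
  note gD = dual_carrierD[OF g] lin_mapD[OF dual_carrierD(1)[OF g]]
  show fg: "f \<oplus>\<^bsub>dual\<^esub> g \<in> carrier dual" unfolding dual_simps
    using fD gD by (intro restrict_dual lin_mapI) (auto simp: R.a_ac R.r_distr)
  show "f \<oplus>\<^bsub>dual\<^esub> g = g \<oplus>\<^bsub>dual\<^esub> f" unfolding dual_simps using fD gD by (auto simp: R.a_comm intro!: restrict_ext)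
  show "f \<otimes>\<^bsub>dual\<^esub> g \<in> carrier dual" by (rule dual_mult_closed[OF f g])
next
  fix f assume f: "f \<in> carrier dual"
  note fD = dual_carrierD[OF f] lin_mapD[OF dual_carrierD(1)[OF f]]
  have "(\<lambda>c\<in>carrier C. \<ominus>\<^bsub>R\<^esub> f c) \<in> carrier dual"
    using fD by (intro restrict_dual lin_mapI) (auto simp: R.minus_add R.r_minus)
  moreover have "(\<lambda>c\<in>carrier C. \<ominus>\<^bsub>R\<^esub> f c) \<oplus>\<^bsub>dual\<^esub> f = \<zero>\<^bsub>dual\<^esub>"
    unfolding dual_simps using fD by (auto simp: R.l_neg intro!: restrict_ext)
  ultimately show "\<exists>g\<in>carrier dual. g \<oplus>\<^bsub>dual\<^esub> f = \<zero>\<^bsub>dual\<^esub>" by blast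
next
  show z: "\<zero>\<^bsub>dual\<^esub> \<in> carrier dual" unfolding dual_simps by (intro restrict_dual lin_mapI) auto
  show o: "\<one>\<^bsub>dual\<^esub> \<in> carrier dual" unfolding dual_simps by (intro restrict_dual counit)
  fix f assume f: "f \<in> carrier dual"
  note fD = dual_carrierD[OF f]
  have fe: "f = (\<lambda>c\<in>carrier C. f c)" using f by (auto simp: dual_algebra_def extensional_restrict)
  show "\<zero>\<^bsub>dual\<^esub> \<oplus>\<^bsub>dual\<^esub> f = f" unfolding dual_simps by (subst (2) fe) (use fD in \<open>auto intro!: restrict_ext\<close>)
  show "\<one>\<^bsub>dual\<^esub> \<otimes>\<^bsub>dual\<^esub> f = f"
  proof (rule dual_eqI[OF dual_mult_closed[OF o f] f])
    fix c assume c: "c \<in> carrier C"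
    have "sw (\<lambda>x y. \<one>\<^bsub>dual\<^esub> x \<otimes>\<^bsub>R\<^esub> f y) c = sw (\<lambda>x y. \<epsilon> x \<otimes>\<^bsub>R\<^esub> f y) c"
      using c fD counit_closed by (intro sw_cong) (auto simp: dual_simps)
    then show "(\<one>\<^bsub>dual\<^esub> \<otimes>\<^bsub>dual\<^esub> f) c = f c" using c sw_counit(2)[OF fD(1) c] by (simp add: dual_simps(3))
  qed
  show "f \<otimes>\<^bsub>dual\<^esub> \<one>\<^bsub>dual\<^esub> = f"
  proof (rule dual_eqI[OF dual_mult_closed[OF f o] f])
    fix c assume c: "c \<in> carrier C"
    have "sw (\<lambda>x y. f x \<otimes>\<^bsub>R\<^esub> \<one>\<^bsub>dual\<^esub> y) c = sw (\<lambda>x y. \<epsilon> y \<otimes>\<^bsub>R\<^esub> f x) c"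
      using c fD counit_closed by (intro sw_cong) (auto simp: dual_simps R.m_comm)
    then show "(f \<otimes>\<^bsub>dual\<^esub> \<one>\<^bsub>dual\<^esub>) c = f c" using c sw_counit(1)[OF fD(1) c] by (simp add: dual_simps(3))
  qed
next
  fix f g h assume f: "f \<in> carrier dual" and g: "g \<in> carrier dual" and h: "h \<in> carrier dual"
  note fD = dual_carrierD[OF f] and gD = dual_carrierD[OF g] and hD = dual_carrierD[OF h]
  show "f \<oplus>\<^bsub>dual\<^esub> g \<oplus>\<^bsub>dual\<^esub> h = f \<oplus>\<^bsub>dual\<^esub> (g \<oplus>\<^bsub>dual\<^esub> h)"
    unfolding dual_simps using fD gD hD by (auto simp: R.a_assoc intro!: restrict_ext)
  show "(f \<oplus>\<^bsub>dual\<^esub> g) \<otimes>\<^bsub>dual\<^esub> h = f \<otimes>\<^bsub>dual\<^esub> h \<oplus>\<^bsub>dual\<^esub> g \<otimes>\<^bsub>dual\<^esub> h"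
    unfolding dual_simps
  proof (rule restrict_ext)
    fix c assume c: "c \<in> carrier C"
    have "sw (\<lambda>x y. (\<lambda>c\<in>carrier C. f c \<oplus>\<^bsub>R\<^esub> g c) x \<otimes>\<^bsub>R\<^esub> h y) c = sw (\<lambda>x y. f x \<otimes>\<^bsub>R\<^esub> h y \<oplus>\<^bsub>R\<^esub> g x \<otimes>\<^bsub>R\<^esub> h y) c"
      using c fD gD hD by (intro sw_cong) (auto simp: R.l_distr)
    also have "\<dots> = sw (\<lambda>x y. f x \<otimes>\<^bsub>R\<^esub> h y) c \<oplus>\<^bsub>R\<^esub> sw (\<lambda>x y. g x \<otimes>\<^bsub>R\<^esub> h y) c"
      using c fD gD hD by (intro sw_add) auto
    finally show "sw (\<lambda>x y. (\<lambda>c\<in>carrier C. f c \<oplus>\<^bsub>R\<^esub> g c) x \<otimes>\<^bsub>R\<^esub> h y) c =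
      (\<lambda>c\<in>carrier C. sw (\<lambda>x y. f x \<otimes>\<^bsub>R\<^esub> h y) c) c \<oplus>\<^bsub>R\<^esub> (\<lambda>c\<in>carrier C. sw (\<lambda>x y. g x \<otimes>\<^bsub>R\<^esub> h y) c) c"
      using c by simp
  qed
  show "h \<otimes>\<^bsub>dual\<^esub> (f \<oplus>\<^bsub>dual\<^esub> g) = h \<otimes>\<^bsub>dual\<^esub> f \<oplus>\<^bsub>dual\<^esub> h \<otimes>\<^bsub>dual\<^esub> g"
    unfolding dual_simps
  proof (rule restrict_ext)
    fix c assume c: "c \<in> carrier C"
    have "sw (\<lambda>x y. h x \<otimes>\<^bsub>R\<^esub> (\<lambda>c\<in>carrier C. f c \<oplus>\<^bsub>R\<^esub> g c) y) c = sw (\<lambda>x y. h x \<otimes>\<^bsub>R\<^esub> f y \<oplus>\<^bsub>R\<^esub> h x \<otimes>\<^bsub>R\<^esub> g y) c"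
      using c fD gD hD by (intro sw_cong) (auto simp: R.r_distr)
    also have "\<dots> = sw (\<lambda>x y. h x \<otimes>\<^bsub>R\<^esub> f y) c \<oplus>\<^bsub>R\<^esub> sw (\<lambda>x y. h x \<otimes>\<^bsub>R\<^esub> g y) c"
      using c fD gD hD by (intro sw_add) auto
    finally show "sw (\<lambda>x y. h x \<otimes>\<^bsub>R\<^esub> (\<lambda>c\<in>carrier C. f c \<oplus>\<^bsub>R\<^esub> g c) y) c =
      (\<lambda>c\<in>carrier C. sw (\<lambda>x y. h x \<otimes>\<^bsub>R\<^esub> f y) c) c \<oplus>\<^bsub>R\<^esub> (\<lambda>c\<in>carrier C. sw (\<lambda>x y. h x \<otimes>\<^bsub>R\<^esub> g y) c) c"
      using c by simp
  qed
  show "f \<otimes>\<^bsub>dual\<^esub> g \<otimes>\<^bsub>dual\<^esub> h = f \<otimes>\<^bsub>dual\<^esub> (g \<otimes>\<^bsub>dual\<^esub> h)"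
  proof (rule dual_eqI)
    fix c assume c: "c \<in> carrier C"
    have "(f \<otimes>\<^bsub>dual\<^esub> g \<otimes>\<^bsub>dual\<^esub> h) c = sw (\<lambda>x z. (f \<otimes>\<^bsub>dual\<^esub> g) x \<otimes>\<^bsub>R\<^esub> h z) c"
      using c by (simp add: dual_simps(3))
    also have "\<dots> = sw (\<lambda>x z. sw (\<lambda>x' y. f x' \<otimes>\<^bsub>R\<^esub> g y \<otimes>\<^bsub>R\<^esub> h z) x) c"
      using fD gD hD by (intro sw_cong c) (auto simp: dual_simps(3) sw_scalar_mult intro!: sw_closed)
    also have "\<dots> = sw (\<lambda>x w. sw (\<lambda>y z. f x \<otimes>\<^bsub>R\<^esub> g y \<otimes>\<^bsub>R\<^esub> h z) w) c"
      using fD gD hD by (intro sw_coassoc c trilinear_mapI lin_map_mult cring) auto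
    also have "\<dots> = sw (\<lambda>x w. f x \<otimes>\<^bsub>R\<^esub> (g \<otimes>\<^bsub>dual\<^esub> h) w) c"
      using fD gD hD by (intro sw_cong c) (auto simp: dual_simps(3) sw_scalar_mult(1)[symmetric] R.m_assoc intro!: sw_closed sw_cong)
    also have "\<dots> = (f \<otimes>\<^bsub>dual\<^esub> (g \<otimes>\<^bsub>dual\<^esub> h)) c" using c by (simp add: dual_simps(3))
    finally show "(f \<otimes>\<^bsub>dual\<^esub> g \<otimes>\<^bsub>dual\<^esub> h) c = (f \<otimes>\<^bsub>dual\<^esub> (g \<otimes>\<^bsub>dual\<^esub> h)) c" .
  qed (intro dual_mult_closed f g h)+
qed

lemma comodule_to_module_simps:
  "carrier (comodule_to_module R M \<rho>) = carrier M" "\<zero>\<^bsub>comodule_to_module R M \<rho>\<^esub> = \<zero>\<^bsub>M\<^esub>"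
  "x \<oplus>\<^bsub>comodule_to_module R M \<rho>\<^esub> y = x \<oplus>\<^bsub>M\<^esub> y"
  "f \<odot>\<^bsub>comodule_to_module R M \<rho>\<^esub> x = tensor_lift R M (\<lambda>x c. f c \<odot>\<^bsub>M\<^esub> x) (\<rho> x)"
  by (simp_all add: comodule_to_module_def)

lemma comodule_to_module_finsum:
  "finsum (comodule_to_module R M \<rho>) = finsum M"
  by (intro ext) (simp add: finsum_def finprod_def comodule_to_module_def)

lemma coaction_bilinear:
  assumes M: "module R M" and f: "f \<in> lin_map R C scalar"
  shows "(\<lambda>x c. f c \<odot>\<^bsub>M\<^esub> x) \<in> bilinear_map R M C M"
proof -
  interpret M: left_module R M by (rule module_imp_left_module) (rule M)
  note fD = lin_mapD[OF f]
  show ?thesis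
    using fD by (intro bilinear_mapI lin_mapI)
      (auto simp: M.smult_r_distr M.smult_l_distr M.smult_assoc1[symmetric] R.m_comm)
qed

text \<open>The associativity law \<open>f \<cdot> (g \<cdot> m) = \<Sum> f(m\<^sub>1) g(m\<^sub>2) m\<^sub>0 = (f * g) \<cdot> m\<close> is coassociativity of the
  coaction.\<close>

lemma comodule_left_module:
  assumes "right_comodule R C \<Delta> \<epsilon> M \<rho>"
  shows "left_module dual (comodule_to_module R M \<rho>)"
proof -
  interpret Mc: right_comodule R C \<Delta> \<epsilon> M \<rho> by fact
  interpret M: left_module R M by (rule module_imp_left_module) (rule Mc.module)
  interpret MC: tensor_pair R M C by (intro tensor_pair.intro cring module Mc.module)
  note rD = lin_mapD[OF Mc.coaction]
  note tl = MC.tensor_lift_closed[OF Mc.module rD(1)]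
  note act = lin_mapD[OF tensor_lift_lin_map[OF cring Mc.module module Mc.module coaction_bilinear[OF Mc.module dual_carrierD(1)]]]
  show ?thesis
  proof (intro left_module.intro left_module_axioms.intro abelian_groupI dual_ring; (unfold comodule_to_module_simps)?)
    fix f x assume f: "f \<in> carrier dual" and x: "x \<in> carrier M"
    note fD = dual_carrierD[OF f]
    show "tensor_lift R M (\<lambda>x c. f c \<odot>\<^bsub>M\<^esub> x) (\<rho> x) \<in> carrier M"
      using fD x by (intro tl) auto
    fix y assume y: "y \<in> carrier M"
    show "tensor_lift R M (\<lambda>x c. f c \<odot>\<^bsub>M\<^esub> x) (\<rho> (x \<oplus>\<^bsub>M\<^esub> y))
        = tensor_lift R M (\<lambda>x c. f c \<odot>\<^bsub>M\<^esub> x) (\<rho> x) \<oplus>\<^bsub>M\<^esub> tensor_lift R M (\<lambda>x c. f c \<odot>\<^bsub>M\<^esub> x) (\<rho> y)"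
      using act(2)[OF f rD(1)[OF x] rD(1)[OF y]] rD(2)[OF x y] by simp
  next
    fix f g x assume f: "f \<in> carrier dual" and g: "g \<in> carrier dual" and x: "x \<in> carrier M"
    note fD = dual_carrierD[OF f] and gD = dual_carrierD[OF g]
    show "tensor_lift R M (\<lambda>x c. (f \<oplus>\<^bsub>dual\<^esub> g) c \<odot>\<^bsub>M\<^esub> x) (\<rho> x)
        = tensor_lift R M (\<lambda>x c. f c \<odot>\<^bsub>M\<^esub> x) (\<rho> x) \<oplus>\<^bsub>M\<^esub> tensor_lift R M (\<lambda>x c. g c \<odot>\<^bsub>M\<^esub> x) (\<rho> x)"
      using fD gD
      by (subst MC.tensor_lift_add[OF Mc.module rD(1)[OF x], symmetric])
         (auto simp: dual_simps M.smult_l_distr intro!: MC.tensor_lift_cong[OF Mc.module rD(1)[OF x]])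
    have fg: "f c \<odot>\<^bsub>M\<^esub> (g d \<odot>\<^bsub>M\<^esub> x) = (f c \<otimes>\<^bsub>R\<^esub> g d) \<odot>\<^bsub>M\<^esub> x" if "c \<in> carrier C" "d \<in> carrier C" "x \<in> carrier M" for c d x
      using that fD gD by (simp add: M.smult_assoc1)
    have tri: "(\<lambda>x c d. (f c \<otimes>\<^bsub>R\<^esub> g d) \<odot>\<^bsub>M\<^esub> x) \<in> trilinear_map R M C C M"
    proof (intro trilinear_mapI)
      fix x d assume "x \<in> carrier M" "d \<in> carrier C"
      then show "(\<lambda>c. (f c \<otimes>\<^bsub>R\<^esub> g d) \<odot>\<^bsub>M\<^esub> x) \<in> lin_map R C M"
        "(\<lambda>c. (f d \<otimes>\<^bsub>R\<^esub> g c) \<odot>\<^bsub>M\<^esub> x) \<in> lin_map R C M"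
        using fD gD lin_mapD[OF fD(1)] lin_mapD[OF gD(1)]
        by (auto intro!: lin_mapI simp: R.l_distr R.r_distr M.smult_l_distr M.smult_assoc1[symmetric] R.m_assoc R.m_lcomm)
    next
      fix c d assume "c \<in> carrier C" "d \<in> carrier C"
      then show "(\<lambda>x. (f c \<otimes>\<^bsub>R\<^esub> g d) \<odot>\<^bsub>M\<^esub> x) \<in> lin_map R M M"
        using fD gD by (intro lin_mapI) (auto simp: M.smult_r_distr M.smult_assoc1[symmetric] R.m_ac)
    qed
    have "tensor_lift R M (\<lambda>x c. f c \<odot>\<^bsub>M\<^esub> x) (\<rho> (tensor_lift R M (\<lambda>x c. g c \<odot>\<^bsub>M\<^esub> x) (\<rho> x)))
        = tensor_lift R M (\<lambda>x d. tensor_lift R M (\<lambda>x c. f c \<odot>\<^bsub>M\<^esub> x) (\<rho> (g d \<odot>\<^bsub>M\<^esub> x))) (\<rho> x)"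
    proof (rule MC.lin_map_tensor_lift[OF Mc.module rD(1)[OF x] _ Mc.module])
      show "(\<lambda>y. tensor_lift R M (\<lambda>x c. f c \<odot>\<^bsub>M\<^esub> x) (\<rho> y)) \<in> lin_map R M M"
        using act[OF f] rD by (intro lin_mapI) auto
    qed (use gD in auto)
    also have "\<dots> = tensor_lift R M (\<lambda>x d. tensor_lift R M (\<lambda>x c. (f c \<otimes>\<^bsub>R\<^esub> g d) \<odot>\<^bsub>M\<^esub> x) (\<rho> x)) (\<rho> x)"
    proof (rule MC.tensor_lift_cong[OF Mc.module rD(1)[OF x]])
      fix y d assume y: "y \<in> carrier M" and d: "d \<in> carrier C"
      show "tensor_lift R M (\<lambda>x c. (f c \<otimes>\<^bsub>R\<^esub> g d) \<odot>\<^bsub>M\<^esub> x) (\<rho> y) \<in> carrier M"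
        using fD gD d by (intro tl y) auto
      have "tensor_lift R M (\<lambda>x c. f c \<odot>\<^bsub>M\<^esub> x) (\<rho> (g d \<odot>\<^bsub>M\<^esub> y)) = g d \<odot>\<^bsub>M\<^esub> tensor_lift R M (\<lambda>x c. f c \<odot>\<^bsub>M\<^esub> x) (\<rho> y)"
        using act(3)[OF f gD(2)[OF d] rD(1)[OF y]] rD(3)[OF gD(2)[OF d] y] by simp
      also have "\<dots> = tensor_lift R M (\<lambda>x c. g d \<odot>\<^bsub>M\<^esub> (f c \<odot>\<^bsub>M\<^esub> x)) (\<rho> y)"
        using fD gD d by (intro MC.tensor_lift_smult[OF Mc.module rD(1)[OF y], symmetric]) auto
      also have "\<dots> = tensor_lift R M (\<lambda>x c. (f c \<otimes>\<^bsub>R\<^esub> g d) \<odot>\<^bsub>M\<^esub> x) (\<rho> y)"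
        using fD gD d by (intro MC.tensor_lift_cong[OF Mc.module rD(1)[OF y]]) (auto simp: M.smult_assoc1[symmetric] R.m_comm)
      finally show "tensor_lift R M (\<lambda>x c. f c \<odot>\<^bsub>M\<^esub> x) (\<rho> (g d \<odot>\<^bsub>M\<^esub> y)) = tensor_lift R M (\<lambda>x c. (f c \<otimes>\<^bsub>R\<^esub> g d) \<odot>\<^bsub>M\<^esub> x) (\<rho> y)" .
    qed
    also have "\<dots> = tensor_lift R M (\<lambda>x c. tensor_lift R M (\<lambda>c' c''. (f c' \<otimes>\<^bsub>R\<^esub> g c'') \<odot>\<^bsub>M\<^esub> x) (\<Delta> c)) (\<rho> x)"
      by (rule coaction_coassoc[OF coalgebra_axioms assms Mc.module tri x])
    also have "\<dots> = tensor_lift R M (\<lambda>x c. (f \<otimes>\<^bsub>dual\<^esub> g) c \<odot>\<^bsub>M\<^esub> x) (\<rho> x)"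
    proof (rule MC.tensor_lift_cong[OF Mc.module rD(1)[OF x]])
      fix y c assume y: "y \<in> carrier M" and c: "c \<in> carrier C"
      show "(f \<otimes>\<^bsub>dual\<^esub> g) c \<odot>\<^bsub>M\<^esub> y \<in> carrier M"
        using dual_carrierD(2)[OF dual_mult_closed[OF f g] c] y by simp
      have "(\<lambda>a. a \<odot>\<^bsub>M\<^esub> y) \<in> lin_map R scalar M"
        using y by (intro lin_mapI) (auto simp: M.smult_l_distr M.smult_assoc1)
      then have "sw (\<lambda>c' c''. f c' \<otimes>\<^bsub>R\<^esub> g c'') c \<odot>\<^bsub>M\<^esub> y = tensor_lift R M (\<lambda>c' c''. (f c' \<otimes>\<^bsub>R\<^esub> g c'') \<odot>\<^bsub>M\<^esub> y) (\<Delta> c)"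
        using fD gD by (intro tensor_pair.lin_map_tensor_lift[OF tensor_pair_self scalar_module comult_closed[OF c] _ Mc.module]) auto
      then show "tensor_lift R M (\<lambda>c' c''. (f c' \<otimes>\<^bsub>R\<^esub> g c'') \<odot>\<^bsub>M\<^esub> y) (\<Delta> c) = (f \<otimes>\<^bsub>dual\<^esub> g) c \<odot>\<^bsub>M\<^esub> y"
        using c by (simp add: dual_simps(3))
    qed
    finally show "tensor_lift R M (\<lambda>x c. (f \<otimes>\<^bsub>dual\<^esub> g) c \<odot>\<^bsub>M\<^esub> x) (\<rho> x)
      = tensor_lift R M (\<lambda>x c. f c \<odot>\<^bsub>M\<^esub> x) (\<rho> (tensor_lift R M (\<lambda>x c. g c \<odot>\<^bsub>M\<^esub> x) (\<rho> x)))" by simp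
  next
    fix x assume x: "x \<in> carrier M"
    have "tensor_lift R M (\<lambda>x c. \<one>\<^bsub>dual\<^esub> c \<odot>\<^bsub>M\<^esub> x) (\<rho> x) = tensor_lift R M (\<lambda>x c. \<epsilon> c \<odot>\<^bsub>M\<^esub> x) (\<rho> x)"
      by (rule MC.tensor_lift_cong[OF Mc.module rD(1)[OF x]]) (auto simp: dual_simps counit_closed)
    then show "tensor_lift R M (\<lambda>x c. \<one>\<^bsub>dual\<^esub> c \<odot>\<^bsub>M\<^esub> x) (\<rho> x) = x"
      using Mc.coaction_counit[OF x] by simp
    show "\<exists>y\<in>carrier M. y \<oplus>\<^bsub>M\<^esub> x = \<zero>\<^bsub>M\<^esub>" using x M.M.l_neg M.M.a_inv_closed by blast
  qed (auto simp: M.M.a_ac)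
qed

lemma comodule_hom_imp_dual_linear:
  assumes M: "right_comodule R C \<Delta> \<epsilon> M \<rho>" and N: "right_comodule R C \<Delta> \<epsilon> N \<sigma>"
    and g: "g \<in> comodule_hom R C M \<rho> N \<sigma>"
  shows "g \<in> lin_map dual (comodule_to_module R M \<rho>) (comodule_to_module R N \<sigma>)"
proof -
  interpret Mc: right_comodule R C \<Delta> \<epsilon> M \<rho> by fact
  interpret Nc: right_comodule R C \<Delta> \<epsilon> N \<sigma> by fact
  interpret M: left_module R M by (rule module_imp_left_module) (rule Mc.module)
  interpret MC: tensor_pair R M C by (intro tensor_pair.intro cring module Mc.module)
  interpret NC: tensor_pair R N C by (intro tensor_pair.intro cring module Nc.module)
  interpret N: left_module R N by (rule module_imp_left_module) (rule Nc.module)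
  have gl: "g \<in> lin_map R M N" and gc: "\<And>m. m \<in> carrier M \<Longrightarrow> \<sigma> (g m) = tensor_map R N C g id (\<rho> m)"
    using g by (auto simp: comodule_hom_def)
  note gD = lin_mapD[OF gl]
  show ?thesis
  proof (intro lin_mapI; (unfold comodule_to_module_simps)?)
    fix f m assume f: "f \<in> carrier dual" and m: "m \<in> carrier M"
    note fD = dual_carrierD[OF f]
    have r: "\<rho> m \<in> carrier (tensor R M C)" using lin_mapD(1)[OF Mc.coaction m] .
    have "g (tensor_lift R M (\<lambda>x c. f c \<odot>\<^bsub>M\<^esub> x) (\<rho> m)) = tensor_lift R N (\<lambda>x c. g (f c \<odot>\<^bsub>M\<^esub> x)) (\<rho> m)"
      using fD by (intro MC.lin_map_tensor_lift[OF Mc.module r _ Nc.module gl]) auto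
    also have "\<dots> = tensor_lift R N (\<lambda>x c. f c \<odot>\<^bsub>N\<^esub> g x) (\<rho> m)"
      using fD gD by (intro MC.tensor_lift_cong[OF Nc.module r]) auto
    also have "\<dots> = tensor_lift R N (\<lambda>x c. f c \<odot>\<^bsub>N\<^esub> x) (tensor_map R N C g id (\<rho> m))"
      using gD by (subst tensor_lift_tensor_map[OF MC.tensor_pair_axioms NC.tensor_pair_axioms Nc.module r coaction_bilinear[OF Nc.module fD(1)]]) auto
    finally show "g (tensor_lift R M (\<lambda>x c. f c \<odot>\<^bsub>M\<^esub> x) (\<rho> m)) = tensor_lift R N (\<lambda>x c. f c \<odot>\<^bsub>N\<^esub> x) (\<sigma> (g m))"
      using gc[OF m] by simp
  qed (auto intro: gD)
qed

text \<open>Scalars act through the multiples of the counit, so a map that is linear over the dual algebra is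
  linear over \<open>R\<close>.\<close>

lemma scalar_action:
  assumes M: "right_comodule R C \<Delta> \<epsilon> M \<rho>" and a: "a \<in> carrier R" and m: "m \<in> carrier M"
  shows "tensor_lift R M (\<lambda>x c. (\<lambda>c\<in>carrier C. a \<otimes>\<^bsub>R\<^esub> \<epsilon> c) c \<odot>\<^bsub>M\<^esub> x) (\<rho> m) = a \<odot>\<^bsub>M\<^esub> m"
proof -
  interpret Mc: right_comodule R C \<Delta> \<epsilon> M \<rho> by fact
  interpret M: left_module R M by (rule module_imp_left_module) (rule Mc.module)
  interpret MC: tensor_pair R M C by (intro tensor_pair.intro cring module Mc.module)
  note r = lin_mapD(1)[OF Mc.coaction m]
  have "tensor_lift R M (\<lambda>x c. (\<lambda>c\<in>carrier C. a \<otimes>\<^bsub>R\<^esub> \<epsilon> c) c \<odot>\<^bsub>M\<^esub> x) (\<rho> m)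
    = tensor_lift R M (\<lambda>x c. a \<odot>\<^bsub>M\<^esub> (\<epsilon> c \<odot>\<^bsub>M\<^esub> x)) (\<rho> m)"
    using a by (intro MC.tensor_lift_cong[OF Mc.module r]) (auto simp: M.smult_assoc1 counit_closed)
  also have "\<dots> = a \<odot>\<^bsub>M\<^esub> tensor_lift R M (\<lambda>x c. \<epsilon> c \<odot>\<^bsub>M\<^esub> x) (\<rho> m)"
    using a by (intro MC.tensor_lift_smult[OF Mc.module r]) (auto simp: counit_closed)
  finally show ?thesis using Mc.coaction_counit[OF m] by simp
qed

lemma coordinate_lin_map:
  assumes "s \<in> lin_map R C (free_module R S)"
  shows "(\<lambda>c. s c p) \<in> lin_map R C scalar"
  using lin_mapD[OF assms] by (intro lin_mapI) (force simp: free_module_def)+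

text \<open>To compare \<open>\<sigma> (h m)\<close> with the image of \<open>\<rho> m\<close> under \<open>h \<otimes> id\<close>, apply a functional \<open>f\<close> to the second
  factor: the results are \<open>f \<cdot> h m\<close> and \<open>h (f \<cdot> m)\<close>, which agree. Functionals separate the tensors
  because \<open>C\<close> is projective.\<close>

lemma dual_linear_imp_comodule_hom:
  assumes proj: "projective_module R C"
    and M: "right_comodule R C \<Delta> \<epsilon> M \<rho>" and N: "right_comodule R C \<Delta> \<epsilon> N \<sigma>"
    and h: "h \<in> lin_map dual (comodule_to_module R M \<rho>) (comodule_to_module R N \<sigma>)"
  shows "h \<in> comodule_hom R C M \<rho> N \<sigma>"
proof -
  interpret Mc: right_comodule R C \<Delta> \<epsilon> M \<rho> by fact
  interpret Nc: right_comodule R C \<Delta> \<epsilon> N \<sigma> by fact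
  interpret M: left_module R M by (rule module_imp_left_module) (rule Mc.module)
  interpret MC: tensor_pair R M C by (intro tensor_pair.intro cring module Mc.module)
  interpret NC: tensor_pair R N C by (intro tensor_pair.intro cring module Nc.module)
  interpret N: left_module R N by (rule module_imp_left_module) (rule Nc.module)
  note hD = lin_mapD[OF h, unfolded comodule_to_module_simps]
  have r: "\<rho> m \<in> carrier (tensor R M C)" if "m \<in> carrier M" for m using lin_mapD(1)[OF Mc.coaction that] .
  have s: "\<sigma> m \<in> carrier (tensor R N C)" if "m \<in> carrier N" for m using lin_mapD(1)[OF Nc.coaction that] .
  have hl: "h \<in> lin_map R M N"
  proof (intro lin_mapI hD(1,2))
    fix a m assume a: "a \<in> carrier R" and m: "m \<in> carrier M"
    have "(\<lambda>c\<in>carrier C. a \<otimes>\<^bsub>R\<^esub> \<epsilon> c) \<in> carrier dual"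
      using a by (intro restrict_dual lin_map_mult cring counit)
    from hD(3)[OF this m] show "h (a \<odot>\<^bsub>M\<^esub> m) = a \<odot>\<^bsub>N\<^esub> h m"
      using scalar_action[OF M a m] scalar_action[OF N a hD(1)[OF m]] by simp
  qed
  obtain s where s': "s \<in> lin_map R C (free_module R (carrier C))"
    "\<And>x. x \<in> carrier C \<Longrightarrow> lin_ext R C (\<lambda>p. p) (s x) = x"
    by (rule projective_module_dual_basis[OF proj]) blast
  have "\<sigma> (h m) = tensor_map R N C h id (\<rho> m)" if m: "m \<in> carrier M" for m
  proof (rule NC.tensor_eqI[OF s'])
    show "\<sigma> (h m) \<in> carrier (tensor R N C)" by (intro s hD m)
    show "tensor_map R N C h id (\<rho> m) \<in> carrier (tensor R N C)"
      by (intro tensor_map_closed[OF MC.tensor_pair_axioms NC.tensor_pair_axioms] r m) (auto intro: hD)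
    fix p assume p: "p \<in> carrier C"
    have sl: "(\<lambda>c. s c p) \<in> lin_map R C scalar" by (rule coordinate_lin_map[OF s'(1)])
    let ?f = "\<lambda>c\<in>carrier C. s c p"
    have f: "?f \<in> carrier dual" by (rule restrict_dual[OF sl])
    note fD = lin_mapD(1)[OF sl, simplified]
    have res: "tensor_lift R N (\<lambda>x c. s c p \<odot>\<^bsub>N\<^esub> x) (\<sigma> (h m)) = tensor_lift R N (\<lambda>x c. ?f c \<odot>\<^bsub>N\<^esub> x) (\<sigma> (h m))"
      using fD by (intro NC.tensor_lift_cong[OF Nc.module s[OF hD(1)[OF m]]]) auto
    have "tensor_lift R N (\<lambda>x c. s c p \<odot>\<^bsub>N\<^esub> x) (\<sigma> (h m)) = h (tensor_lift R M (\<lambda>x c. ?f c \<odot>\<^bsub>M\<^esub> x) (\<rho> m))"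
      using hD(3)[OF f m] res by simp
    also have "\<dots> = tensor_lift R N (\<lambda>x c. h (?f c \<odot>\<^bsub>M\<^esub> x)) (\<rho> m)"
      using fD by (intro MC.lin_map_tensor_lift[OF Mc.module r[OF m] _ Nc.module hl]) auto
    also have "\<dots> = tensor_lift R N (\<lambda>x c. s c p \<odot>\<^bsub>N\<^esub> h x) (\<rho> m)"
      using fD lin_mapD[OF hl] by (intro MC.tensor_lift_cong[OF Nc.module r[OF m]]) auto
    also have "\<dots> = tensor_lift R N (\<lambda>x c. s c p \<odot>\<^bsub>N\<^esub> x) (tensor_map R N C h id (\<rho> m))"
      using hD(1) by (subst tensor_lift_tensor_map[OF MC.tensor_pair_axioms NC.tensor_pair_axioms Nc.module r[OF m] coaction_bilinear[OF Nc.module sl]]) auto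
    finally show "tensor_lift R N (\<lambda>x c. s c p \<odot>\<^bsub>N\<^esub> x) (\<sigma> (h m)) = \<dots>" .
  qed
  then show ?thesis using hl by (simp add: comodule_hom_def)
qed

lemma dual_projective_imp_projective_comodule:
  assumes proj: "projective_module R C" and P: "right_comodule R C \<Delta> \<epsilon> P \<pi>"
    and dproj: "projective_module dual (comodule_to_module R P \<pi>)"
  shows "projective_comodule TYPE('m) TYPE('n) R C \<Delta> \<epsilon> P \<pi>"
  unfolding projective_comodule_def
proof (intro conjI allI impI ballI P)
  fix M :: "('r, 'm) module" and \<rho> and N :: "('r, 'n) module" and \<sigma> g f
  assume M: "right_comodule R C \<Delta> \<epsilon> M \<rho>" and N: "right_comodule R C \<Delta> \<epsilon> N \<sigma>"
    and g: "g \<in> comodule_hom R C M \<rho> N \<sigma>" and f: "f \<in> comodule_hom R C P \<pi> N \<sigma>"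
    and surj: "g ` carrier M = carrier N"
  have l: "lifting_property dual (comodule_to_module R P \<pi>) (comodule_to_module R M \<rho>) (comodule_to_module R N \<sigma>)"
    by (intro projective_module_lift dproj comodule_left_module M N)
  have "\<exists>h\<in>lin_map dual (comodule_to_module R P \<pi>) (comodule_to_module R M \<rho>).
      \<forall>x\<in>carrier (comodule_to_module R P \<pi>). g (h x) = f x"
    using l[unfolded lifting_property_def, rule_format,
        OF comodule_hom_imp_dual_linear[OF M N g] comodule_hom_imp_dual_linear[OF P N f]] surj
    by (simp add: comodule_to_module_simps)
  then obtain h where h: "h \<in> lin_map dual (comodule_to_module R P \<pi>) (comodule_to_module R M \<rho>)"
    "\<forall>x\<in>carrier P. g (h x) = f x"
    by (elim bexE) (simp add: comodule_to_module_simps)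
  show "\<exists>h\<in>comodule_hom R C P \<pi> M \<rho>. \<forall>x\<in>carrier P. g (h x) = f x"
    using h(2) by (intro bexI[of _ h] dual_linear_imp_comodule_hom[OF proj P M h(1)])
qed

lemma dual_separates:
  assumes proj: "projective_module R C" and xy: "x \<in> carrier C" "y \<in> carrier C"
    and eq: "\<And>f. f \<in> carrier dual \<Longrightarrow> f x = f y"
  shows "x = y"
proof -
  obtain s where s: "s \<in> lin_map R C (free_module R (carrier C))"
    "\<And>x. x \<in> carrier C \<Longrightarrow> lin_ext R C (\<lambda>p. p) (s x) = x"
    by (rule projective_module_dual_basis[OF proj]) blast
  have "s x p = s y p" for p
  proof -
    from eq[OF restrict_dual[OF coordinate_lin_map[OF s(1)]]] show ?thesis using xy by simp
  qed
  then have "s x = s y" by blast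
  then show ?thesis using s(2) xy by metis
qed

end


section \<open>Integrals of Hopf algebras\<close>

context hopf_algebra
begin

interpretation R: cring R by (rule cring)
interpretation H: left_module R H by (rule module_imp_left_module) (rule module)
interpretation HH: tensor_pair R H H by (rule tensor_pair_self)

lemma lin_ident: "(\<lambda>x. x) \<in> lin_map R H H"
  by (intro lin_mapI) auto

lemma lin_mult_left: "\<lbrakk>g \<in> lin_map R H H; a \<in> carrier H\<rbrakk> \<Longrightarrow> (\<lambda>x. a \<otimes>\<^bsub>H\<^esub> g x) \<in> lin_map R H H"
  by (intro lin_mapI) (auto simp: lin_mapD r_distr smult_mult_right)

lemma lin_mult_right: "\<lbrakk>g \<in> lin_map R H H; a \<in> carrier H\<rbrakk> \<Longrightarrow> (\<lambda>x. g x \<otimes>\<^bsub>H\<^esub> a) \<in> lin_map R H H"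
  by (intro lin_mapI) (auto simp: lin_mapD l_distr smult_mult_left)

lemma lin_comp: "\<lbrakk>f \<in> lin_map R H P; g \<in> lin_map R H H\<rbrakk> \<Longrightarrow> (\<lambda>x. f (g x)) \<in> lin_map R H P"
  by (intro lin_mapI) (auto simp: lin_mapD)

lemmas lin_antipode = lin_comp[OF antipode]

lemma lin_scalar_mult:
  "\<lbrakk>f \<in> lin_map R H scalar; a \<in> carrier R\<rbrakk> \<Longrightarrow> (\<lambda>x. f x \<otimes>\<^bsub>R\<^esub> a) \<in> lin_map R H scalar"
  "\<lbrakk>f \<in> lin_map R H scalar; a \<in> carrier R\<rbrakk> \<Longrightarrow> (\<lambda>x. a \<otimes>\<^bsub>R\<^esub> f x) \<in> lin_map R H scalar"
  by (rule lin_map_mult[OF cring]; assumption)+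

lemma lin_sw: "\<lbrakk>c \<in> carrier H; \<And>x y. \<lbrakk>x \<in> carrier H; y \<in> carrier H\<rbrakk> \<Longrightarrow> (\<lambda>q. B q x y) \<in> lin_map R H scalar\<rbrakk>
    \<Longrightarrow> (\<lambda>q. sw (B q) c) \<in> lin_map R H scalar"
  by (rule sw_lin_map_param[OF _ module])

lemma lin_sw_arg: "\<lbrakk>B \<in> bilinear_map R H H scalar; g \<in> lin_map R H H\<rbrakk> \<Longrightarrow> (\<lambda>x. sw B (g x)) \<in> lin_map R H scalar"
  by (rule lin_comp[OF sw_lin_map])

(* These rules prove linearity of nested Sweedler sums in each of their variables. For a functional f
   the instance lin_comp[OF f] has to be added, because f (g x) with both f and g unknown is not a
   higher-order pattern. *)
lemmas lin_intros = lin_ident lin_mult_left lin_mult_right lin_antipode lin_scalar_mult lin_sw lin_sw_arg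
  bilinear_mapI trilinear_mapI

lemma antipode_closed [simp]: "x \<in> carrier H \<Longrightarrow> S x \<in> carrier H"
  using lin_mapD(1)[OF antipode] .

lemma counit_one: "\<epsilon> \<one>\<^bsub>H\<^esub> = \<one>\<^bsub>R\<^esub>"
  using counit_ring_hom by (simp add: ring_hom_def)

lemma comult_one: "\<Delta> \<one>\<^bsub>H\<^esub> = pure_tensor R H H \<one>\<^bsub>H\<^esub> \<one>\<^bsub>H\<^esub>"
  using comult_ring_hom by (simp add: ring_hom_def tensor_algebra_def)

lemma sw_one:
  assumes "B \<in> bilinear_map R H H scalar"
  shows "sw B \<one>\<^bsub>H\<^esub> = B \<one>\<^bsub>H\<^esub> \<one>\<^bsub>H\<^esub>"
  unfolding comult_one by (intro tensor_lift_pure cring module scalar_module assms) auto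

lemma sw_prod:
  assumes B: "B \<in> bilinear_map R H H scalar" and h: "h \<in> carrier H" and k: "k \<in> carrier H"
  shows "sw B (h \<otimes>\<^bsub>H\<^esub> k) = sw (\<lambda>x y. sw (\<lambda>u v. B (x \<otimes>\<^bsub>H\<^esub> u) (y \<otimes>\<^bsub>H\<^esub> v)) k) h"
proof -
  note L = tensor_lift_lin_map[OF cring module module scalar_module B]
  let ?p = "\<lambda>a b a' b'. pure_tensor R H H (a \<otimes>\<^bsub>H\<^esub> a') (b \<otimes>\<^bsub>H\<^esub> b')"
  have pc: "?p a b a' b' \<in> carrier (tensor R H H)"
    if "a \<in> carrier H" "b \<in> carrier H" "a' \<in> carrier H" "b' \<in> carrier H" for a b a' b'
    using that by (intro HH.pure_tensor_closed) auto
  note tm = HH.module_tensor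
  have "\<Delta> (h \<otimes>\<^bsub>H\<^esub> k) = tensor_lift R (tensor R H H) (\<lambda>a b. tensor_lift R (tensor R H H) (?p a b) (\<Delta> k)) (\<Delta> h)"
    using comult_ring_hom h k by (simp add: ring_hom_def tensor_algebra_def)
  then have "sw B (h \<otimes>\<^bsub>H\<^esub> k) = tensor_lift R scalar B
      (tensor_lift R (tensor R H H) (\<lambda>a b. tensor_lift R (tensor R H H) (?p a b) (\<Delta> k)) (\<Delta> h))" by simp
  also have "\<dots> = sw (\<lambda>a b. tensor_lift R scalar B (tensor_lift R (tensor R H H) (?p a b) (\<Delta> k))) h"
    by (rule HH.lin_map_tensor_lift[OF tm comult_closed[OF h] _ scalar_module L])
       (intro HH.tensor_lift_closed tm comult_closed k pc)
  also have "\<dots> = sw (\<lambda>x y. sw (\<lambda>u v. B (x \<otimes>\<^bsub>H\<^esub> u) (y \<otimes>\<^bsub>H\<^esub> v)) k) h"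
  proof (rule sw_cong[OF h])
    fix x y assume x: "x \<in> carrier H" and y: "y \<in> carrier H"
    have Bc: "B (x \<otimes>\<^bsub>H\<^esub> u) (y \<otimes>\<^bsub>H\<^esub> v) \<in> carrier R" if "u \<in> carrier H" "v \<in> carrier H" for u v
      using bilinear_mapD(3)[OF B] that x y by simp
    then show "sw (\<lambda>u v. B (x \<otimes>\<^bsub>H\<^esub> u) (y \<otimes>\<^bsub>H\<^esub> v)) k \<in> carrier R" by (intro sw_closed k)
    have "tensor_lift R scalar B (tensor_lift R (tensor R H H) (?p x y) (\<Delta> k))
        = sw (\<lambda>u v. tensor_lift R scalar B (?p x y u v)) k"
      by (rule HH.lin_map_tensor_lift[OF tm comult_closed[OF k] _ scalar_module L]) (intro pc x y)
    also have "\<dots> = sw (\<lambda>u v. B (x \<otimes>\<^bsub>H\<^esub> u) (y \<otimes>\<^bsub>H\<^esub> v)) k"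
      using x y by (intro sw_cong k Bc tensor_lift_pure cring module scalar_module B) auto
    finally show "tensor_lift R scalar B (tensor_lift R (tensor R H H) (?p x y) (\<Delta> k))
        = sw (\<lambda>u v. B (x \<otimes>\<^bsub>H\<^esub> u) (y \<otimes>\<^bsub>H\<^esub> v)) k" .
  qed
  finally show ?thesis .
qed

lemma sw_antipode:
  assumes L: "L \<in> lin_map R H scalar" and h: "h \<in> carrier H"
  shows "sw (\<lambda>x y. L (S x \<otimes>\<^bsub>H\<^esub> y)) h = \<epsilon> h \<otimes>\<^bsub>R\<^esub> L \<one>\<^bsub>H\<^esub>"
    and "sw (\<lambda>x y. L (x \<otimes>\<^bsub>H\<^esub> S y)) h = \<epsilon> h \<otimes>\<^bsub>R\<^esub> L \<one>\<^bsub>H\<^esub>"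
proof -
  have e: "L (\<epsilon> h \<odot>\<^bsub>H\<^esub> \<one>\<^bsub>H\<^esub>) = \<epsilon> h \<otimes>\<^bsub>R\<^esub> L \<one>\<^bsub>H\<^esub>"
    using lin_mapD(3)[OF L counit_closed[OF h] one_closed] by simp
  show "sw (\<lambda>x y. L (S x \<otimes>\<^bsub>H\<^esub> y)) h = \<epsilon> h \<otimes>\<^bsub>R\<^esub> L \<one>\<^bsub>H\<^esub>"
    using HH.lin_map_tensor_lift[OF module comult_closed[OF h] _ scalar_module L, of "\<lambda>x y. S x \<otimes>\<^bsub>H\<^esub> y"]
      antipode_left[OF h] e by simp
  show "sw (\<lambda>x y. L (x \<otimes>\<^bsub>H\<^esub> S y)) h = \<epsilon> h \<otimes>\<^bsub>R\<^esub> L \<one>\<^bsub>H\<^esub>"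
    using HH.lin_map_tensor_lift[OF module comult_closed[OF h] _ scalar_module L, of "\<lambda>x y. x \<otimes>\<^bsub>H\<^esub> S y"]
      antipode_right[OF h] e by simp
qed

text \<open>This is the identity \<open>\<Sum> S(h\<^sub>1)\<^sub>1 h\<^sub>2 \<otimes> S(h\<^sub>1)\<^sub>2 = 1 \<otimes> S(h)\<close> in \<open>H \<otimes> H\<close>. Multiply the second factor on the
  right by \<open>h\<^sub>3 S(h\<^sub>4)\<close>, which is the counit. As \<open>\<Delta>\<close> is multiplicative, the left side becomes
  \<open>\<Sum> \<Delta>(S(h\<^sub>1) h\<^sub>2) (1 \<otimes> S(h\<^sub>3))\<close>, and here \<open>S(h\<^sub>1) h\<^sub>2\<close> collapses.\<close>

lemma sw_comult_antipode:
  assumes B: "B \<in> bilinear_map R H H scalar" and h: "h \<in> carrier H"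
  shows "sw (\<lambda>x y. sw (\<lambda>u v. B (u \<otimes>\<^bsub>H\<^esub> y) v) (S x)) h = B \<one>\<^bsub>H\<^esub> (S h)"
proof -
  note Bl = lin_comp[OF bilinear_mapD(1)[OF B]] and Br = lin_comp[OF bilinear_mapD(2)[OF B]]
  note Bc = bilinear_mapD(3)[OF B, simplified]
  note li = lin_intros Bl Br
  \<comment> \<open>\<open>D w k\<close> is the value of \<open>B\<close> on \<open>\<Delta>(k) (1 \<otimes> S(w))\<close>.\<close>
  define D where "D w k = sw (\<lambda>p q. B p (q \<otimes>\<^bsub>H\<^esub> S w)) k" for w k
  have Dl: "D w \<in> lin_map R H scalar" if "w \<in> carrier H" for w
    unfolding D_def using that by (intro sw_lin_map bilinear_mapI li) auto
  have Dr: "(\<lambda>w. D w k) \<in> lin_map R H scalar" if "k \<in> carrier H" for k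
    unfolding D_def using that by (intro li) auto
  have Dc: "D w k \<in> carrier R" if "w \<in> carrier H" "k \<in> carrier H" for w k
    using lin_mapD(1)[OF Dl] that by simp
  have insert: "B (u \<otimes>\<^bsub>H\<^esub> y) v = sw (\<lambda>y' w. sw (\<lambda>y1 z. B (u \<otimes>\<^bsub>H\<^esub> y1) (v \<otimes>\<^bsub>H\<^esub> z \<otimes>\<^bsub>H\<^esub> S w)) y') y"
    if u: "u \<in> carrier H" and v: "v \<in> carrier H" and y: "y \<in> carrier H" for u v y
  proof -
    have "B (u \<otimes>\<^bsub>H\<^esub> y) v = sw (\<lambda>y1 y2. \<epsilon> y2 \<otimes>\<^bsub>R\<^esub> B (u \<otimes>\<^bsub>H\<^esub> y1) v) y"
      using u v y by (intro sw_counit(1)[symmetric] li) auto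
    also have "\<dots> = sw (\<lambda>y1 y2. sw (\<lambda>z w. B (u \<otimes>\<^bsub>H\<^esub> y1) (v \<otimes>\<^bsub>H\<^esub> z \<otimes>\<^bsub>H\<^esub> S w)) y2) y"
    proof (rule sw_cong[OF y])
      fix y1 y2 assume y12: "y1 \<in> carrier H" "y2 \<in> carrier H"
      then show "sw (\<lambda>z w. B (u \<otimes>\<^bsub>H\<^esub> y1) (v \<otimes>\<^bsub>H\<^esub> z \<otimes>\<^bsub>H\<^esub> S w)) y2 \<in> carrier R"
        using u v by (intro sw_closed Bc) auto
      have "sw (\<lambda>z w. B (u \<otimes>\<^bsub>H\<^esub> y1) (v \<otimes>\<^bsub>H\<^esub> z \<otimes>\<^bsub>H\<^esub> S w)) y2 = sw (\<lambda>z w. B (u \<otimes>\<^bsub>H\<^esub> y1) (v \<otimes>\<^bsub>H\<^esub> (z \<otimes>\<^bsub>H\<^esub> S w))) y2"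
        using u v y12 by (intro sw_cong) (auto simp: m_assoc intro!: Bc)
      also have "\<dots> = \<epsilon> y2 \<otimes>\<^bsub>R\<^esub> B (u \<otimes>\<^bsub>H\<^esub> y1) (v \<otimes>\<^bsub>H\<^esub> \<one>\<^bsub>H\<^esub>)"
        using u v y12 by (intro sw_antipode(2) li) auto
      finally show "\<epsilon> y2 \<otimes>\<^bsub>R\<^esub> B (u \<otimes>\<^bsub>H\<^esub> y1) v = sw (\<lambda>z w. B (u \<otimes>\<^bsub>H\<^esub> y1) (v \<otimes>\<^bsub>H\<^esub> z \<otimes>\<^bsub>H\<^esub> S w)) y2"
        using v by simp
    qed
    also have "\<dots> = sw (\<lambda>y' w. sw (\<lambda>y1 z. B (u \<otimes>\<^bsub>H\<^esub> y1) (v \<otimes>\<^bsub>H\<^esub> z \<otimes>\<^bsub>H\<^esub> S w)) y') y"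
      using u v y by (intro sw_coassoc[symmetric] li) auto
    finally show ?thesis .
  qed
  have "sw (\<lambda>x y. sw (\<lambda>u v. B (u \<otimes>\<^bsub>H\<^esub> y) v) (S x)) h = sw (\<lambda>x y. sw (\<lambda>y' w. D w (S x \<otimes>\<^bsub>H\<^esub> y')) y) h"
  proof (rule sw_cong[OF h])
    fix x y assume x: "x \<in> carrier H" and y: "y \<in> carrier H"
    show "sw (\<lambda>y' w. D w (S x \<otimes>\<^bsub>H\<^esub> y')) y \<in> carrier R" using x y by (intro sw_closed Dc) auto
    have "sw (\<lambda>u v. B (u \<otimes>\<^bsub>H\<^esub> y) v) (S x)
        = sw (\<lambda>u v. sw (\<lambda>y' w. sw (\<lambda>y1 z. B (u \<otimes>\<^bsub>H\<^esub> y1) (v \<otimes>\<^bsub>H\<^esub> z \<otimes>\<^bsub>H\<^esub> S w)) y') y) (S x)"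
      using x y by (intro sw_cong insert) (auto intro!: sw_closed Bc)
    also have "\<dots> = sw (\<lambda>y' w. sw (\<lambda>u v. sw (\<lambda>y1 z. B (u \<otimes>\<^bsub>H\<^esub> y1) (v \<otimes>\<^bsub>H\<^esub> z \<otimes>\<^bsub>H\<^esub> S w)) y') (S x)) y"
      using x y by (intro sw_swap sw_closed Bc) auto
    also have "\<dots> = sw (\<lambda>y' w. D w (S x \<otimes>\<^bsub>H\<^esub> y')) y"
    proof (rule sw_cong[OF y])
      fix y' w assume y': "y' \<in> carrier H" and w: "w \<in> carrier H"
      then show "D w (S x \<otimes>\<^bsub>H\<^esub> y') \<in> carrier R" using x by (intro Dc) auto
      show "sw (\<lambda>u v. sw (\<lambda>y1 z. B (u \<otimes>\<^bsub>H\<^esub> y1) (v \<otimes>\<^bsub>H\<^esub> z \<otimes>\<^bsub>H\<^esub> S w)) y') (S x) = D w (S x \<otimes>\<^bsub>H\<^esub> y')"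
        unfolding D_def using x y' w by (intro sw_prod[symmetric] li) auto
    qed
    finally show "sw (\<lambda>u v. B (u \<otimes>\<^bsub>H\<^esub> y) v) (S x) = sw (\<lambda>y' w. D w (S x \<otimes>\<^bsub>H\<^esub> y')) y" .
  qed
  also have "\<dots> = sw (\<lambda>h' w. sw (\<lambda>x y'. D w (S x \<otimes>\<^bsub>H\<^esub> y')) h') h"
  proof (intro sw_coassoc[symmetric] h trilinear_mapI)
    fix x y assume x: "x \<in> carrier H" and y: "y \<in> carrier H"
    show "(\<lambda>m. D y (S m \<otimes>\<^bsub>H\<^esub> x)) \<in> lin_map R H scalar"
      using x y by (intro lin_comp[OF Dl] li)
    show "(\<lambda>n. D y (S x \<otimes>\<^bsub>H\<^esub> n)) \<in> lin_map R H scalar"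
      using x y by (intro lin_comp[OF Dl] li) auto
    show "(\<lambda>l. D l (S x \<otimes>\<^bsub>H\<^esub> y)) \<in> lin_map R H scalar"
      using x y by (intro Dr) auto
  qed
  also have "\<dots> = sw (\<lambda>h' w. \<epsilon> h' \<otimes>\<^bsub>R\<^esub> D w \<one>\<^bsub>H\<^esub>) h"
    by (intro sw_cong h sw_antipode(1) Dl) (auto intro!: Dc counit_closed)
  also have "\<dots> = D h \<one>\<^bsub>H\<^esub>" by (intro sw_counit(2) Dr h) auto
  also have "\<dots> = B \<one>\<^bsub>H\<^esub> (\<one>\<^bsub>H\<^esub> \<otimes>\<^bsub>H\<^esub> S h)"
    unfolding D_def using h by (intro sw_one li) auto
  finally show ?thesis using h by simp
qed

text \<open>The law of a left integral, tested against all functionals: \<open>f * \<phi> = f(1) \<phi>\<close> in the convolution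
  algebra. If \<open>H\<close> is projective, functionals separate its elements and this is equivalent to
  \<^const>\<open>left_integral\<close>.\<close>

definition integral_form :: "('h \<Rightarrow> 'r) \<Rightarrow> bool" where
  "integral_form \<phi> \<longleftrightarrow> \<phi> \<in> lin_map R H scalar \<and>
    (\<forall>f\<in>lin_map R H scalar. \<forall>h\<in>carrier H. sw (\<lambda>x y. f x \<otimes>\<^bsub>R\<^esub> \<phi> y) h = f \<one>\<^bsub>H\<^esub> \<otimes>\<^bsub>R\<^esub> \<phi> h)"

text \<open>For an integral \<open>\<phi>\<close>, sending \<open>b\<close> to the functional \<open>y \<mapsto> \<phi>(y S(b))\<close> is linear over the dual algebra:
  the equation compares \<open>f\<close> times this functional with the functional of \<open>f \<cdot> b\<close>. On the right side
  replace \<open>f(c) \<phi>(w)\<close> by \<open>\<Sum> f(w\<^sub>1 c) \<phi>(w\<^sub>2)\<close> for \<open>w = y S(b')\<close>, which holds as \<open>\<phi>\<close> is an integral, and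
  then apply \<open>sw_comult_antipode\<close>.\<close>

lemma sw_integral_antipode:
  assumes \<phi>: "integral_form \<phi>" and f: "f \<in> lin_map R H scalar" and y: "y \<in> carrier H" and b: "b \<in> carrier H"
  shows "sw (\<lambda>u v. f u \<otimes>\<^bsub>R\<^esub> \<phi> (v \<otimes>\<^bsub>H\<^esub> S b)) y = sw (\<lambda>b' c. f c \<otimes>\<^bsub>R\<^esub> \<phi> (y \<otimes>\<^bsub>H\<^esub> S b')) b"
proof -
  have \<phi>l: "\<phi> \<in> lin_map R H scalar" using \<phi> by (simp add: integral_form_def)
  have int: "sw (\<lambda>x y. g x \<otimes>\<^bsub>R\<^esub> \<phi> y) h = g \<one>\<^bsub>H\<^esub> \<otimes>\<^bsub>R\<^esub> \<phi> h" if "g \<in> lin_map R H scalar" "h \<in> carrier H" for g h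
    using \<phi> that by (simp add: integral_form_def)
  note fc = lin_mapD(1)[OF f, simplified] and \<phi>c = lin_mapD(1)[OF \<phi>l, simplified]
  note li = lin_intros lin_comp[OF f] lin_comp[OF \<phi>l]
  have "sw (\<lambda>b' c. f c \<otimes>\<^bsub>R\<^esub> \<phi> (y \<otimes>\<^bsub>H\<^esub> S b')) b
      = sw (\<lambda>b' c. sw (\<lambda>u v. sw (\<lambda>p q. f (u \<otimes>\<^bsub>H\<^esub> (p \<otimes>\<^bsub>H\<^esub> c)) \<otimes>\<^bsub>R\<^esub> \<phi> (v \<otimes>\<^bsub>H\<^esub> q)) (S b')) y) b"
  proof (rule sw_cong[OF b])
    fix b' c assume b': "b' \<in> carrier H" and c: "c \<in> carrier H"
    show "sw (\<lambda>u v. sw (\<lambda>p q. f (u \<otimes>\<^bsub>H\<^esub> (p \<otimes>\<^bsub>H\<^esub> c)) \<otimes>\<^bsub>R\<^esub> \<phi> (v \<otimes>\<^bsub>H\<^esub> q)) (S b')) y \<in> carrier R"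
      using y b' c by (intro sw_closed R.m_closed fc \<phi>c) auto
    have "f c \<otimes>\<^bsub>R\<^esub> \<phi> (y \<otimes>\<^bsub>H\<^esub> S b') = f (\<one>\<^bsub>H\<^esub> \<otimes>\<^bsub>H\<^esub> c) \<otimes>\<^bsub>R\<^esub> \<phi> (y \<otimes>\<^bsub>H\<^esub> S b')" using c by simp
    also have "\<dots> = sw (\<lambda>p q. f (p \<otimes>\<^bsub>H\<^esub> c) \<otimes>\<^bsub>R\<^esub> \<phi> q) (y \<otimes>\<^bsub>H\<^esub> S b')"
      using y b' c by (intro int[symmetric] li) auto
    also have "\<dots> = sw (\<lambda>u v. sw (\<lambda>p q. f (u \<otimes>\<^bsub>H\<^esub> p \<otimes>\<^bsub>H\<^esub> c) \<otimes>\<^bsub>R\<^esub> \<phi> (v \<otimes>\<^bsub>H\<^esub> q)) (S b')) y"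
      using y b' c fc \<phi>c by (intro sw_prod li) auto
    also have "\<dots> = sw (\<lambda>u v. sw (\<lambda>p q. f (u \<otimes>\<^bsub>H\<^esub> (p \<otimes>\<^bsub>H\<^esub> c)) \<otimes>\<^bsub>R\<^esub> \<phi> (v \<otimes>\<^bsub>H\<^esub> q)) (S b')) y"
      using y b' c by (intro sw_cong sw_closed R.m_closed fc \<phi>c) (auto simp: m_assoc)
    finally show "f c \<otimes>\<^bsub>R\<^esub> \<phi> (y \<otimes>\<^bsub>H\<^esub> S b') = \<dots>" .
  qed
  also have "\<dots> = sw (\<lambda>u v. sw (\<lambda>b' c. sw (\<lambda>p q. f (u \<otimes>\<^bsub>H\<^esub> (p \<otimes>\<^bsub>H\<^esub> c)) \<otimes>\<^bsub>R\<^esub> \<phi> (v \<otimes>\<^bsub>H\<^esub> q)) (S b')) b) y"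
    using y b by (intro sw_swap sw_closed R.m_closed fc \<phi>c) auto
  also have "\<dots> = sw (\<lambda>u v. f u \<otimes>\<^bsub>R\<^esub> \<phi> (v \<otimes>\<^bsub>H\<^esub> S b)) y"
  proof (rule sw_cong[OF y])
    fix u v assume u: "u \<in> carrier H" and v: "v \<in> carrier H"
    show "f u \<otimes>\<^bsub>R\<^esub> \<phi> (v \<otimes>\<^bsub>H\<^esub> S b) \<in> carrier R" using u v b by (intro R.m_closed fc \<phi>c) auto
    have "(\<lambda>p q. f (u \<otimes>\<^bsub>H\<^esub> p) \<otimes>\<^bsub>R\<^esub> \<phi> (v \<otimes>\<^bsub>H\<^esub> q)) \<in> bilinear_map R H H scalar"
      using u v fc \<phi>c by (intro li) auto
    from sw_comult_antipode[OF this b] u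
    show "sw (\<lambda>b' c. sw (\<lambda>p q. f (u \<otimes>\<^bsub>H\<^esub> (p \<otimes>\<^bsub>H\<^esub> c)) \<otimes>\<^bsub>R\<^esub> \<phi> (v \<otimes>\<^bsub>H\<^esub> q)) (S b')) b = f u \<otimes>\<^bsub>R\<^esub> \<phi> (v \<otimes>\<^bsub>H\<^esub> S b)"
      by simp
  qed
  finally show ?thesis by simp
qed


section \<open>Integrals and projectivity\<close>

abbreviation "H_dual \<equiv> comodule_to_module R H \<Delta>"

text \<open>The action of \<open>f\<close> on \<open>H\<close>, for a linear map \<open>f\<close> that may take any values outside the carrier.\<close>

abbreviation act :: "('h \<Rightarrow> 'r) \<Rightarrow> 'h \<Rightarrow> 'h" where
  "act f h \<equiv> tensor_lift R H (\<lambda>x y. f y \<odot>\<^bsub>H\<^esub> x) (\<Delta> h)"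

lemma act_closed:
  assumes "f \<in> lin_map R H scalar" "h \<in> carrier H"
  shows "act f h \<in> carrier H"
  using lin_mapD(1)[OF assms(1)] by (intro HH.tensor_lift_closed module comult_closed assms) auto

lemma lin_act:
  assumes f: "f \<in> lin_map R H scalar" and L: "L \<in> lin_map R H scalar" and h: "h \<in> carrier H"
  shows "L (act f h) = sw (\<lambda>x y. f y \<otimes>\<^bsub>R\<^esub> L x) h"
proof -
  note fc = lin_mapD(1)[OF f, simplified]
  have "L (act f h) = sw (\<lambda>x y. L (f y \<odot>\<^bsub>H\<^esub> x)) h"
    using fc by (intro HH.lin_map_tensor_lift[OF module comult_closed[OF h] _ scalar_module L]) auto
  also have "\<dots> = sw (\<lambda>x y. f y \<otimes>\<^bsub>R\<^esub> L x) h"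
    using fc lin_mapD[OF L] by (intro sw_cong h) auto
  finally show ?thesis .
qed

lemma act_one:
  assumes f: "f \<in> lin_map R H scalar"
  shows "act f \<one>\<^bsub>H\<^esub> = f \<one>\<^bsub>H\<^esub> \<odot>\<^bsub>H\<^esub> \<one>\<^bsub>H\<^esub>"
  unfolding comult_one by (intro tensor_lift_pure cring module coaction_bilinear f) auto

lemma left_integral_imp_integral_form:
  assumes "left_integral R H \<Delta> \<phi>" shows "integral_form \<phi>"
proof -
  have \<phi>: "\<phi> \<in> lin_map R H scalar" and i: "\<And>h. h \<in> carrier H \<Longrightarrow> act \<phi> h = \<phi> h \<odot>\<^bsub>H\<^esub> \<one>\<^bsub>H\<^esub>"
    using assms by (auto simp: left_integral_def)
  note \<phi>c = lin_mapD(1)[OF \<phi>, simplified]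
  have "sw (\<lambda>x y. f x \<otimes>\<^bsub>R\<^esub> \<phi> y) h = f \<one>\<^bsub>H\<^esub> \<otimes>\<^bsub>R\<^esub> \<phi> h" if f: "f \<in> lin_map R H scalar" and h: "h \<in> carrier H" for f h
  proof -
    note fc = lin_mapD(1)[OF f, simplified]
    have "sw (\<lambda>x y. f x \<otimes>\<^bsub>R\<^esub> \<phi> y) h = sw (\<lambda>x y. \<phi> y \<otimes>\<^bsub>R\<^esub> f x) h"
      using fc \<phi>c by (intro sw_cong h) (auto simp: R.m_comm)
    also have "\<dots> = f (\<phi> h \<odot>\<^bsub>H\<^esub> \<one>\<^bsub>H\<^esub>)" using lin_act[OF \<phi> f h] i[OF h] by simp
    also have "\<dots> = f \<one>\<^bsub>H\<^esub> \<otimes>\<^bsub>R\<^esub> \<phi> h"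
      using lin_mapD(3)[OF f \<phi>c[OF h] one_closed] fc[OF one_closed] \<phi>c[OF h] by (simp add: R.m_comm)
    finally show ?thesis .
  qed
  then show ?thesis using \<phi> by (simp add: integral_form_def)
qed

lemma integral_form_imp_left_integral:
  assumes proj: "projective_module R H" and "integral_form \<phi>" shows "left_integral R H \<Delta> \<phi>"
proof -
  have \<phi>: "\<phi> \<in> lin_map R H scalar"
    and i: "\<And>f h. \<lbrakk>f \<in> lin_map R H scalar; h \<in> carrier H\<rbrakk> \<Longrightarrow> sw (\<lambda>x y. f x \<otimes>\<^bsub>R\<^esub> \<phi> y) h = f \<one>\<^bsub>H\<^esub> \<otimes>\<^bsub>R\<^esub> \<phi> h"
    using assms by (auto simp: integral_form_def)
  note \<phi>c = lin_mapD(1)[OF \<phi>, simplified]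
  have "act \<phi> h = \<phi> h \<odot>\<^bsub>H\<^esub> \<one>\<^bsub>H\<^esub>" if h: "h \<in> carrier H" for h
  proof (rule dual_separates[OF proj])
    show "act \<phi> h \<in> carrier H" by (rule act_closed[OF \<phi> h])
    show "\<phi> h \<odot>\<^bsub>H\<^esub> \<one>\<^bsub>H\<^esub> \<in> carrier H" using \<phi>c[OF h] by simp
    fix f assume "f \<in> carrier dual"
    then have f: "f \<in> lin_map R H scalar" by (rule dual_carrierD)
    note fc = lin_mapD(1)[OF f, simplified]
    have "f (act \<phi> h) = sw (\<lambda>x y. f x \<otimes>\<^bsub>R\<^esub> \<phi> y) h"
      unfolding lin_act[OF \<phi> f h] using fc \<phi>c by (intro sw_cong h) (auto simp: R.m_comm)
    also have "\<dots> = f (\<phi> h \<odot>\<^bsub>H\<^esub> \<one>\<^bsub>H\<^esub>)"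
      using i[OF f h] lin_mapD(3)[OF f \<phi>c[OF h] one_closed] fc[OF one_closed] \<phi>c[OF h] by (simp add: R.m_comm)
    finally show "f (act \<phi> h) = f (\<phi> h \<odot>\<^bsub>H\<^esub> \<one>\<^bsub>H\<^esub>)" .
  qed
  then show ?thesis using \<phi> by (simp add: left_integral_def)
qed

lemma dual_module: "left_module dual H_dual"
  by (rule comodule_left_module[OF right_comodule_axioms])

text \<open>Multiplication by \<open>\<phi> e\<close> on \<open>H\<close> factors through a free module over the dual algebra. Let \<open>p\<^sup>*\<close> be
  the coordinates of a dual basis of \<open>H\<close> over \<open>R\<close>, and send \<open>x\<close> to the functionals
  \<open>t\<^sub>p(x) = (y \<mapsto> \<Sum> p\<^sup>*(e x\<^sub>1) \<phi>(y S(x\<^sub>2)))\<close>. They depend linearly on \<open>x\<close> over the dual algebra, by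
  \<open>sw_integral_antipode\<close> and coassociativity. The dual basis property collapses
  \<open>\<Sum>\<^sub>p t\<^sub>p(x)(p)\<close> to \<open>\<Sum> \<phi>(e x\<^sub>1 S(x\<^sub>2)) = \<epsilon>(x) \<phi>(e)\<close>, whence \<open>\<Sum>\<^sub>p t\<^sub>p(x) \<cdot> p = \<phi>(e) x\<close>.\<close>

lemma integral_factorization:
  assumes proj: "projective_module R H" and \<phi>: "integral_form \<phi>" and e: "e \<in> carrier H"
  obtains \<sigma> where "\<sigma> \<in> lin_map dual H_dual (free_module dual (carrier H))"
    "\<And>x. x \<in> carrier H \<Longrightarrow> lin_ext dual H_dual (\<lambda>p. p) (\<sigma> x) = \<phi> e \<odot>\<^bsub>H\<^esub> x"
proof -
  interpret D: ring dual by (rule dual_ring)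
  interpret DM: left_module dual H_dual by (rule dual_module)
  interpret F: left_module dual "free_module dual (carrier H)" by (rule free_module_left_module) (rule dual_ring)
  interpret sc: left_module R scalar by (rule module_imp_left_module) (rule scalar_module)
  obtain s where s: "s \<in> lin_map R H (free_module R (carrier H))"
    "\<And>x. x \<in> carrier H \<Longrightarrow> lin_ext R H (\<lambda>p. p) (s x) = x"
    by (rule projective_module_dual_basis[OF proj]) blast
  have sl: "(\<lambda>c. s c p) \<in> lin_map R H scalar" for p by (rule coordinate_lin_map[OF s(1)])
  have \<phi>l: "\<phi> \<in> lin_map R H scalar" using \<phi> by (simp add: integral_form_def)
  note \<phi>c = lin_mapD(1)[OF \<phi>l, simplified] and spc = lin_mapD(1)[OF sl, simplified]
  note li = lin_intros lin_comp[OF sl] lin_comp[OF \<phi>l]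
  define t where "t p x y = sw (\<lambda>a b. s (e \<otimes>\<^bsub>H\<^esub> a) p \<otimes>\<^bsub>R\<^esub> \<phi> (y \<otimes>\<^bsub>H\<^esub> S b)) x" for p x y
  have tx: "(\<lambda>x. t p x y) \<in> lin_map R H scalar" if "y \<in> carrier H" for p y
    unfolding t_def using that e by (intro sw_lin_map li spc \<phi>c) auto
  have ty: "t p x \<in> lin_map R H scalar" if "x \<in> carrier H" for p x
    unfolding t_def using that e by (intro li spc) auto
  have tc: "t p x y \<in> carrier R" if "x \<in> carrier H" "y \<in> carrier H" for p x y
    using lin_mapD(1)[OF ty] that by simp
  have tact: "t p (act f x) y = sw (\<lambda>u v. f u \<otimes>\<^bsub>R\<^esub> t p x v) y"
    if f: "f \<in> lin_map R H scalar" and x: "x \<in> carrier H" and y: "y \<in> carrier H" for p f x y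
  proof -
    note fc = lin_mapD(1)[OF f, simplified]
    note li = li lin_comp[OF f] f
    let ?p = "\<lambda>a. s (e \<otimes>\<^bsub>H\<^esub> a) p"
    have pc: "?p a \<in> carrier R" if "a \<in> carrier H" for a using spc e that by simp
    have "t p (act f x) y = sw (\<lambda>a c. f c \<otimes>\<^bsub>R\<^esub> t p a y) x" by (rule lin_act[OF f tx[OF y] x])
    also have "\<dots> = sw (\<lambda>a c. sw (\<lambda>a' b. ?p a' \<otimes>\<^bsub>R\<^esub> (f c \<otimes>\<^bsub>R\<^esub> \<phi> (y \<otimes>\<^bsub>H\<^esub> S b))) a) x"
    proof (rule sw_cong[OF x])
      fix a c assume a: "a \<in> carrier H" and c: "c \<in> carrier H"
      show "sw (\<lambda>a' b. ?p a' \<otimes>\<^bsub>R\<^esub> (f c \<otimes>\<^bsub>R\<^esub> \<phi> (y \<otimes>\<^bsub>H\<^esub> S b))) a \<in> carrier R"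
        using a c y by (intro sw_closed R.m_closed pc fc \<phi>c) auto
      have "f c \<otimes>\<^bsub>R\<^esub> t p a y = sw (\<lambda>a' b. f c \<otimes>\<^bsub>R\<^esub> (?p a' \<otimes>\<^bsub>R\<^esub> \<phi> (y \<otimes>\<^bsub>H\<^esub> S b))) a"
        unfolding t_def using a c y by (intro sw_scalar_mult(1)[symmetric] R.m_closed pc fc \<phi>c) auto
      also have "\<dots> = sw (\<lambda>a' b. ?p a' \<otimes>\<^bsub>R\<^esub> (f c \<otimes>\<^bsub>R\<^esub> \<phi> (y \<otimes>\<^bsub>H\<^esub> S b))) a"
        using a c y by (intro sw_cong R.m_lcomm R.m_closed pc fc \<phi>c) auto
      finally show "f c \<otimes>\<^bsub>R\<^esub> t p a y = \<dots>" .
    qed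
    also have "\<dots> = sw (\<lambda>a w. sw (\<lambda>b c. ?p a \<otimes>\<^bsub>R\<^esub> (f c \<otimes>\<^bsub>R\<^esub> \<phi> (y \<otimes>\<^bsub>H\<^esub> S b))) w) x"
      using x y e by (intro sw_coassoc li R.m_closed pc fc \<phi>c) auto
    also have "\<dots> = sw (\<lambda>a w. sw (\<lambda>u v. ?p a \<otimes>\<^bsub>R\<^esub> (f u \<otimes>\<^bsub>R\<^esub> \<phi> (v \<otimes>\<^bsub>H\<^esub> S w))) y) x"
    proof (rule sw_cong[OF x])
      fix a w assume a: "a \<in> carrier H" and w: "w \<in> carrier H"
      show "sw (\<lambda>u v. ?p a \<otimes>\<^bsub>R\<^esub> (f u \<otimes>\<^bsub>R\<^esub> \<phi> (v \<otimes>\<^bsub>H\<^esub> S w))) y \<in> carrier R"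
        using a w y by (intro sw_closed R.m_closed pc fc \<phi>c) auto
      have "sw (\<lambda>b c. ?p a \<otimes>\<^bsub>R\<^esub> (f c \<otimes>\<^bsub>R\<^esub> \<phi> (y \<otimes>\<^bsub>H\<^esub> S b))) w = ?p a \<otimes>\<^bsub>R\<^esub> sw (\<lambda>b c. f c \<otimes>\<^bsub>R\<^esub> \<phi> (y \<otimes>\<^bsub>H\<^esub> S b)) w"
        using a w y by (intro sw_scalar_mult(1) R.m_closed pc fc \<phi>c) auto
      also have "\<dots> = ?p a \<otimes>\<^bsub>R\<^esub> sw (\<lambda>u v. f u \<otimes>\<^bsub>R\<^esub> \<phi> (v \<otimes>\<^bsub>H\<^esub> S w)) y"
        by (simp only: sw_integral_antipode[OF \<phi> f y w])
      also have "\<dots> = sw (\<lambda>u v. ?p a \<otimes>\<^bsub>R\<^esub> (f u \<otimes>\<^bsub>R\<^esub> \<phi> (v \<otimes>\<^bsub>H\<^esub> S w))) y"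
        using a w y by (intro sw_scalar_mult(1)[symmetric] R.m_closed pc fc \<phi>c) auto
      finally show "sw (\<lambda>b c. ?p a \<otimes>\<^bsub>R\<^esub> (f c \<otimes>\<^bsub>R\<^esub> \<phi> (y \<otimes>\<^bsub>H\<^esub> S b))) w = \<dots>" .
    qed
    also have "\<dots> = sw (\<lambda>u v. sw (\<lambda>a w. ?p a \<otimes>\<^bsub>R\<^esub> (f u \<otimes>\<^bsub>R\<^esub> \<phi> (v \<otimes>\<^bsub>H\<^esub> S w))) x) y"
      using x y by (intro sw_swap R.m_closed pc fc \<phi>c) auto
    also have "\<dots> = sw (\<lambda>u v. f u \<otimes>\<^bsub>R\<^esub> t p x v) y"
    proof (rule sw_cong[OF y])
      fix u v assume u: "u \<in> carrier H" and v: "v \<in> carrier H"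
      show "f u \<otimes>\<^bsub>R\<^esub> t p x v \<in> carrier R" using u v x by (intro R.m_closed fc tc)
      have "sw (\<lambda>a w. ?p a \<otimes>\<^bsub>R\<^esub> (f u \<otimes>\<^bsub>R\<^esub> \<phi> (v \<otimes>\<^bsub>H\<^esub> S w))) x = sw (\<lambda>a w. f u \<otimes>\<^bsub>R\<^esub> (?p a \<otimes>\<^bsub>R\<^esub> \<phi> (v \<otimes>\<^bsub>H\<^esub> S w))) x"
        using u v x by (intro sw_cong R.m_lcomm R.m_closed pc fc \<phi>c) auto
      also have "\<dots> = f u \<otimes>\<^bsub>R\<^esub> t p x v"
        unfolding t_def using u v x by (intro sw_scalar_mult(1) R.m_closed pc fc \<phi>c) auto
      finally show "sw (\<lambda>a w. ?p a \<otimes>\<^bsub>R\<^esub> (f u \<otimes>\<^bsub>R\<^esub> \<phi> (v \<otimes>\<^bsub>H\<^esub> S w))) x = f u \<otimes>\<^bsub>R\<^esub> t p x v" .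
    qed
    finally show ?thesis .
  qed
  \<comment> \<open>Only finitely many \<open>a\<close> occur in a representative of \<open>\<Delta> x\<close>, and each \<open>ea\<close> has finitely many non-zero
    coordinates, so \<open>t p x\<close> vanishes for all but finitely many \<open>p\<close>.\<close>
  define supp where "supp x = (\<Union>q\<in>{q. (SOME u. u \<in> \<Delta> x) q \<noteq> \<zero>\<^bsub>R\<^esub>}. {p. s (e \<otimes>\<^bsub>H\<^esub> fst q) p \<noteq> \<zero>\<^bsub>R\<^esub>})" for x
  have sF: "s c \<in> carrier (free_module R (carrier H))" if "c \<in> carrier H" for c
    using lin_mapD(1)[OF s(1) that] .
  have supp: "finite (supp x)" "supp x \<subseteq> carrier H" if x: "x \<in> carrier H" for x
  proof -
    note r = HH.rep_support[OF comult_closed[OF x]]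
    have "finite {p. s (e \<otimes>\<^bsub>H\<^esub> fst q) p \<noteq> \<zero>\<^bsub>R\<^esub>}" "{p. s (e \<otimes>\<^bsub>H\<^esub> fst q) p \<noteq> \<zero>\<^bsub>R\<^esub>} \<subseteq> carrier H"
      if "q \<in> {q. (SOME u. u \<in> \<Delta> x) q \<noteq> \<zero>\<^bsub>R\<^esub>}" for q
    proof -
      have "fst q \<in> carrier H" using r(2) that by (cases q) auto
      then have "s (e \<otimes>\<^bsub>H\<^esub> fst q) \<in> carrier (free_module R (carrier H))" using e by (intro sF) simp
      then show "finite {p. s (e \<otimes>\<^bsub>H\<^esub> fst q) p \<noteq> \<zero>\<^bsub>R\<^esub>}" "{p. s (e \<otimes>\<^bsub>H\<^esub> fst q) p \<noteq> \<zero>\<^bsub>R\<^esub>} \<subseteq> carrier H"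
        by (auto simp: free_module_def)
    qed
    then show "finite (supp x)" "supp x \<subseteq> carrier H" unfolding supp_def using r(1) by blast+
  qed
  have suppD: "{p. s (e \<otimes>\<^bsub>H\<^esub> a) p \<noteq> \<zero>\<^bsub>R\<^esub>} \<subseteq> supp x" if "(SOME u. u \<in> \<Delta> x) (a, b) \<noteq> \<zero>\<^bsub>R\<^esub>" for a b x
    using that unfolding supp_def by force
  have t0: "t p x y = \<zero>\<^bsub>R\<^esub>" if p: "p \<notin> supp x" and x: "x \<in> carrier H" and y: "y \<in> carrier H" for p x y
  proof -
    have "t p x y = sw (\<lambda>a b. \<zero>\<^bsub>scalar\<^esub>) x"
      unfolding t_def
    proof (rule HH.tensor_lift_cong_support[OF scalar_module comult_closed[OF x]])
      fix a b assume "a \<in> carrier H" "b \<in> carrier H" "(SOME u. u \<in> \<Delta> x) (a, b) \<noteq> \<zero>\<^bsub>R\<^esub>"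
      then have "s (e \<otimes>\<^bsub>H\<^esub> a) p = \<zero>\<^bsub>R\<^esub>" "\<phi> (y \<otimes>\<^bsub>H\<^esub> S b) \<in> carrier R"
        using suppD p \<phi>c y by auto
      then show "s (e \<otimes>\<^bsub>H\<^esub> a) p \<otimes>\<^bsub>R\<^esub> \<phi> (y \<otimes>\<^bsub>H\<^esub> S b) = \<zero>\<^bsub>scalar\<^esub>" by simp
    qed simp
    then show ?thesis using HH.tensor_lift_zero[OF scalar_module comult_closed[OF x]] by simp
  qed
  have tsum: "(\<Oplus>\<^bsub>scalar\<^esub>p\<in>I. t p x p) = \<epsilon> x \<otimes>\<^bsub>R\<^esub> \<phi> e"
    if x: "x \<in> carrier H" and I: "finite I" "supp x \<subseteq> I" "I \<subseteq> carrier H" for x I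
  proof -
    have c: "s (e \<otimes>\<^bsub>H\<^esub> a) p \<otimes>\<^bsub>R\<^esub> \<phi> (p \<otimes>\<^bsub>H\<^esub> S b) \<in> carrier R" if "a \<in> carrier H" "b \<in> carrier H" "p \<in> I" for a b p
      using that I(3) e by (intro R.m_closed spc \<phi>c) auto
    have "(\<Oplus>\<^bsub>scalar\<^esub>p\<in>I. t p x p) = sw (\<lambda>a b. \<Oplus>\<^bsub>scalar\<^esub>p\<in>I. s (e \<otimes>\<^bsub>H\<^esub> a) p \<otimes>\<^bsub>R\<^esub> \<phi> (p \<otimes>\<^bsub>H\<^esub> S b)) x"
      unfolding t_def using c by (intro HH.tensor_lift_finsum[OF scalar_module comult_closed[OF x] I(1), symmetric]) auto
    also have "\<dots> = sw (\<lambda>a b. \<phi> (e \<otimes>\<^bsub>H\<^esub> (a \<otimes>\<^bsub>H\<^esub> S b))) x"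
    proof (rule HH.tensor_lift_cong_support[OF scalar_module comult_closed[OF x]])
      fix a b assume a: "a \<in> carrier H" and b: "b \<in> carrier H"
      show "\<phi> (e \<otimes>\<^bsub>H\<^esub> (a \<otimes>\<^bsub>H\<^esub> S b)) \<in> carrier scalar" using a b e by (simp add: \<phi>c)
      assume "(SOME u. u \<in> \<Delta> x) (a, b) \<noteq> \<zero>\<^bsub>R\<^esub>"
      then have sI: "{p. s (e \<otimes>\<^bsub>H\<^esub> a) p \<noteq> \<zero>\<^bsub>R\<^esub>} \<subseteq> I" using suppD I(2) by blast
      have ea: "e \<otimes>\<^bsub>H\<^esub> a \<in> carrier H" using e a by simp
      have L: "(\<lambda>c. \<phi> (c \<otimes>\<^bsub>H\<^esub> S b)) \<in> lin_map R H scalar" using b by (intro li) auto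
      have "\<phi> (e \<otimes>\<^bsub>H\<^esub> (a \<otimes>\<^bsub>H\<^esub> S b)) = \<phi> (lin_ext R H (\<lambda>p. p) (s (e \<otimes>\<^bsub>H\<^esub> a)) \<otimes>\<^bsub>H\<^esub> S b)"
        using e a b s(2)[OF ea] by (simp add: m_assoc)
      also have "\<dots> = lin_ext R scalar (\<lambda>p. \<phi> (p \<otimes>\<^bsub>H\<^esub> S b)) (s (e \<otimes>\<^bsub>H\<^esub> a))"
        by (rule lin_map_lin_ext[OF H.left_module_axioms sc.left_module_axioms L _ sF[OF ea]]) simp
      also have "\<dots> = (\<Oplus>\<^bsub>scalar\<^esub>p\<in>I. s (e \<otimes>\<^bsub>H\<^esub> a) p \<odot>\<^bsub>scalar\<^esub> \<phi> (p \<otimes>\<^bsub>H\<^esub> S b))"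
        using b \<phi>c by (intro sc.lin_ext_superset[OF _ sF[OF ea] I(1) sI I(3)]) auto
      finally show "(\<Oplus>\<^bsub>scalar\<^esub>p\<in>I. s (e \<otimes>\<^bsub>H\<^esub> a) p \<otimes>\<^bsub>R\<^esub> \<phi> (p \<otimes>\<^bsub>H\<^esub> S b)) = \<phi> (e \<otimes>\<^bsub>H\<^esub> (a \<otimes>\<^bsub>H\<^esub> S b))" by simp
    qed
    also have "\<dots> = \<epsilon> x \<otimes>\<^bsub>R\<^esub> \<phi> (e \<otimes>\<^bsub>H\<^esub> \<one>\<^bsub>H\<^esub>)"
      using e by (intro sw_antipode(2) x li) auto
    finally show ?thesis using e by simp
  qed
  define \<sigma> where "\<sigma> x = (\<lambda>p. if p \<in> carrier H then restrict (t p x) (carrier H) else \<zero>\<^bsub>dual\<^esub>)" for x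
  have tD: "restrict (t p x) (carrier H) \<in> carrier dual" if "x \<in> carrier H" for p x
    by (intro restrict_dual ty that)
  have \<sigma>supp: "{p. \<sigma> x p \<noteq> \<zero>\<^bsub>dual\<^esub>} \<subseteq> supp x" if x: "x \<in> carrier H" for x
  proof
    fix p assume p: "p \<in> {p. \<sigma> x p \<noteq> \<zero>\<^bsub>dual\<^esub>}"
    show "p \<in> supp x"
    proof (rule ccontr)
      assume "p \<notin> supp x"
      then have "\<sigma> x p = \<zero>\<^bsub>dual\<^esub>" using t0[OF _ x] by (auto simp: \<sigma>_def dual_simps intro!: restrict_ext)
      then show False using p by simp
    qed
  qed
  have \<sigma>c: "\<sigma> x \<in> carrier (free_module dual (carrier H))" if x: "x \<in> carrier H" for x
  proof -
    have "finite {p. \<sigma> x p \<noteq> \<zero>\<^bsub>dual\<^esub>}" by (rule finite_subset[OF \<sigma>supp[OF x] supp(1)[OF x]])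
    moreover have "\<sigma> x p \<in> carrier dual" for p using tD[OF x] by (simp add: \<sigma>_def)
    ultimately show ?thesis using \<sigma>supp[OF x] supp(2)[OF x] by (auto simp: free_module_def)
  qed
  have "\<sigma> \<in> lin_map dual H_dual (free_module dual (carrier H))"
  proof (intro lin_mapI; (unfold comodule_to_module_simps)?)
    fix x assume x: "x \<in> carrier H"
    show "\<sigma> x \<in> carrier (free_module dual (carrier H))" by (rule \<sigma>c[OF x])
    fix y assume y: "y \<in> carrier H"
    have "\<sigma> (x \<oplus>\<^bsub>H\<^esub> y) p = \<sigma> x p \<oplus>\<^bsub>dual\<^esub> \<sigma> y p" for p
      using lin_mapD(2)[OF tx x y] by (auto simp: \<sigma>_def dual_simps(2,4) intro!: restrict_ext)
    then show "\<sigma> (x \<oplus>\<^bsub>H\<^esub> y) = \<sigma> x \<oplus>\<^bsub>free_module dual (carrier H)\<^esub> \<sigma> y"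
      by (auto simp: free_module_def)
  next
    fix f x assume f: "f \<in> carrier dual" and x: "x \<in> carrier H"
    note fl = dual_carrierD(1)[OF f]
    have "\<sigma> (act f x) p = f \<otimes>\<^bsub>dual\<^esub> \<sigma> x p" for p
    proof (cases "p \<in> carrier H")
      case True
      have "t p (act f x) y = sw (\<lambda>u v. f u \<otimes>\<^bsub>R\<^esub> restrict (t p x) (carrier H) v) y" if y: "y \<in> carrier H" for y
        unfolding tact[OF fl x y] using dual_carrierD(2)[OF f] tc x
        by (intro sw_cong y) auto
      then show ?thesis using True by (auto simp: \<sigma>_def dual_simps(3) intro!: restrict_ext)
    next
      case False then show ?thesis using f by (simp add: \<sigma>_def)
    qed
    then show "\<sigma> (act f x) = f \<odot>\<^bsub>free_module dual (carrier H)\<^esub> \<sigma> x"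
      by (auto simp: free_module_def)
  qed
  moreover have "lin_ext dual H_dual (\<lambda>p. p) (\<sigma> x) = \<phi> e \<odot>\<^bsub>H\<^esub> x" if x: "x \<in> carrier H" for x
  proof (rule dual_separates[OF proj])
    have idH: "(\<lambda>p. p) \<in> carrier H \<rightarrow> carrier H_dual" by (simp add: comodule_to_module_simps)
    show "lin_ext dual H_dual (\<lambda>p. p) (\<sigma> x) \<in> carrier H"
      using lin_mapD(1)[OF DM.lin_ext_lin_map[OF idH] \<sigma>c[OF x]] by (simp add: comodule_to_module_simps)
    show "\<phi> e \<odot>\<^bsub>H\<^esub> x \<in> carrier H" using x \<phi>c[OF e] by simp
    fix f assume f: "f \<in> carrier dual"
    note fl = dual_carrierD(1)[OF f] and fc = dual_carrierD(2)[OF f]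
    have ax: "act f x \<in> carrier H" by (rule act_closed[OF fl x])
    let ?I = "supp x \<union> supp (act f x)"
    have I: "finite ?I" "?I \<subseteq> carrier H" using supp[OF x] supp[OF ax] by auto
    have \<sigma>p: "\<sigma> x p \<in> lin_map R H scalar" if "p \<in> ?I" for p
      using that I(2) tD[OF x] by (auto simp: \<sigma>_def intro: dual_carrierD(1))
    \<comment> \<open>The value of \<open>f\<close> at \<open>t\<^sub>p(x) \<cdot> p\<close> is \<open>(f * t\<^sub>p(x))(p) = t\<^sub>p(f \<cdot> x)(p)\<close>, so the sum to be computed is
      \<open>tsum\<close> at \<open>f \<cdot> x\<close>.\<close>
    have "lin_ext dual H_dual (\<lambda>p. p) (\<sigma> x) = (\<Oplus>\<^bsub>H_dual\<^esub>p\<in>?I. \<sigma> x p \<odot>\<^bsub>H_dual\<^esub> p)"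
      using \<sigma>supp[OF x] by (intro DM.lin_ext_superset[OF idH \<sigma>c[OF x] I(1) _ I(2)]) auto
    also have "\<dots> = (\<Oplus>\<^bsub>H\<^esub>p\<in>?I. act (\<sigma> x p) p)"
      by (simp add: comodule_to_module_finsum comodule_to_module_simps)
    finally have "f (lin_ext dual H_dual (\<lambda>p. p) (\<sigma> x)) = f (\<Oplus>\<^bsub>H\<^esub>p\<in>?I. act (\<sigma> x p) p)" by simp
    also have "\<dots> = (\<Oplus>\<^bsub>scalar\<^esub>p\<in>?I. f (act (\<sigma> x p) p))"
      using I(2) \<sigma>p
      by (intro lin_map_finsum[OF H.left_module_axioms sc.left_module_axioms fl I(1)] funcsetI act_closed) auto
    also have "\<dots> = (\<Oplus>\<^bsub>scalar\<^esub>p\<in>?I. t p (act f x) p)"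
    proof (intro sc.M.finsum_cong' refl funcsetI)
      fix p assume pI: "p \<in> ?I"
      then have p: "p \<in> carrier H" using I(2) by blast
      show "t p (act f x) p \<in> carrier scalar" using tc[OF ax p] by simp
      have "f (act (\<sigma> x p) p) = sw (\<lambda>u v. \<sigma> x p v \<otimes>\<^bsub>R\<^esub> f u) p" by (rule lin_act[OF \<sigma>p[OF pI] fl p])
      also have "\<dots> = sw (\<lambda>u v. f u \<otimes>\<^bsub>R\<^esub> t p x v) p"
        using fc tc x p by (intro sw_cong p) (auto simp: \<sigma>_def R.m_comm)
      also have "\<dots> = t p (act f x) p" by (rule tact[OF fl x p, symmetric])
      finally show "f (act (\<sigma> x p) p) = t p (act f x) p" .
    qed
    also have "\<dots> = \<epsilon> (act f x) \<otimes>\<^bsub>R\<^esub> \<phi> e" by (rule tsum[OF ax I(1) _ I(2)]) simp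
    also have "\<epsilon> (act f x) = f x"
    proof -
      have "\<epsilon> (act f x) = sw (\<lambda>a c. \<epsilon> a \<otimes>\<^bsub>R\<^esub> f c) x"
        unfolding lin_act[OF fl counit x] using fc counit_closed by (intro sw_cong x) (auto simp: R.m_comm)
      then show ?thesis using sw_counit(2)[OF fl x] by simp
    qed
    also have "f x \<otimes>\<^bsub>R\<^esub> \<phi> e = f (\<phi> e \<odot>\<^bsub>H\<^esub> x)"
      using lin_mapD(3)[OF fl \<phi>c[OF e] x] fc[OF x] \<phi>c[OF e] by (simp add: R.m_comm)
    finally show "f (lin_ext dual H_dual (\<lambda>p. p) (\<sigma> x)) = f (\<phi> e \<odot>\<^bsub>H\<^esub> x)" .
  qed
  ultimately show thesis by (rule that)
qed

text \<open>The map \<open>\<psi>\<close> is the fraction \<open>(c / b) \<phi>\<close>; its properties follow from those of \<open>\<phi>\<close> by cancelling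
  \<open>b\<close>.\<close>

lemma integral_form_divide:
  assumes R: "domain R" and \<phi>: "integral_form \<phi>" and b: "b \<in> carrier R" "b \<noteq> \<zero>\<^bsub>R\<^esub>" and c: "c \<in> carrier R"
    and \<psi>: "\<And>h. h \<in> carrier H \<Longrightarrow> \<psi> h \<in> carrier R" "\<And>h. h \<in> carrier H \<Longrightarrow> c \<otimes>\<^bsub>R\<^esub> \<phi> h = b \<otimes>\<^bsub>R\<^esub> \<psi> h"
  shows "integral_form \<psi>"
proof -
  interpret D: domain R by fact
  have \<phi>l: "\<phi> \<in> lin_map R H scalar" using \<phi> by (simp add: integral_form_def)
  note \<phi>D = lin_mapD[OF \<phi>l, simplified]
  have l: "\<psi> \<in> lin_map R H scalar"
  proof (rule lin_mapI; simp?)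
    fix x y assume x: "x \<in> carrier H" and y: "y \<in> carrier H"
    show "\<psi> x \<in> carrier R" by (rule \<psi>(1)[OF x])
    have "b \<otimes>\<^bsub>R\<^esub> \<psi> (x \<oplus>\<^bsub>H\<^esub> y) = b \<otimes>\<^bsub>R\<^esub> (\<psi> x \<oplus>\<^bsub>R\<^esub> \<psi> y)"
      using x y b c \<psi>(1) \<phi>D by (simp add: R.r_distr flip: \<psi>(2))
    then show "\<psi> (x \<oplus>\<^bsub>H\<^esub> y) = \<psi> x \<oplus>\<^bsub>R\<^esub> \<psi> y"
      using x y b \<psi>(1) by (simp add: D.m_lcancel)
  next
    fix a x assume a: "a \<in> carrier R" and x: "x \<in> carrier H"
    have "b \<otimes>\<^bsub>R\<^esub> \<psi> (a \<odot>\<^bsub>H\<^esub> x) = a \<otimes>\<^bsub>R\<^esub> (c \<otimes>\<^bsub>R\<^esub> \<phi> x)"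
      using x a c \<phi>D by (simp add: R.m_lcomm flip: \<psi>(2))
    also have "\<dots> = b \<otimes>\<^bsub>R\<^esub> (a \<otimes>\<^bsub>R\<^esub> \<psi> x)" using x a b \<psi>(1) by (simp add: \<psi>(2) R.m_lcomm)
    finally show "\<psi> (a \<odot>\<^bsub>H\<^esub> x) = a \<otimes>\<^bsub>R\<^esub> \<psi> x"
      using x a b \<psi>(1) by (simp add: D.m_lcancel)
  qed
  have "sw (\<lambda>x y. f x \<otimes>\<^bsub>R\<^esub> \<psi> y) h = f \<one>\<^bsub>H\<^esub> \<otimes>\<^bsub>R\<^esub> \<psi> h" if f: "f \<in> lin_map R H scalar" and h: "h \<in> carrier H" for f h
  proof -
    note fc = lin_mapD(1)[OF f, simplified]
    have "b \<otimes>\<^bsub>R\<^esub> sw (\<lambda>x y. f x \<otimes>\<^bsub>R\<^esub> \<psi> y) h = sw (\<lambda>x y. b \<otimes>\<^bsub>R\<^esub> (f x \<otimes>\<^bsub>R\<^esub> \<psi> y)) h"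
      using fc \<psi>(1) b by (intro sw_scalar_mult(1)[symmetric] h) auto
    also have "\<dots> = sw (\<lambda>x y. c \<otimes>\<^bsub>R\<^esub> (f x \<otimes>\<^bsub>R\<^esub> \<phi> y)) h"
    proof (rule sw_cong[OF h])
      fix x y assume x: "x \<in> carrier H" and y: "y \<in> carrier H"
      show "c \<otimes>\<^bsub>R\<^esub> (f x \<otimes>\<^bsub>R\<^esub> \<phi> y) \<in> carrier R" using x y fc \<phi>D c by simp
      have "b \<otimes>\<^bsub>R\<^esub> (f x \<otimes>\<^bsub>R\<^esub> \<psi> y) = f x \<otimes>\<^bsub>R\<^esub> (b \<otimes>\<^bsub>R\<^esub> \<psi> y)" using x y fc \<psi>(1) b by (intro R.m_lcomm) auto
      also have "\<dots> = f x \<otimes>\<^bsub>R\<^esub> (c \<otimes>\<^bsub>R\<^esub> \<phi> y)" using \<psi>(2)[OF y] by simp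
      also have "\<dots> = c \<otimes>\<^bsub>R\<^esub> (f x \<otimes>\<^bsub>R\<^esub> \<phi> y)" using x y fc \<phi>D c by (intro R.m_lcomm) auto
      finally show "b \<otimes>\<^bsub>R\<^esub> (f x \<otimes>\<^bsub>R\<^esub> \<psi> y) = c \<otimes>\<^bsub>R\<^esub> (f x \<otimes>\<^bsub>R\<^esub> \<phi> y)" .
    qed
    also have "\<dots> = c \<otimes>\<^bsub>R\<^esub> sw (\<lambda>x y. f x \<otimes>\<^bsub>R\<^esub> \<phi> y) h"
      using fc \<phi>D c by (intro sw_scalar_mult(1) h) auto
    also have "\<dots> = c \<otimes>\<^bsub>R\<^esub> (f \<one>\<^bsub>H\<^esub> \<otimes>\<^bsub>R\<^esub> \<phi> h)" using \<phi> f h by (simp add: integral_form_def)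
    also have "\<dots> = f \<one>\<^bsub>H\<^esub> \<otimes>\<^bsub>R\<^esub> (c \<otimes>\<^bsub>R\<^esub> \<phi> h)" using h fc \<phi>D c by (intro R.m_lcomm) auto
    also have "\<dots> = f \<one>\<^bsub>H\<^esub> \<otimes>\<^bsub>R\<^esub> (b \<otimes>\<^bsub>R\<^esub> \<psi> h)" using \<psi>(2)[OF h] by simp
    also have "\<dots> = b \<otimes>\<^bsub>R\<^esub> (f \<one>\<^bsub>H\<^esub> \<otimes>\<^bsub>R\<^esub> \<psi> h)" using h fc \<psi>(1) b by (intro R.m_lcomm) auto
    finally have "b \<otimes>\<^bsub>R\<^esub> sw (\<lambda>x y. f x \<otimes>\<^bsub>R\<^esub> \<psi> y) h = b \<otimes>\<^bsub>R\<^esub> (f \<one>\<^bsub>H\<^esub> \<otimes>\<^bsub>R\<^esub> \<psi> h)" .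
    moreover have "sw (\<lambda>x y. f x \<otimes>\<^bsub>R\<^esub> \<psi> y) h \<in> carrier R" using fc \<psi>(1) by (intro sw_closed h) auto
    ultimately show ?thesis using h b \<psi>(1) fc by (simp add: D.m_lcancel)
  qed
  then show ?thesis using l by (simp add: integral_form_def)
qed

text \<open>Given a lifting problem of \<open>f\<close> along \<open>g\<close>, the scalars \<open>r\<close> for which \<open>r f\<close> lifts form an ideal \<open>J\<close>. By
  \<open>integral_factorization\<close> it contains all values of all integrals, in particular those of the fractions
  \<open>(c / b) \<phi>\<close> with values in \<open>R\<close>. So \<open>J\<close> contains \<open>I\<^sup>-\<^sup>1 I\<close> for \<open>I = \<phi>(H)\<close>, and \<open>trace_ideal_unit\<close> yields
  \<open>1 \<in> J\<close>.\<close>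

lemma nonzero_integral_imp_projective:
  assumes R: "dedekind_ring R" and proj: "projective_module R H"
    and \<phi>: "integral_form \<phi>" and nz: "h \<in> carrier H" "\<phi> h \<noteq> \<zero>\<^bsub>R\<^esub>"
  shows "projective_module dual H_dual"
  unfolding projective_module_def
proof (intro conjI allI impI dual_module)
  interpret Dr: dedekind_ring R by fact
  interpret D: ring dual by (rule dual_ring)
  interpret DM: left_module dual H_dual by (rule dual_module)
  fix M :: "('h \<Rightarrow> 'r, 'h \<Rightarrow> 'h \<Rightarrow> 'r) module" and N :: "('h \<Rightarrow> 'r, 'h) module"
  assume M: "left_module dual M" and N: "left_module dual N"
  interpret M: left_module dual M by fact
  interpret N: left_module dual N by fact
  show "lifting_property dual H_dual M N"
    unfolding lifting_property_def comodule_to_module_simps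
  proof (intro ballI impI)
    fix g f assume g: "g \<in> lin_map dual M N" and f: "f \<in> lin_map dual H_dual N" and surj: "g ` carrier M = carrier N"
    note gD = lin_mapD[OF g] and fD = lin_mapD[OF f, unfolded comodule_to_module_simps]
    have "\<forall>p\<in>carrier H. \<exists>m. m \<in> carrier M \<and> g m = f p"
    proof
      fix p assume "p \<in> carrier H"
      then have "f p \<in> g ` carrier M" using fD(1) surj by simp
      then show "\<exists>m. m \<in> carrier M \<and> g m = f p" by auto
    qed
    then obtain m where "\<forall>p\<in>carrier H. m p \<in> carrier M \<and> g (m p) = f p" by (rule bchoice[THEN exE])
    then have m: "m \<in> carrier H \<rightarrow> carrier M" and gm: "\<And>p. p \<in> carrier H \<Longrightarrow> g (m p) = f p" by auto
    define J where "J = {r \<in> carrier R. \<exists>k\<in>lin_map dual H_dual M. \<forall>x\<in>carrier H. g (k x) = f (r \<odot>\<^bsub>H\<^esub> x)}"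
    have Jint: "\<psi> e \<in> J" if \<psi>: "integral_form \<psi>" and e: "e \<in> carrier H" for \<psi> e
    proof -
      obtain \<sigma> where \<sigma>: "\<sigma> \<in> lin_map dual H_dual (free_module dual (carrier H))"
        "\<And>x. x \<in> carrier H \<Longrightarrow> lin_ext dual H_dual (\<lambda>p. p) (\<sigma> x) = \<psi> e \<odot>\<^bsub>H\<^esub> x"
        by (rule integral_factorization[OF proj \<psi> e]) blast
      note \<sigma>D = lin_mapD[OF \<sigma>(1), unfolded comodule_to_module_simps]
      note L = lin_mapD[OF M.lin_ext_lin_map[OF m]]
      have "(\<lambda>x. lin_ext dual M m (\<sigma> x)) \<in> lin_map dual H_dual M"
        using L \<sigma>D by (intro lin_mapI) (simp_all add: comodule_to_module_simps)
      moreover have "g (lin_ext dual M m (\<sigma> x)) = f (\<psi> e \<odot>\<^bsub>H\<^esub> x)" if x: "x \<in> carrier H" for x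
      proof -
        have \<sigma>s: "{p. \<sigma> x p \<noteq> \<zero>\<^bsub>dual\<^esub>} \<subseteq> carrier H" "\<And>p. \<sigma> x p \<in> carrier dual"
          using \<sigma>D(1)[OF x] by (auto simp: free_module_def)
        have "g (lin_ext dual M m (\<sigma> x)) = lin_ext dual N (\<lambda>p. g (m p)) (\<sigma> x)"
          by (rule lin_map_lin_ext[OF M N g m \<sigma>D(1)[OF x]])
        also have "\<dots> = lin_ext dual N f (\<sigma> x)"
          unfolding lin_ext_def using \<sigma>s gm fD(1) by (intro N.M.finsum_cong') auto
        also have "\<dots> = f (lin_ext dual H_dual (\<lambda>p. p) (\<sigma> x))"
          by (rule lin_map_lin_ext[OF dual_module N f _ \<sigma>D(1)[OF x], symmetric]) (simp add: comodule_to_module_simps)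
        finally show ?thesis using \<sigma>(2)[OF x] by simp
      qed
      moreover have "\<psi> e \<in> carrier R" using \<psi> lin_mapD(1)[of \<psi> R H scalar e] e by (simp add: integral_form_def)
      ultimately show ?thesis unfolding J_def by (intro CollectI conjI bexI[of _ "\<lambda>x. lin_ext dual M m (\<sigma> x)"]) auto
    qed
    have Jmult: "a \<otimes>\<^bsub>R\<^esub> r \<in> J" if r: "r \<in> J" and a: "a \<in> carrier R" for r a
    proof -
      obtain k where k: "k \<in> lin_map dual H_dual M" "\<And>x. x \<in> carrier H \<Longrightarrow> g (k x) = f (r \<odot>\<^bsub>H\<^esub> x)" and rR: "r \<in> carrier R"
        using r by (auto simp: J_def)
      note kD = lin_mapD[OF k(1), unfolded comodule_to_module_simps]
      have "act u (a \<odot>\<^bsub>H\<^esub> x) = a \<odot>\<^bsub>H\<^esub> act u x" if u: "u \<in> carrier dual" and x: "x \<in> carrier H" for u x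
        using lin_mapD(3)[OF tensor_lift_lin_map[OF cring module module module coaction_bilinear[OF module dual_carrierD(1)[OF u]]] a comult_closed[OF x]]
          lin_mapD(3)[OF coaction a x] by simp
      then have "(\<lambda>x. k (a \<odot>\<^bsub>H\<^esub> x)) \<in> lin_map dual H_dual M"
        using kD a by (intro lin_mapI) (auto simp: comodule_to_module_simps H.smult_r_distr simp flip: kD(3))
      moreover have "g (k (a \<odot>\<^bsub>H\<^esub> x)) = f ((a \<otimes>\<^bsub>R\<^esub> r) \<odot>\<^bsub>H\<^esub> x)" if "x \<in> carrier H" for x
        using k(2) a rR that by (simp add: H.smult_assoc1[symmetric] R.m_comm)
      ultimately show ?thesis unfolding J_def using a rR
        by (intro CollectI conjI bexI[of _ "\<lambda>x. k (a \<odot>\<^bsub>H\<^esub> x)"]) auto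
    qed
    have Jadd: "r \<oplus>\<^bsub>R\<^esub> r' \<in> J" if r: "r \<in> J" and r': "r' \<in> J" for r r'
    proof -
      obtain k where k: "k \<in> lin_map dual H_dual M" "\<And>x. x \<in> carrier H \<Longrightarrow> g (k x) = f (r \<odot>\<^bsub>H\<^esub> x)" and rR: "r \<in> carrier R"
        using r by (auto simp: J_def)
      obtain k' where k': "k' \<in> lin_map dual H_dual M" "\<And>x. x \<in> carrier H \<Longrightarrow> g (k' x) = f (r' \<odot>\<^bsub>H\<^esub> x)" and rR': "r' \<in> carrier R"
        using r' by (auto simp: J_def)
      note kD = lin_mapD[OF k(1)] and kD' = lin_mapD[OF k'(1)]
      have "(\<lambda>x. k x \<oplus>\<^bsub>M\<^esub> k' x) \<in> lin_map dual H_dual M"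
        using kD kD' by (intro lin_mapI) (auto simp: M.smult_r_distr M.M.a_ac)
      moreover have "g (k x \<oplus>\<^bsub>M\<^esub> k' x) = f ((r \<oplus>\<^bsub>R\<^esub> r') \<odot>\<^bsub>H\<^esub> x)" if "x \<in> carrier H" for x
        using k(2) k'(2) kD(1) kD'(1) gD(2) rR rR' fD(2) that by (simp add: H.smult_l_distr comodule_to_module_simps)
      ultimately show ?thesis unfolding J_def using rR rR'
        by (intro CollectI conjI bexI[of _ "\<lambda>x. k x \<oplus>\<^bsub>M\<^esub> k' x"]) auto
    qed
    have "ideal J R"
    proof (rule idealI[OF R.ring_axioms])
      show "subgroup J (add_monoid R)"
      proof (rule R.add.subgroupI)
        show "J \<subseteq> carrier R" by (auto simp: J_def)
        show "J \<noteq> {}" using Jint[OF \<phi> nz(1)] by auto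
        show "\<ominus>\<^bsub>R\<^esub> a \<in> J" if "a \<in> J" for a
          using Jmult[OF that, of "\<ominus>\<^bsub>R\<^esub> \<one>\<^bsub>R\<^esub>"] that by (simp add: R.l_minus J_def)
      qed (rule Jadd)
      show "x \<otimes>\<^bsub>R\<^esub> a \<in> J" "a \<otimes>\<^bsub>R\<^esub> x \<in> J" if "a \<in> J" "x \<in> carrier R" for a x
      proof -
        have "a \<in> carrier R" using that by (simp add: J_def)
        then show "x \<otimes>\<^bsub>R\<^esub> a \<in> J" "a \<otimes>\<^bsub>R\<^esub> x \<in> J" using Jmult[OF that] that(2) by (simp_all add: R.m_comm)
      qed
    qed
    have \<phi>c: "\<phi> x \<in> carrier R" if "x \<in> carrier H" for x
      using \<phi> lin_mapD(1)[of \<phi> R H scalar x] that by (simp add: integral_form_def)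
    have "J = carrier R"
    proof (rule Dr.trace_ideal_unit[of "\<phi> ` carrier H"])
      show "\<phi> ` carrier H \<subseteq> carrier R" "\<phi> ` carrier H \<noteq> {}" "\<phi> ` carrier H \<noteq> {\<zero>\<^bsub>R\<^esub>}"
        using \<phi>c nz by auto
      show "ideal J R" by fact
      fix b c x y
      assume b: "b \<in> carrier R" "b \<noteq> \<zero>\<^bsub>R\<^esub>" and c: "c \<in> carrier R"
        and ex: "\<And>x. x \<in> \<phi> ` carrier H \<Longrightarrow> \<exists>y\<in>carrier R. c \<otimes>\<^bsub>R\<^esub> x = b \<otimes>\<^bsub>R\<^esub> y"
        and x: "x \<in> \<phi> ` carrier H" and y: "y \<in> carrier R" "c \<otimes>\<^bsub>R\<^esub> x = b \<otimes>\<^bsub>R\<^esub> y"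
      have "\<forall>h\<in>carrier H. \<exists>y. y \<in> carrier R \<and> c \<otimes>\<^bsub>R\<^esub> \<phi> h = b \<otimes>\<^bsub>R\<^esub> y" using ex by blast
      then obtain \<psi> where \<psi>: "\<forall>h\<in>carrier H. \<psi> h \<in> carrier R \<and> c \<otimes>\<^bsub>R\<^esub> \<phi> h = b \<otimes>\<^bsub>R\<^esub> \<psi> h"
        by (rule bchoice[THEN exE])
      then have \<psi>i: "integral_form \<psi>"
        by (intro integral_form_divide[OF Dr.domain_axioms \<phi> b c]) auto
      obtain e where e: "e \<in> carrier H" "x = \<phi> e" using x by auto
      have "b \<otimes>\<^bsub>R\<^esub> \<psi> e = b \<otimes>\<^bsub>R\<^esub> y" using \<psi> e y by auto
      then have "\<psi> e = y" using \<psi> e y b by (simp add: Dr.m_lcancel)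
      then show "y \<in> J" using Jint[OF \<psi>i e(1)] by simp
    qed
    then have "\<one>\<^bsub>R\<^esub> \<in> J" by simp
    then show "\<exists>k\<in>lin_map dual H_dual M. \<forall>x\<in>carrier H. g (k x) = f x"
      by (auto simp: J_def)
  qed
qed

text \<open>A coordinate of a dual basis is a map \<open>s\<close> from \<open>H\<close> to the dual algebra that is linear over the dual
  algebra, so \<open>\<phi> = s(1)\<close> satisfies \<open>f * \<phi> = s(f \<cdot> 1) = f(1) \<phi>\<close>. Not all coordinates of \<open>1\<close> vanish, since
  \<open>\<epsilon>(1) = 1\<close> makes \<open>1\<close> non-zero in \<open>H\<close>.\<close>

lemma projective_imp_nonzero_integral:
  assumes nontriv: "\<one>\<^bsub>R\<^esub> \<noteq> \<zero>\<^bsub>R\<^esub>" and dproj: "projective_module dual H_dual"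
  obtains \<phi> h where "integral_form \<phi>" "h \<in> carrier H" "\<phi> h \<noteq> \<zero>\<^bsub>R\<^esub>"
proof -
  interpret D: ring dual by (rule dual_ring)
  obtain s where s: "s \<in> lin_map dual H_dual (free_module dual (carrier H_dual))"
    "\<And>x. x \<in> carrier H_dual \<Longrightarrow> lin_ext dual H_dual (\<lambda>p. p) (s x) = x"
    by (rule projective_module_dual_basis[OF dproj]) blast
  note sD = lin_mapD[OF s(1), unfolded comodule_to_module_simps]
  have "\<exists>p. s \<one>\<^bsub>H\<^esub> p \<noteq> \<zero>\<^bsub>dual\<^esub>"
  proof (rule ccontr)
    assume "\<nexists>p. s \<one>\<^bsub>H\<^esub> p \<noteq> \<zero>\<^bsub>dual\<^esub>"
    then have "lin_ext dual H_dual (\<lambda>p. p) (s \<one>\<^bsub>H\<^esub>) = \<zero>\<^bsub>H\<^esub>"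
      by (simp add: lin_ext_def comodule_to_module_finsum)
    then have "\<one>\<^bsub>H\<^esub> = \<zero>\<^bsub>H\<^esub>" using s(2)[of "\<one>\<^bsub>H\<^esub>"] by (simp add: comodule_to_module_simps)
    then have "\<epsilon> \<one>\<^bsub>H\<^esub> = \<zero>\<^bsub>scalar\<^esub>"
      using lin_map_zero[OF H.left_module_axioms module_imp_left_module[OF scalar_module] counit] by simp
    then show False using nontriv counit_one by simp
  qed
  then obtain p where p: "s \<one>\<^bsub>H\<^esub> p \<noteq> \<zero>\<^bsub>dual\<^esub>" by blast
  define \<phi> where "\<phi> = s \<one>\<^bsub>H\<^esub> p"
  have \<phi>: "\<phi> \<in> carrier dual" using sD(1)[OF one_closed] by (auto simp: \<phi>_def free_module_def)
  note \<phi>l = dual_carrierD(1)[OF \<phi>] and \<phi>c = dual_carrierD(2)[OF \<phi>]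
  have conv: "f \<otimes>\<^bsub>dual\<^esub> \<phi> = s (f \<one>\<^bsub>H\<^esub> \<odot>\<^bsub>H\<^esub> \<one>\<^bsub>H\<^esub>) p" if f: "f \<in> carrier dual" for f
    using sD(3)[OF f one_closed] act_one[OF dual_carrierD(1)[OF f]] by (simp add: \<phi>_def free_module_def)
  have "sw (\<lambda>x y. f x \<otimes>\<^bsub>R\<^esub> \<phi> y) h = f \<one>\<^bsub>H\<^esub> \<otimes>\<^bsub>R\<^esub> \<phi> h" if f: "f \<in> lin_map R H scalar" and h: "h \<in> carrier H" for f h
  proof -
    note fc = lin_mapD(1)[OF f, simplified]
    \<comment> \<open>\<open>f\<close> and \<open>f(1) \<epsilon>\<close> act in the same way on \<open>1\<close>.\<close>
    let ?f = "restrict f (carrier H)" let ?e = "\<lambda>c\<in>carrier H. f \<one>\<^bsub>H\<^esub> \<otimes>\<^bsub>R\<^esub> \<epsilon> c"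
    have e: "?e \<in> carrier dual" by (intro restrict_dual lin_scalar_mult counit fc one_closed)
    have "?f \<otimes>\<^bsub>dual\<^esub> \<phi> = ?e \<otimes>\<^bsub>dual\<^esub> \<phi>"
      using conv[OF restrict_dual[OF f]] conv[OF e] fc[OF one_closed] by (simp add: counit_one)
    then have "(?f \<otimes>\<^bsub>dual\<^esub> \<phi>) h = (?e \<otimes>\<^bsub>dual\<^esub> \<phi>) h" by simp
    then have *: "sw (\<lambda>x y. ?f x \<otimes>\<^bsub>R\<^esub> \<phi> y) h = sw (\<lambda>x y. ?e x \<otimes>\<^bsub>R\<^esub> \<phi> y) h"
      using h by (simp add: dual_simps(3))
    have "sw (\<lambda>x y. f x \<otimes>\<^bsub>R\<^esub> \<phi> y) h = sw (\<lambda>x y. ?f x \<otimes>\<^bsub>R\<^esub> \<phi> y) h"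
      using fc \<phi>c by (intro sw_cong h) auto
    also note *
    also have "sw (\<lambda>x y. ?e x \<otimes>\<^bsub>R\<^esub> \<phi> y) h = sw (\<lambda>x y. f \<one>\<^bsub>H\<^esub> \<otimes>\<^bsub>R\<^esub> (\<epsilon> x \<otimes>\<^bsub>R\<^esub> \<phi> y)) h"
      using fc[OF one_closed] \<phi>c counit_closed by (intro sw_cong h) (auto simp: R.m_assoc)
    also have "\<dots> = f \<one>\<^bsub>H\<^esub> \<otimes>\<^bsub>R\<^esub> sw (\<lambda>x y. \<epsilon> x \<otimes>\<^bsub>R\<^esub> \<phi> y) h"
      using fc[OF one_closed] \<phi>c counit_closed by (intro sw_scalar_mult(1) h) auto
    finally show ?thesis using sw_counit(2)[OF \<phi>l h] by simp
  qed
  then have "integral_form \<phi>" using \<phi>l by (simp add: integral_form_def)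
  moreover have "\<exists>h\<in>carrier H. \<phi> h \<noteq> \<zero>\<^bsub>R\<^esub>"
  proof (rule ccontr)
    assume "\<not> ?thesis"
    then have "\<phi> = \<zero>\<^bsub>dual\<^esub>" by (intro dual_eqI \<phi> D.zero_closed) (simp add: dual_simps)
    then show False using p by (simp add: \<phi>_def)
  qed
  ultimately show thesis using that by blast
qed

end

theorem proposition4p9:
  fixes R :: "('r, 'k) ring_scheme" and H :: "('r, 'h) module"
    and \<Delta> :: "'h \<Rightarrow> ('h \<times> 'h \<Rightarrow> 'r) set" and \<epsilon> :: "'h \<Rightarrow> 'r" and S :: "'h \<Rightarrow> 'h"
  assumes "dedekind_ring R"
    and "hopf_algebra R H \<Delta> \<epsilon> S"
    and "projective_module R H"
  shows "((\<exists>\<phi>. left_integral R H \<Delta> \<phi> \<and> (\<exists>h\<in>carrier H. \<phi> h \<noteq> \<zero>\<^bsub>R\<^esub>))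
            \<longleftrightarrow> projective_module (dual_algebra R H \<Delta> \<epsilon>) (comodule_to_module R H \<Delta>))
       \<and> ((\<exists>\<phi>. left_integral R H \<Delta> \<phi> \<and> (\<exists>h\<in>carrier H. \<phi> h \<noteq> \<zero>\<^bsub>R\<^esub>))
            \<longrightarrow> projective_comodule TYPE('m) TYPE('n) R H \<Delta> \<epsilon> H \<Delta>)"
proof -
  interpret R: dedekind_ring R by fact
  interpret H: hopf_algebra R H \<Delta> \<epsilon> S by fact
  let ?int = "\<exists>\<phi>. left_integral R H \<Delta> \<phi> \<and> (\<exists>h\<in>carrier H. \<phi> h \<noteq> \<zero>\<^bsub>R\<^esub>)"
  have 1: "projective_module (dual_algebra R H \<Delta> \<epsilon>) (comodule_to_module R H \<Delta>)" if int: ?int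
  proof -
    obtain \<phi> h where "left_integral R H \<Delta> \<phi>" "h \<in> carrier H" "\<phi> h \<noteq> \<zero>\<^bsub>R\<^esub>" using int by blast
    then show ?thesis
      by (intro H.nonzero_integral_imp_projective[OF assms(1,3)] H.left_integral_imp_integral_form)
  qed
  have 2: ?int if p: "projective_module (dual_algebra R H \<Delta> \<epsilon>) (comodule_to_module R H \<Delta>)"
  proof -
    obtain \<phi> h where \<phi>: "H.integral_form \<phi>" "h \<in> carrier H" "\<phi> h \<noteq> \<zero>\<^bsub>R\<^esub>"
      by (rule H.projective_imp_nonzero_integral[OF R.one_not_zero p]) blast
    then show ?int using H.integral_form_imp_left_integral[OF assms(3)] by blast
  qed
  have 3: "projective_comodule TYPE('m) TYPE('n) R H \<Delta> \<epsilon> H \<Delta>" if ?int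
    by (rule H.dual_projective_imp_projective_comodule[OF assms(3) H.right_comodule_axioms 1[OF that]])
  show ?thesis using 1 2 3 by blast
qed

end
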